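(* Let $\mathcal{A}$ be a finite nonempty set and let $M:\mathcal{A}\times\mathcal{A}\to\mathbb{N}_0$ satisfy (M1) $M_{j,j}\ge 1$ for all $j\in\mathcal{A}$, and (M2) there is $n\in\mathbb{N}$ such that all entries of $M^n$ are positive; if $\mathcal{A}$ has exactly one element, assume moreover that the number $M$ is at least $2$. Then there exist finitely many intervals in $\mathbb{R}$ such that for every $j\in\mathcal{A}$ the spectrum of the operator $L$ associated with the tree $\mathbb{T}(M,j)$ consists of exactly these intervals (i.e. is their union) and is purely absolutely continuous.
   Context: A tree is a connected graph without cycles. In a tree with a distinguished root $o$, $|x|=d(x,o)$ denotes the graph distance to the root, and the $n$-th sphere is the set of vertices with $|x|=n$. Tree $\mathbb{T}(M,j)$: given $M:\mathcal{A}\times\mathcal{A}\to\mathbb{N}_0$ and $j\in\mathcal{A}$, one constructs inductively a rooted tree with vertex set $V$ together with a labeling $a:V\to\mathcal{A}$. The root gets the label $j$. Each vertex with label $k\in\mathcal{A}$ in the $n$-th sphere is joined by single undirected edges to exactly $M_{i,k}$ vertices with label $i$ of the $(n+1)$-th sphere, for every $i\in\mathcal{A}$ (each vertex other than the root having exactly one neighbor in the previous sphere). Operator: $L$ is the adjacency operator on $\ell^2(V)$, $(L\varphi)(x)=\sum_{y\sim x}\varphi(y)$, where $y\sim x$ means that $x$ and $y$ are joined by an edge; it is bounded and self-adjoint. "Purely absolutely continuous spectrum" means all spectral measures of $L$ are absolutely continuous with respect to Lebesgue measure. *)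

theory Defs
  imports "HOL-Analysis.Analysis"
begin

definition mat_pow :: "nat ^ 'a ^ 'a \<Rightarrow> nat \<Rightarrow> nat ^ 'a ^ 'a"
  where "mat_pow M n = (((**) M) ^^ n) (mat 1)"


section \<open>The tree generated by a substitution matrix\<close>

text \<open>
  A vertex is encoded by the path leading to it from the root \<open>[]\<close>, most recent step first.
  A step \<open>(i, m)\<close> goes to the \<open>m\<close>-th of the \<open>M $ i $ k\<close> forward neighbours with label \<open>i\<close> of a
  vertex with label \<open>k\<close>. The vertices of the \<open>n\<close>-th sphere are those of length \<open>n\<close>.
\<close>

type_synonym 'a vertex = "('a \<times> nat) list"

fun vertex_label :: "'a \<Rightarrow> 'a vertex \<Rightarrow> 'a" where
  "vertex_label j [] = j"
| "vertex_label j ((i, m) # x) = i"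

inductive_set tree_vertices :: "nat ^ 'a ^ 'a \<Rightarrow> 'a \<Rightarrow> ('a::finite) vertex set"
  for M :: "nat ^ 'a ^ 'a" and j :: 'a
where
  root: "[] \<in> tree_vertices M j"
| step: "x \<in> tree_vertices M j \<Longrightarrow> m < M $ i $ vertex_label j x \<Longrightarrow> (i, m) # x \<in> tree_vertices M j"

definition tree_adj :: "nat ^ 'a ^ 'a \<Rightarrow> 'a \<Rightarrow> ('a::finite) vertex \<Rightarrow> 'a vertex \<Rightarrow> bool" where
  "tree_adj M j x y \<longleftrightarrow> x \<in> tree_vertices M j \<and> y \<in> tree_vertices M j \<and>
     (\<exists>c. y = c # x \<or> x = c # y)"

lemma card_forward_neighbours:
  assumes "x \<in> tree_vertices M j"
  shows "card {y. tree_adj M j x y \<and> length y = Suc (length x) \<and> vertex_label j y = i}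
           = M $ i $ vertex_label j x"
proof -
  have "{y. tree_adj M j x y \<and> length y = Suc (length x) \<and> vertex_label j y = i}
          = (\<lambda>m. (i, m) # x) ` {..<M $ i $ vertex_label j x}"
    using assms by (auto simp: tree_adj_def intro: tree_vertices.intros elim: tree_vertices.cases)
  thus ?thesis
    by (simp add: card_image inj_on_def)
qed


section \<open>Operators on the Hilbert space of square-summable functions\<close>

text \<open>
  Elements of \<open>\<ell>\<^sup>2(V)\<close> are functions on the ambient type that vanish outside \<open>V\<close>, so that equality
  in \<open>\<ell>\<^sup>2(V)\<close> is equality of functions. The inner product is linear in the second argument.
\<close>

definition ell2 :: "'v set \<Rightarrow> ('v \<Rightarrow> complex) set" where
  "ell2 V = {\<phi>. (\<forall>x. x \<notin> V \<longrightarrow> \<phi> x = 0) \<and> (\<lambda>x. (cmod (\<phi> x))\<^sup>2) summable_on V}"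

definition ell2_inner :: "'v set \<Rightarrow> ('v \<Rightarrow> complex) \<Rightarrow> ('v \<Rightarrow> complex) \<Rightarrow> complex" where
  "ell2_inner V \<phi> \<psi> = (\<Sum>\<^sub>\<infinity>x\<in>V. cnj (\<phi> x) * \<psi> x)"

definition ell2_norm :: "'v set \<Rightarrow> ('v \<Rightarrow> complex) \<Rightarrow> real" where
  "ell2_norm V \<phi> = sqrt (\<Sum>\<^sub>\<infinity>x\<in>V. (cmod (\<phi> x))\<^sup>2)"

text \<open>
  The resolvent set of an operator \<open>T\<close> on \<open>\<ell>\<^sup>2(V)\<close> consists of the \<open>z\<close> for which \<open>T - z\<close> is a
  bijection of \<open>\<ell>\<^sup>2(V)\<close> with bounded inverse (\<open>C\<close> is a bound for the norm of the inverse).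
\<close>

definition resolvent_set :: "'v set \<Rightarrow> (('v \<Rightarrow> complex) \<Rightarrow> 'v \<Rightarrow> complex) \<Rightarrow> complex set" where
  "resolvent_set V T =
     {z. bij_betw (\<lambda>\<phi> x. T \<phi> x - z * \<phi> x) (ell2 V) (ell2 V) \<and>
         (\<exists>C. \<forall>\<phi>\<in>ell2 V. ell2_norm V \<phi> \<le> C * ell2_norm V (\<lambda>x. T \<phi> x - z * \<phi> x))}"

definition op_spectrum :: "'v set \<Rightarrow> (('v \<Rightarrow> complex) \<Rightarrow> 'v \<Rightarrow> complex) \<Rightarrow> complex set" where
  "op_spectrum V T = - resolvent_set V T"

text \<open>
  The spectral measure of a bounded self-adjoint operator \<open>T\<close> at the vector \<open>\<phi>\<close> is the finite Borel
  measure \<open>\<mu>\<close> carried by the spectrum of \<open>T\<close> such that \<open>\<langle>\<phi>, p(T) \<phi>\<rangle> = \<integral> p d\<mu>\<close> for all polynomials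
  \<open>p\<close>; by linearity it is enough to require this for monomials. For bounded self-adjoint \<open>T\<close> it
  exists and is unique by the continuous functional calculus and the Riesz representation theorem.
\<close>

definition is_spectral_measure ::
    "'v set \<Rightarrow> (('v \<Rightarrow> complex) \<Rightarrow> 'v \<Rightarrow> complex) \<Rightarrow> ('v \<Rightarrow> complex) \<Rightarrow> real measure \<Rightarrow> bool" where
  "is_spectral_measure V T \<phi> \<mu> \<longleftrightarrow>
     sets \<mu> = sets borel \<and> finite_measure \<mu> \<and>
     (AE t in \<mu>. complex_of_real t \<in> op_spectrum V T) \<and>
     (\<forall>n. integrable \<mu> (\<lambda>t. t ^ n) \<and>
          ell2_inner V \<phi> ((T ^^ n) \<phi>) = complex_of_real (\<integral>t. t ^ n \<partial>\<mu>))"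

definition spectral_measure ::
    "'v set \<Rightarrow> (('v \<Rightarrow> complex) \<Rightarrow> 'v \<Rightarrow> complex) \<Rightarrow> ('v \<Rightarrow> complex) \<Rightarrow> real measure" where
  "spectral_measure V T \<phi> = (THE \<mu>. is_spectral_measure V T \<phi> \<mu>)"

definition purely_absolutely_continuous ::
    "'v set \<Rightarrow> (('v \<Rightarrow> complex) \<Rightarrow> 'v \<Rightarrow> complex) \<Rightarrow> bool" where
  "purely_absolutely_continuous V T \<longleftrightarrow>
     (\<forall>\<phi>\<in>ell2 V. absolutely_continuous lborel (spectral_measure V T \<phi>))"

definition tree_adj_op ::
    "nat ^ 'a ^ 'a \<Rightarrow> 'a \<Rightarrow> (('a::finite) vertex \<Rightarrow> complex) \<Rightarrow> 'a vertex \<Rightarrow> complex" where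
  "tree_adj_op M j \<phi> x = (\<Sum>y | tree_adj M j x y. \<phi> y)"

end

theory Submission
  imports Defs "HOL-Probability.Probability" "HOL-Computational_Algebra.Polynomial"
begin

text \<open>
  The forward cones of the tree give numbers \<open>g k\<close> (the truncated Green functions, one for each
  label) with \<open>g k * (z + (\<Sum>i. M $ i $ k * g i)) = -1\<close>. Call \<open>z\<close> regular if there are such \<open>g\<close> and a
  vector \<open>p > 0\<close> with \<open>(cmod (g k))\<^sup>2 * (\<Sum>i. M $ i $ k * p i) < p k\<close>. The proof shows that the resolvent set
  is exactly the set of regular \<open>z\<close>, a condition which does not involve the label of the root. If \<open>z\<close>
  is regular, then \<open>L - z\<close> factors into a diagonal operator and two operators that differ from the
  identity by strict contractions of weighted \<open>\<ell>\<^sup>2\<close> norms. Every nonreal \<open>z\<close> is regular, by Brouwer's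
  theorem with \<open>p = Im g\<close>. If \<open>L - E\<close> is bounded below for a real \<open>E\<close>, then \<open>Im g / \<eta>\<close> at \<open>E + \<i>\<eta>\<close> stays
  bounded, first at the root and by (M2) for all labels, and a limit point for \<open>\<eta> \<rightarrow> 0\<close> shows that \<open>E\<close>
  is regular.

  If two real energies are regular with real \<open>g1\<close>, \<open>g2\<close> of the same sign pattern, then \<open>g1 < g2\<close>
  by a Cauchy-Schwarz estimate for the two contracted vectors, and all energies in between are regular
  by Brouwer's theorem on the box \<open>[g1, g2]\<close> and a Schwarz-Pick estimate. Hence the real part of the
  resolvent set is a union of at most \<open>2 ^ CARD('a)\<close> intervals.

  By (M1) all \<open>g\<close> in the upper half plane are bounded by 1. This bounds the resolvent matrix elements
  of finitely supported vectors uniformly up to the real axis, so that their spectral measures have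
  bounded densities; absolute continuity passes to limits of vectors. Absolute continuity also rules out isolated
  points of the spectrum, so all bands are nondegenerate.
\<close>

section \<open>Real solutions of the recursion for the Green functions\<close>

text \<open>Subcriticality is a single inequality that serves both triangular factors of
  \<open>L - z\<close>: the label weight \<open>p / |g|^2\<close> makes the passage from parents to
  children contracting, and the reciprocal weight, by duality, the passage back. It comes from the
  imaginary part of the recursion, \<open>Im g = |g|^2 * (Im z + child_sum M (Im g))\<close>. At the
  real axis \<open>Im g\<close> may degenerate to 0, but the quotient \<open>Im g / \<eta>\<close>
  satisfies the same identity with \<open>Im z\<close> replaced by 1, so strictness survives the
  limit. Sign patterns enter because a real \<open>g\<close> has no zero entry and the difference of
  two solutions is governed by a matrix with entries \<open>g1 k * g2 k * M $ i $ k\<close>,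
  nonnegative exactly when the signs agree where \<open>M\<close> has children. On the spectral side
  the obstacle is that a spectral measure is a definite description, so existence and uniqueness
  have to be proved. Both go through moments: existence by Bernstein weights, uniqueness by squares
  of polynomials approximating indicators. All estimates of spectral measures start from
  inequalities between norms of \<open>p(T) \<phi>\<close> for real polynomials \<open>p\<close> and
  pass to closed sets.\<close>

abbreviation child_sum :: "nat ^ 'a ^ 'a \<Rightarrow> ('a::finite \<Rightarrow> real) \<Rightarrow> 'a \<Rightarrow> real" where
  "child_sum M p k \<equiv> \<Sum>i\<in>UNIV. real (M $ i $ k) * p i"

text \<open>The recursion \<open>g k = -1 / (z + ...)\<close> in product form, which also asserts
  that \<open>g k\<close> and the denominator are nonzero. Column \<open>k\<close> of
  \<open>M\<close> lists the children of a vertex labelled \<open>k\<close>.\<close>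

definition green_solution :: "nat ^ 'a ^ 'a \<Rightarrow> complex \<Rightarrow> ('a::finite \<Rightarrow> complex) \<Rightarrow> bool" where
  "green_solution M z g \<longleftrightarrow> (\<forall>k. g k * (z + (\<Sum>i\<in>UNIV. of_nat (M $ i $ k) * g i)) = -1)"

text \<open>The Collatz-Wielandt form of the statement that the nonnegative matrix with entries
  \<open>(cmod (g k))\<^sup>2 * M $ i $ k\<close> has spectral radius below 1; the witness
  \<open>p\<close> supplies the weights for the norms.\<close>

definition subcritical :: "nat ^ 'a ^ 'a \<Rightarrow> ('a::finite \<Rightarrow> complex) \<Rightarrow> bool" where
  "subcritical M g \<longleftrightarrow>
     (\<exists>p. \<forall>k. p k > 0 \<and> (cmod (g k))\<^sup>2 * (child_sum M p k) < p k)"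

lemma green_solution_nonzero: "green_solution M z g \<Longrightarrow> g k \<noteq> 0"
  by (auto simp: green_solution_def dest!: spec[of _ k])

lemma brouwer_fun_real:
  fixes f :: "('a::finite \<Rightarrow> real) \<Rightarrow> 'a \<Rightarrow> real" and lo hi :: "'a \<Rightarrow> real"
  assumes le: "\<And>k. lo k \<le> hi k"
    and cont: "\<And>k. continuous_on (cbox (\<chi> k. lo k) (\<chi> k. hi k)) (\<lambda>h. f (\<lambda>i. h $ i) k)"
    and maps: "\<And>h k. (\<And>i. lo i \<le> h i \<and> h i \<le> hi i) \<Longrightarrow> lo k \<le> f h k \<and> f h k \<le> hi k"
  shows "\<exists>h. (\<forall>i. lo i \<le> h i \<and> h i \<le> hi i) \<and> (\<forall>k. f h k = h k)"
proof -
  let ?B = "cbox (\<chi> k. lo k) (\<chi> k. hi k) :: (real ^ 'a) set"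
  let ?F = "\<lambda>h::real^'a. \<chi> k. f (\<lambda>i. h $ i) k"
  have "?B \<noteq> {}" using le by (auto simp: box_ne_empty(1) Basis_vec_def inner_axis)
  moreover have "continuous_on ?B ?F"
    by (rule continuous_on_vec_lambda) (rule cont)
  moreover have "?F \<in> ?B \<rightarrow> ?B"
    using maps by (auto simp: mem_box_cart)
  ultimately obtain h where h: "h \<in> ?B" "?F h = h"
    using brouwer[of ?B ?F] compact_cbox convex_box(1) by blast
  have "\<forall>i. lo i \<le> h $ i \<and> h $ i \<le> hi i" using h(1) by (simp add: mem_box_cart)
  moreover have "\<forall>k. f (\<lambda>i. h $ i) k = h $ k" using h(2) by (metis vec_lambda_beta)
  ultimately show ?thesis by blast
qed

text \<open>A minimum principle. Where \<open>d / r\<close> attains its minimum \<open>m\<close>, a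
  value \<open>m \<le> 0\<close> would give \<open>A d \<ge> m * A r \<ge> m * r = d\<close>,
  against \<open>d > A d\<close>.\<close>

lemma positive_of_contraction:
  fixes A :: "'a::finite \<Rightarrow> 'a \<Rightarrow> real"
  assumes A: "\<And>k i. A k i \<ge> 0"
    and r: "\<And>k. r k > 0" "\<And>k. (\<Sum>i\<in>UNIV. A k i * r i) < r k"
    and d: "\<And>k. d k > (\<Sum>i\<in>UNIV. A k i * d i)"
  shows "d k > 0"
proof -
  define m where "m = Min (range (\<lambda>k. d k / r k))"
  have fin: "finite (range (\<lambda>k. d k / r k))" by simp
  obtain l where l: "m = d l / r l"
    using Min_in[OF fin] unfolding m_def by blast
  have le: "m * r i \<le> d i" for i
  proof -
    have "m \<le> d i / r i" unfolding m_def by (rule Min_le) auto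
    thus ?thesis using r(1)[of i] by (simp add: field_simps)
  qed
  have "m > 0"
  proof (rule ccontr)
    assume "\<not> m > 0"
    hence m: "m \<le> 0" by simp
    have "m * r l \<le> m * (\<Sum>i\<in>UNIV. A l i * r i)"
      using m r(2)[of l] by (simp add: mult_left_mono_neg)
    also have "\<dots> = (\<Sum>i\<in>UNIV. A l i * (m * r i))" by (simp add: sum_distrib_left algebra_simps)
    also have "\<dots> \<le> (\<Sum>i\<in>UNIV. A l i * d i)"
      by (intro sum_mono mult_left_mono le A)
    also have "\<dots> < d l" by (rule d)
    also have "\<dots> = m * r l" using l r(1)[of l] by simp
    finally show False by simp
  qed
  thus ?thesis using le[of k] r(1)[of k] by (smt (verit) mult_pos_pos)
qed

text \<open>The weight is an explicit argument because the comparison of two energies combines the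
  two weights.\<close>

definition real_solution :: "nat ^ 'a ^ 'a \<Rightarrow> real \<Rightarrow> ('a::finite \<Rightarrow> real) \<Rightarrow> ('a \<Rightarrow> real) \<Rightarrow> bool" where
  "real_solution M E g p \<longleftrightarrow>
     (\<forall>k. g k * (E + (child_sum M g k)) = -1 \<and>
          p k > 0 \<and> (g k)\<^sup>2 * (child_sum M p k) < p k)"

lemma real_solution_nonzero: "real_solution M E g p \<Longrightarrow> g k \<noteq> 0"
  by (auto simp: real_solution_def dest!: spec[of _ k])

text \<open>Subtracting the recursions gives
  \<open>d k = g1 k * g2 k * (E2 - E1 + child_sum M d k)\<close> for \<open>d = g2 - g1\<close>.
  Equal signs make this matrix nonnegative, the geometric mean of \<open>p1\<close> and
  \<open>p2\<close> is a strict supersolution for it, and the minimum principle applies.\<close>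

lemma real_solution_mono:
  assumes 1: "real_solution M E1 g1 p1" and 2: "real_solution M E2 g2 p2"
    and e: "E1 < E2" and sgn: "\<And>k. g1 k * g2 k > 0"
  shows "g1 k < g2 k"
proof -
  define A where "A k i = g1 k * g2 k * real (M $ i $ k)" for k i
  define r where "r k = sqrt (p1 k * p2 k)" for k
  define d where "d k = g2 k - g1 k" for k
  have p: "p1 k > 0" "p2 k > 0" for k using 1 2 by (auto simp: real_solution_def)
  have "d k > 0"
  proof (rule positive_of_contraction[of A r])
    show "A k i \<ge> 0" for k i unfolding A_def using sgn[of k] by simp
    show "r k > 0" for k unfolding r_def using p by simp
    fix k
    let ?S1 = "\<Sum>i\<in>UNIV. real (M $ i $ k) * p1 i" and ?S2 = "\<Sum>i\<in>UNIV. real (M $ i $ k) * p2 i"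
    have nn: "?S1 \<ge> 0" "?S2 \<ge> 0" by (auto intro!: sum_nonneg simp: p less_imp_le)
    have "(child_sum M r k)
        = (\<Sum>i\<in>UNIV. \<bar>sqrt (real (M $ i $ k) * p1 i)\<bar> * \<bar>sqrt (real (M $ i $ k) * p2 i)\<bar>)"
      unfolding r_def using p by (intro sum.cong refl) (auto simp: real_sqrt_mult less_imp_le)
    also have "\<dots> \<le> L2_set (\<lambda>i. sqrt (real (M $ i $ k) * p1 i)) UNIV * L2_set (\<lambda>i. sqrt (real (M $ i $ k) * p2 i)) UNIV"
      by (rule L2_set_mult_ineq)
    also have "\<dots> = sqrt ?S1 * sqrt ?S2"
      unfolding L2_set_def using p by (simp add: less_imp_le)
    finally have le: "(child_sum M r k) \<le> sqrt (?S1 * ?S2)" by (simp add: real_sqrt_mult)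
    have "(\<Sum>i\<in>UNIV. A k i * r i) = g1 k * g2 k * (child_sum M r k)"
      unfolding A_def by (simp add: sum_distrib_left algebra_simps)
    also have "\<dots> \<le> g1 k * g2 k * sqrt (?S1 * ?S2)"
      using le sgn[of k] by (simp add: mult_left_mono)
    also have "\<dots> = sqrt (((g1 k)\<^sup>2 * ?S1) * ((g2 k)\<^sup>2 * ?S2))"
      using sgn[of k] by (simp add: real_sqrt_mult flip: abs_mult)
    also have "\<dots> < sqrt (p1 k * p2 k)"
      using 1 2 nn by (intro real_sqrt_less_mono mult_strict_mono') (auto simp: real_solution_def)
    finally show "(\<Sum>i\<in>UNIV. A k i * r i) < r k" by (simp add: r_def)
    let ?u1 = "E1 + (child_sum M g1 k)" and ?u2 = "E2 + (child_sum M g2 k)"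
    have u: "g1 k * ?u1 = -1" "g2 k * ?u2 = -1" using 1 2 by (auto simp: real_solution_def)
    have "d k = g1 k * g2 k * (?u2 - ?u1)" unfolding d_def using u by algebra
    also have "?u2 - ?u1 = (E2 - E1) + (child_sum M d k)"
      by (simp add: d_def algebra_simps sum_subtractf)
    also have "g1 k * g2 k * \<dots> > g1 k * g2 k * (child_sum M d k)"
      using sgn[of k] e by (intro mult_strict_left_mono) auto
    finally show "d k > (\<Sum>i\<in>UNIV. A k i * d i)"
      by (simp add: A_def sum_distrib_left algebra_simps)
  qed
  thus ?thesis by (simp add: d_def)
qed

text \<open>Half the harmonic mean, \<open>x * y / (x + y)\<close>, is concave and homogeneous,
  hence superadditive. The positive \<open>s\<close> and \<open>t\<close> make the inequality
  strict; they will be the distances of an energy to two regular energies around it.\<close>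

lemma harmonic_superadditive:
  fixes a b c :: "'i \<Rightarrow> real"
  assumes "finite I" "\<And>i. i \<in> I \<Longrightarrow> a i > 0" "\<And>i. i \<in> I \<Longrightarrow> b i > 0" "\<And>i. i \<in> I \<Longrightarrow> c i \<ge> 0"
    and "s > 0" "t > 0"
  shows "(\<Sum>i\<in>I. c i * (a i * b i / (a i + b i)))
    < (s + (\<Sum>i\<in>I. c i * a i)) * (t + (\<Sum>i\<in>I. c i * b i)) / ((s + (\<Sum>i\<in>I. c i * a i)) + (t + (\<Sum>i\<in>I. c i * b i)))"
proof -
  define X where "X = s + (\<Sum>i\<in>I. c i * a i)"
  define Y where "Y = t + (\<Sum>i\<in>I. c i * b i)"
  have X: "X > 0" "(\<Sum>i\<in>I. c i * a i) < X" and Y: "Y > 0" "(\<Sum>i\<in>I. c i * b i) < Y"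
    unfolding X_def Y_def using assms by (auto intro!: add_pos_nonneg sum_nonneg mult_nonneg_nonneg simp: less_imp_le)
  \<comment> \<open>The parameter for which the linear bound is an equality at \<open>X\<close>,
    \<open>Y\<close>.\<close>
  define l where "l = Y / (X + Y)"
  have l: "0 < l" "l < 1" using X Y by (auto simp: l_def field_simps)
  text \<open>The harmonic mean is the infimum of the linear functions \<open>l\<^sup>2 a + (1 - l)\<^sup>2 b\<close>.\<close>
  have tangent: "x * y / (x + y) \<le> l\<^sup>2 * x + (1 - l)\<^sup>2 * y" if "x > 0" "y > 0" for x y :: real
  proof -
    have "(l\<^sup>2 * x + (1 - l)\<^sup>2 * y) * (x + y) - x * y = (l * x - (1 - l) * y)\<^sup>2"
      by algebra
    hence "x * y \<le> (l\<^sup>2 * x + (1 - l)\<^sup>2 * y) * (x + y)" by (metis diff_ge_0_iff_ge zero_le_power2)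
    thus ?thesis using that by (simp add: divide_le_eq)
  qed
  have "(\<Sum>i\<in>I. c i * (a i * b i / (a i + b i))) \<le> (\<Sum>i\<in>I. c i * (l\<^sup>2 * a i + (1 - l)\<^sup>2 * b i))"
    using assms by (intro sum_mono mult_left_mono tangent) auto
  also have "\<dots> = l\<^sup>2 * (\<Sum>i\<in>I. c i * a i) + (1 - l)\<^sup>2 * (\<Sum>i\<in>I. c i * b i)"
    by (simp add: sum.distrib sum_distrib_left algebra_simps)
  also have "\<dots> < l\<^sup>2 * X + (1 - l)\<^sup>2 * Y"
    using X Y l by (intro add_strict_mono mult_strict_left_mono) auto
  also have "\<dots> = X * Y / (X + Y)"
  proof -
    have "1 - l = X / (X + Y)" using X Y by (simp add: l_def field_simps)
    hence "l\<^sup>2 * X + (1 - l)\<^sup>2 * Y = (Y / (X + Y))\<^sup>2 * X + (X / (X + Y))\<^sup>2 * Y"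
      by (simp only: l_def)
    also have "\<dots> = (X * Y) * (X + Y) / (X + Y)\<^sup>2"
      by (simp add: power_divide power2_eq_square add_divide_distrib distrib_left mult_ac)
    finally show ?thesis using X Y by (simp add: power2_eq_square)
  qed
  finally show ?thesis by (simp add: X_def Y_def)
qed

text \<open>The weights \<open>a b / (a + b)\<close> come from the Schwarz-Pick lemma for the discs with diameters
  \<open>[g1 k, g2 k]\<close>, which the maps \<open>u \<mapsto> - 1 / u\<close> carry to discs of the same kind.\<close>

lemma real_solution_between:
  assumes 1: "real_solution M E1 g1 p1" and 2: "real_solution M E2 g2 p2"
    and e: "E1 < E" "E < E2" and sgn: "\<And>k. g1 k * g2 k > 0"
  shows "\<exists>g p. real_solution M E g p \<and> (\<forall>k. g1 k < g k \<and> g k < g2 k)"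
proof -
  have lt: "g1 k < g2 k" for k using real_solution_mono[OF 1 2 _ sgn] e by simp
  define u where "u E h k = E + (child_sum M h k)" for E h k
  have u1: "g1 k * u E1 g1 k = -1" and u2: "g2 k * u E2 g2 k = -1" for k
    using 1 2 by (auto simp: real_solution_def u_def)
  have bet: "u E1 g1 k < u E h k \<and> u E h k < u E2 g2 k" if "\<And>i. g1 i \<le> h i \<and> h i \<le> g2 i" for h k
    unfolding u_def using e that by (auto intro!: add_less_le_mono sum_mono mult_left_mono)
  \<comment> \<open>The denominators at both ends have one sign, so those in between avoid 0, and
    \<open>-1 / u\<close> is continuous and increasing on the whole box.\<close>
  have same: "(0 < u E1 g1 k \<and> 0 < u E2 g2 k) \<or> (u E1 g1 k < 0 \<and> u E2 g2 k < 0)" for k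
  proof -
    have "(g1 k * g2 k) * (u E1 g1 k * u E2 g2 k) = 1" using u1[of k] u2[of k] by algebra
    hence "u E1 g1 k * u E2 g2 k > 0" using sgn[of k] by (metis zero_less_mult_pos zero_less_one)
    thus ?thesis by (auto simp: zero_less_mult_iff)
  qed
  have g1: "g1 k = - 1 / u E1 g1 k" and g2: "g2 k = - 1 / u E2 g2 k" for k
    using u1[of k] u2[of k] same[of k] by (metis less_irrefl nonzero_eq_divide_eq)+
  have "\<exists>h. (\<forall>i. g1 i \<le> h i \<and> h i \<le> g2 i) \<and> (\<forall>k. - 1 / u E h k = h k)"
  proof (rule brouwer_fun_real[where f = "\<lambda>h k. - 1 / u E h k"])
    show "g1 k \<le> g2 k" for k using lt less_imp_le by blast
  next
    fix h k assume h: "\<And>i. g1 i \<le> h i \<and> h i \<le> g2 i"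
    note b = bet[OF h, of k]
    have "-1 / u E1 g1 k \<le> -1 / u E h k" "-1 / u E h k \<le> -1 / u E2 g2 k"
      using b same[of k] by (auto simp: divide_simps)
    thus "g1 k \<le> -1 / u E h k \<and> -1 / u E h k \<le> g2 k" using g1 g2 by metis
  next
    fix k
    have "u E (\<lambda>i. h $ i) k \<noteq> 0" if "h \<in> cbox (\<chi> k. g1 k) (\<chi> k. g2 k)" for h
      using bet[of "\<lambda>i. h $ i" k] same[of k] that by (auto simp: mem_box_cart)
    thus "continuous_on (cbox (\<chi> k. g1 k) (\<chi> k. g2 k)) (\<lambda>h. - 1 / u E (\<lambda>i. h $ i) k)"
      by (intro continuous_on_divide continuous_intros) (auto simp: u_def intro!: continuous_intros)
  qed
  then obtain g where g: "\<And>i. g1 i \<le> g i \<and> g i \<le> g2 i" "\<And>k. - 1 / u E g k = g k" by blast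
  note b = bet[OF g(1)]
  have un: "u E g k \<noteq> 0" for k using b[of k] same[of k] by auto
  have ug: "g k * u E g k = -1" for k using g(2)[of k] un[of k] by (metis nonzero_eq_divide_eq)
  define \<alpha> where "\<alpha> k = u E g k - u E1 g1 k" for k
  define \<beta> where "\<beta> k = u E2 g2 k - u E g k" for k
  have ab: "\<alpha> k > 0" "\<beta> k > 0" for k using b by (auto simp: \<alpha>_def \<beta>_def)
  define a where "a k = g k - g1 k" for k
  define c where "c k = g2 k - g k" for k
  have sg: "g k * g1 k > 0" "g k * g2 k > 0" for k
    using g(1)[of k] sgn[of k] by (auto simp: zero_less_mult_iff)
  \<comment> \<open>A difference of reciprocals: \<open>g - g1 = g * g1 * (u - u1)\<close> for
    \<open>g = -1 / u\<close> and \<open>g1 = -1 / u1\<close>.\<close>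
  have a: "a k = g k * g1 k * \<alpha> k" and c: "c k = g k * g2 k * \<beta> k" for k
  proof -
    have "g k * g1 k * \<alpha> k = g1 k * (g k * u E g k) - g k * (g1 k * u E1 g1 k)"
      "g k * g2 k * \<beta> k = g k * (g2 k * u E2 g2 k) - g2 k * (g k * u E g k)"
      by (simp_all add: \<alpha>_def \<beta>_def algebra_simps)
    thus "a k = g k * g1 k * \<alpha> k" "c k = g k * g2 k * \<beta> k"
      by (simp_all add: ug u1 u2 a_def c_def)
  qed
  have ac: "a k > 0" "c k > 0" for k using a c ab sg by simp_all
  define p where "p k = a k * c k / (a k + c k)" for k
  have "(g k)\<^sup>2 * (child_sum M p k) < p k" for k
  proof -
    have \<alpha>: "\<alpha> k = (E - E1) + (child_sum M a k)"
      and \<beta>: "\<beta> k = (E2 - E) + (child_sum M c k)"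
      by (simp_all add: \<alpha>_def \<beta>_def u_def a_def c_def algebra_simps sum_subtractf)
    have "(child_sum M p k) < \<alpha> k * \<beta> k / (\<alpha> k + \<beta> k)"
      unfolding p_def \<alpha> \<beta> by (rule harmonic_superadditive) (use ac e in auto)
    hence "(g k)\<^sup>2 * (child_sum M p k) < (g k)\<^sup>2 * (\<alpha> k * \<beta> k / (\<alpha> k + \<beta> k))"
      using sg[of k] by (intro mult_strict_left_mono) auto
    \<comment> \<open>The Moebius map \<open>-1 / u\<close> multiplies this weight exactly by its
      derivative \<open>g^2\<close>: the factors \<open>g1 * g2\<close> of \<open>a * c\<close> and
      of \<open>a + c\<close> cancel.\<close>
    also have "\<dots> = p k"
    proof -
      have s: "a k + c k = g1 k * g2 k * (\<alpha> k + \<beta> k)"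
      proof -
        have "g1 k * g2 k * (\<alpha> k + \<beta> k) = g1 k * (g2 k * u E2 g2 k) - g2 k * (g1 k * u E1 g1 k)"
          by (simp add: \<alpha>_def \<beta>_def algebra_simps)
        thus ?thesis by (simp add: u1 u2 a_def c_def)
      qed
      have "a k * c k = g1 k * g2 k * ((g k)\<^sup>2 * (\<alpha> k * \<beta> k))"
        unfolding a c by (simp add: power2_eq_square)
      thus ?thesis unfolding p_def s using sgn[of k] by (auto simp: zero_less_mult_iff)
    qed
    finally show ?thesis .
  qed
  moreover have "p k > 0" for k unfolding p_def using ac by (simp add: add_pos_pos)
  ultimately have "real_solution M E g p" unfolding real_solution_def using ug by (simp add: u_def)
  moreover have "g1 k < g k \<and> g k < g2 k" for k using ac[of k] by (simp add: a_def c_def)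
  ultimately show ?thesis by blast
qed

text \<open>Since no entry of \<open>g\<close> vanishes, \<open>S\<close> fixes all signs. An
  intermediate solution lies entrywise between two numbers of the same sign and so stays in the
  class.\<close>

lemma is_interval_sign_class:
  "is_interval {E. \<exists>g p. real_solution M E g p \<and> {k. g k > 0} = S}"
  unfolding is_interval_1
proof (intro ballI allI impI)
  fix E1 E2 E
  assume 1: "E1 \<in> {E. \<exists>g p. real_solution M E g p \<and> {k. g k > 0} = S}"
    and 2: "E2 \<in> {E. \<exists>g p. real_solution M E g p \<and> {k. g k > 0} = S}" and E: "E1 \<le> E \<and> E \<le> E2"
  from 1 obtain g1 p1 where g1: "real_solution M E1 g1 p1" "{k. g1 k > 0} = S" by blast
  from 2 obtain g2 p2 where g2: "real_solution M E2 g2 p2" "{k. g2 k > 0} = S" by blast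
  have sgn: "g1 k * g2 k > 0" for k
    using real_solution_nonzero[OF g1(1), of k] real_solution_nonzero[OF g2(1), of k] g1(2) g2(2)
    by (metis (mono_tags, lifting) linorder_neqE_linordered_idom mem_Collect_eq zero_less_mult_iff)
  consider "E = E1" | "E = E2" | "E1 < E" "E < E2" using E by linarith
  thus "E \<in> {E. \<exists>g p. real_solution M E g p \<and> {k. g k > 0} = S}"
  proof cases
    case 3
    obtain g p where g: "real_solution M E g p" "\<And>k. g1 k < g k \<and> g k < g2 k"
      using real_solution_between[OF g1(1) g2(1) 3 sgn] by blast
    have "g k > 0 \<longleftrightarrow> g1 k > 0" for k
      using g(2)[of k] sgn[of k] by (auto simp: zero_less_mult_iff)
    thus ?thesis using g(1) g1(2) by auto
  qed (use 1 2 in auto)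
qed

section \<open>The moment problem on a compact interval\<close>

text \<open>For \<open>m \<le> k\<close> the ratio of binomials is the product of
  \<open>(k - i) / (n - i)\<close> over \<open>i < m\<close>. Each factor is within
  \<open>m / (n - m)\<close> of \<open>k / n\<close>, and the errors of a product of numbers in the
  unit interval add up. For \<open>k < m\<close> the ratio is 0 and \<open>k / n\<close> alone is
  small.\<close>

lemma binomial_ratio_bound:
  fixes k n m :: nat
  assumes "k \<le> n" "2 * m < n"
  shows "\<bar>(real k / real n) ^ m - real (k choose m) / real (n choose m)\<bar> \<le> real m * real m / (real n - real m)"
proof (cases "m \<le> k")
  case True
  have ch: "real (k choose m) = (\<Prod>i<m. real k - real i) / fact m" for k
    by (simp add: binomial_gbinomial gbinomial_prod_rev atLeast0LessThan)
  have ratio: "real (k choose m) / real (n choose m) = (\<Prod>i<m. (real k - real i) / (real n - real i))"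
    by (simp add: ch prod_dividef)
  have "norm ((\<Prod>i<m. real k / real n) - (\<Prod>i<m. (real k - real i) / (real n - real i)))
      \<le> (\<Sum>i<m. norm (real k / real n - (real k - real i) / (real n - real i)))"
    using assms True by (intro norm_prod_diff) (auto simp: divide_le_eq)
  also have "\<dots> \<le> (\<Sum>i<m. real m / (real n - real m))"
  proof (intro sum_mono)
    fix i assume i: "i \<in> {..<m}"
    have pos: "real n > 0" "real n - real i > 0" "real n - real m > 0" using i assms by auto
    have "real k / real n - (real k - real i) / (real n - real i) = real i * ((real n - real k) / real n) / (real n - real i)"
      using pos by (simp add: field_simps)
    moreover have "\<dots> \<ge> 0" using pos assms by simp
    ultimately have "norm (real k / real n - (real k - real i) / (real n - real i)) = real i * ((real n - real k) / real n) / (real n - real i)"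
      by (metis abs_of_nonneg real_norm_def)
    also have "\<dots> \<le> real i / (real n - real i)"
      using pos assms by (intro divide_right_mono mult_left_le) (auto simp: divide_le_eq)
    also have "\<dots> \<le> real m / (real n - real m)"
      using pos i by (intro frac_le) auto
    finally show "norm (real k / real n - (real k - real i) / (real n - real i)) \<le> real m / (real n - real m)" .
  qed
  finally show ?thesis using ratio by simp
next
  case False
  hence km: "k < m" by simp
  have "(real k / real n) ^ m \<le> (real k / real n) ^ 1"
    using assms km by (intro power_decreasing) (auto simp: divide_le_eq)
  also have "\<dots> \<le> real m * real m / (real n - real m)"
  proof -
    have "real k * 1 \<le> real m * real m" using km by (intro mult_mono) auto
    hence "real k / real n \<le> (real m * real m) / (real n - real m)"
      using assms by (intro frac_le) auto
    thus ?thesis by simp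
  qed
  finally have "(real k / real n) ^ m \<le> real m * real m / (real n - real m)" .
  thus ?thesis using km by (simp add: binomial_eq_0)
qed

text \<open>Hausdorff's argument: \<open>c n k\<close> is a mass at the point \<open>k / n\<close>,
  and \<open>mom\<close> prescribes the binomial moments. These laws live on the unit interval,
  hence are tight; a weak limit has the power moments \<open>b m\<close>, since binomial and power
  moments differ by \<open>O(1 / n)\<close>.\<close>

lemma hausdorff_moment_unit_interval:
  fixes b :: "nat \<Rightarrow> real" and c :: "nat \<Rightarrow> nat \<Rightarrow> real"
  assumes nn: "\<And>n k. c n k \<ge> 0"
    and mom: "\<And>n m. m \<le> n \<Longrightarrow> (\<Sum>k\<le>n. real (k choose m) * c n k) = real (n choose m) * b m"
    and b0: "b 0 = 1"
  shows "\<exists>N. real_distribution N \<and> (AE y in N. 0 \<le> y \<and> y \<le> 1) \<and> (\<forall>m. b m = (\<integral>y. y ^ m \<partial>N))"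
proof -
  have sum1: "(\<Sum>k\<le>n. c n k) = 1" for n
    using mom[of 0 n] b0 by simp
  define P where "P n = embed_pmf (\<lambda>k. if k \<le> n then c n k else 0)" for n
  have pmf: "pmf (P n) k = (if k \<le> n then c n k else 0)" for n k
    unfolding P_def
  proof (rule pmf_embed_pmf)
    have "(\<integral>\<^sup>+ k. ennreal (if k \<le> n then c n k else 0) \<partial>count_space UNIV)
       = (\<integral>\<^sup>+ k. ennreal (if k \<le> n then c n k else 0) \<partial>count_space {..n})"
      by (rule nn_integral_count_space_eq) auto
    also have "\<dots> = (\<Sum>k\<le>n. ennreal (c n k))" by (simp add: nn_integral_count_space_finite)
    also have "\<dots> = 1" using sum1[of n] by (simp add: nn)
    finally show "(\<integral>\<^sup>+ k. ennreal (if k \<le> n then c n k else 0) \<partial>count_space UNIV) = 1" .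
  qed (simp add: nn)
  define \<nu> where "\<nu> n = distr (measure_pmf (P n)) borel (\<lambda>k. real k / real n)" for n
  have rd: "real_distribution (\<nu> n)" for n
    unfolding \<nu>_def by (intro real_distribution.intro real_distribution_axioms.intro prob_space.prob_space_distr) (auto intro: prob_space_measure_pmf)
  have int: "(\<integral>y. f y \<partial>\<nu> n) = (\<Sum>k\<le>n. c n k * f (real k / real n))" if "f \<in> borel_measurable borel" for f :: "real \<Rightarrow> real" and n
  proof -
    have "(\<integral>y. f y \<partial>\<nu> n) = (\<integral>k. f (real k / real n) \<partial>measure_pmf (P n))"
      unfolding \<nu>_def using that by (intro integral_distr) auto
    also have "\<dots> = (\<Sum>k\<le>n. pmf (P n) k *\<^sub>R f (real k / real n))"
      by (rule integral_measure_pmf) (auto simp: set_pmf_iff pmf split: if_splits)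
    finally show ?thesis by (simp add: pmf)
  qed
  have "AE k in measure_pmf (P n). 0 \<le> real k / real n \<and> real k / real n \<le> 1" for n
    by (rule AE_pmfI) (auto simp: set_pmf_iff pmf divide_le_eq split: if_splits)
  hence AE\<nu>: "AE y in \<nu> n. 0 \<le> y \<and> y \<le> 1" for n
    unfolding \<nu>_def by (subst AE_distr_iff) auto
  have "tight \<nu>"
    unfolding tight_def
  proof (intro conjI allI impI rd)
    fix \<epsilon> :: real assume "\<epsilon> > 0"
    have "measure (\<nu> n) {-1<..1} = 1" for n
    proof -
      interpret real_distribution "\<nu> n" by (rule rd)
      have "AE y in \<nu> n. y \<in> {-1<..1}" using AE\<nu>[of n] by eventually_elim auto
      thus ?thesis by (intro prob_eq_1[THEN iffD2]) auto
    qed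
    thus "\<exists>a b. a < b \<and> (\<forall>n. 1 - \<epsilon> < measure (\<nu> n) {a<..b})"
      using \<open>\<epsilon> > 0\<close> by (intro exI[of _ "-1"] exI[of _ 1]) auto
  qed
  then obtain r N where r: "strict_mono r" and N: "real_distribution N" and wc: "weak_conv_m (\<nu> \<circ> id \<circ> r) N"
    using tight_imp_convergent_subsubsequence[of \<nu> id] by (auto simp: strict_mono_def)
  have conv: "(\<lambda>n. \<integral>y. f y \<partial>\<nu> (r n)) \<longlonglongrightarrow> (\<integral>y. f y \<partial>N)"
    if "\<And>x. isCont f x" "\<And>x. \<bar>f x\<bar> \<le> B" for f :: "real \<Rightarrow> real" and B
    using weak_conv_imp_integral_bdd_continuous_conv[of "\<nu> \<circ> id \<circ> r" N f B] rd N wc that by simp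
  interpret N: real_distribution N by (rule N)
  \<comment> \<open>Weak convergence tests only bounded continuous functions; clamping makes powers
    bounded without changing them on the unit interval.\<close>
  define cl where "cl y = max 0 (min 1 y)" for y :: real
  have AEN: "AE y in N. 0 \<le> y \<and> y \<le> 1"
  proof -
    \<comment> \<open>Bounded, continuous and zero exactly on the unit interval, so that its
      integral detects any mass outside.\<close>
    let ?f = "\<lambda>y::real. min 1 \<bar>y - cl y\<bar>"
    have cont: "isCont ?f x" for x unfolding cl_def by (intro continuous_intros)
    have "(\<integral>y. ?f y \<partial>\<nu> n) = 0" for n
    proof -
      have "(\<integral>y. ?f y \<partial>\<nu> n) = (\<integral>y. 0 \<partial>\<nu> n)"
        using AE\<nu>[of n] by (intro integral_cong_AE) (auto simp: \<nu>_def cl_def)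
      thus ?thesis by simp
    qed
    hence "(\<integral>y. ?f y \<partial>N) = 0"
      using conv[of ?f 1] cont LIMSEQ_unique[OF _ tendsto_const] by simp
    moreover have "integrable N ?f"
      by (rule N.integrable_const_bound[of _ 1]) (auto simp: cl_def)
    ultimately have "AE y in N. ?f y = 0"
      by (subst (asm) integral_nonneg_eq_0_iff_AE) auto
    thus ?thesis by eventually_elim (auto simp: cl_def min_def max_def split: if_splits)
  qed
  have "b m = (\<integral>y. y ^ m \<partial>N)" for m
  proof -
    have cont: "isCont (\<lambda>y. cl y ^ m) x" for x unfolding cl_def by (intro continuous_intros)
    have 1: "(\<lambda>n. \<integral>y. cl y ^ m \<partial>\<nu> (r n)) \<longlonglongrightarrow> (\<integral>y. cl y ^ m \<partial>N)"
      by (rule conv[of _ 1]) (use cont in \<open>auto simp: cl_def power_le_one abs_le_iff intro: order_trans[of _ 0]\<close>)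
    have eqN: "(\<integral>y. cl y ^ m \<partial>N) = (\<integral>y. y ^ m \<partial>N)"
      using AEN by (intro integral_cong_AE) (auto simp: cl_def)
    have close: "\<bar>(\<integral>y. cl y ^ m \<partial>\<nu> n) - b m\<bar> \<le> real m * real m / (real n - real m)" if n: "2 * m < n" for n
    proof -
      have b: "b m = (\<Sum>k\<le>n. c n k * (real (k choose m) / real (n choose m)))"
        using mom[of m n] n by (simp add: sum_divide_distrib[symmetric] mult.commute nonzero_eq_divide_eq)
      have i: "(\<integral>y. cl y ^ m \<partial>\<nu> n) = (\<Sum>k\<le>n. c n k * (real k / real n) ^ m)"
        by (subst int) (auto simp: cl_def divide_le_eq intro!: sum.cong)
      have "\<bar>(\<integral>y. cl y ^ m \<partial>\<nu> n) - b m\<bar> \<le> (\<Sum>k\<le>n. \<bar>c n k * (real k / real n) ^ m - c n k * (real (k choose m) / real (n choose m))\<bar>)"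
        unfolding b i sum_subtractf[symmetric] by (rule sum_abs)
      also have "\<dots> \<le> (\<Sum>k\<le>n. c n k * (real m * real m / (real n - real m)))"
      proof (intro sum_mono)
        fix k assume "k \<in> {..n}"
        hence "c n k * \<bar>(real k / real n) ^ m - real (k choose m) / real (n choose m)\<bar>
            \<le> c n k * (real m * real m / (real n - real m))"
          using binomial_ratio_bound[OF _ n] nn by (intro mult_left_mono) auto
        thus "\<bar>c n k * (real k / real n) ^ m - c n k * (real (k choose m) / real (n choose m))\<bar>
            \<le> c n k * (real m * real m / (real n - real m))"
          using nn[of n k] by (simp only: right_diff_distrib[symmetric] abs_mult abs_of_nonneg)
      qed
      also have "\<dots> = real m * real m / (real n - real m)"
        by (simp only: sum1 mult_1 sum_distrib_right[symmetric])
      finally show ?thesis .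
    qed
    have "(\<lambda>n. real m * real m / (real n - real m)) \<longlonglongrightarrow> 0" by real_asymp
    hence "(\<lambda>n. (\<integral>y. cl y ^ m \<partial>\<nu> n) - b m) \<longlonglongrightarrow> 0"
      by (rule Lim_null_comparison[rotated]) (use close in \<open>auto intro!: eventually_sequentiallyI[of "Suc (2*m)"]\<close>)
    hence "(\<lambda>n. \<integral>y. cl y ^ m \<partial>\<nu> n) \<longlonglongrightarrow> b m" by (simp add: LIM_zero_iff)
    hence "(\<lambda>n. \<integral>y. cl y ^ m \<partial>\<nu> (r n)) \<longlonglongrightarrow> b m" using LIMSEQ_subseq_LIMSEQ[OF _ r] by (simp add: o_def)
    from LIMSEQ_unique[OF this 1] eqN show ?thesis by simp
  qed
  thus ?thesis using N AEN by blast
qed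

text \<open>After \<open>(n choose k) * (k choose m) = (n choose m) * ((n - m) choose (k -
  m))\<close> this is the binomial theorem with exponent \<open>n - m\<close>. It is stated over a
  commutative ring because \<open>y\<close> and \<open>z\<close> will be polynomials.\<close>

lemma bernstein_binomial_sum:
  fixes y z :: "'b :: comm_ring_1"
  assumes "y + z = 1" "m \<le> n"
  shows "(\<Sum>k\<le>n. of_nat (k choose m) * (of_nat (n choose k) * (y ^ k * z ^ (n - k)))) = of_nat (n choose m) * y ^ m"
proof -
  have "(\<Sum>k\<le>n. of_nat (k choose m) * (of_nat (n choose k) * (y ^ k * z ^ (n - k))))
      = (\<Sum>k=m..n. of_nat (k choose m) * (of_nat (n choose k) * (y ^ k * z ^ (n - k))))"
    by (rule sum.mono_neutral_right) (auto simp: binomial_eq_0)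
  also have "\<dots> = (\<Sum>j\<le>n-m. of_nat (n choose m) * y ^ m * (of_nat ((n - m) choose j) * y ^ j * z ^ (n - m - j)))"
  proof (rule sum.reindex_bij_witness[of _ "\<lambda>j. j + m" "\<lambda>k. k - m"])
    fix k assume k: "k \<in> {m..n}"
    have "(n choose k) * (k choose m) = (n choose m) * ((n - m) choose (k - m))"
      using k by (intro choose_mult) auto
    hence "of_nat (n choose k) * of_nat (k choose m) = (of_nat (n choose m) * of_nat ((n - m) choose (k - m)) :: 'b)"
      by (metis of_nat_mult)
    moreover have "y ^ k = y ^ m * y ^ (k - m)" using k by (simp flip: power_add)
    moreover have "n - m - (k - m) = n - k" using k by auto
    moreover have "of_nat (n choose m) * y ^ m * (of_nat ((n - m) choose (k - m)) * y ^ (k - m) * z ^ (n - k))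
        = (of_nat (n choose m) * of_nat ((n - m) choose (k - m))) * (y ^ m * y ^ (k - m)) * z ^ (n - k)"
      by (simp only: mult_ac)
    moreover have "of_nat (k choose m) * (of_nat (n choose k) * (y ^ k * z ^ (n - k)))
        = (of_nat (n choose k) * of_nat (k choose m)) * y ^ k * z ^ (n - k)"
      by (simp only: mult_ac)
    ultimately show "of_nat (n choose m) * y ^ m * (of_nat ((n - m) choose (k - m)) * y ^ (k - m) * z ^ (n - m - (k - m))) =
         of_nat (k choose m) * (of_nat (n choose k) * (y ^ k * z ^ (n - k)))"
      by (simp only:)
  qed (use assms in auto)
  also have "\<dots> = of_nat (n choose m) * y ^ m * (y + z) ^ (n - m)"
    by (simp add: binomial_ring sum_distrib_left)
  finally show ?thesis using assms by simp
qed

text \<open>The polynomials \<open>Y = (1 + t / R) / 2\<close> and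
  \<open>Z = (1 - t / R) / 2\<close> move the interval from \<open>-R\<close> to \<open>R\<close>
  onto the unit interval. Hausdorff's theorem asks for positivity of all
  \<open>Y ^ a * Z ^ b\<close>, which follows from positivity on squares and from
  \<open>4 * Y * Z = 1 - t^2 / R^2\<close>, where the bound on multiplication by \<open>t\<close>
  enters.\<close>

lemma moment_problem_compact:
  fixes \<Lambda> :: "real poly \<Rightarrow> real"
  assumes add: "\<And>p q. \<Lambda> (p + q) = \<Lambda> p + \<Lambda> q" and smult: "\<And>c p. \<Lambda> (smult c p) = c * \<Lambda> p"
    and pos: "\<And>p. \<Lambda> (p * p) \<ge> 0"
    and bd: "\<And>p. \<Lambda> (pCons 0 p * pCons 0 p) \<le> R\<^sup>2 * \<Lambda> (p * p)"
    and R: "R > 0" and one: "\<Lambda> 1 = 1"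
  shows "\<exists>\<mu>. real_distribution \<mu> \<and> (AE t in \<mu>. \<bar>t\<bar> \<le> R) \<and> (\<forall>p. \<Lambda> p = (\<integral>t. poly p t \<partial>\<mu>))"
proof -
  have zero: "\<Lambda> 0 = 0" using smult[of 0 0] by simp
  have sum: "\<Lambda> (\<Sum>i\<in>I. f i) = (\<Sum>i\<in>I. \<Lambda> (f i))" for I :: "nat set" and f
    by (induction I rule: infinite_finite_induct) (auto simp: add zero)
  define Y where "Y = [:1/2, 1/(2*R):]"
  define Z where "Z = [:1/2, -1/(2*R):]"
  have YZ1: "Y + Z = 1" by (simp add: Y_def Z_def one_pCons)
  have YZ: "\<Lambda> (q * q * (Y * Z)) \<ge> 0" for q
  proof -
    have "q * q * (Y * Z) = smult (1/4) (q * q) + smult (- 1 / (4 * R\<^sup>2)) (pCons 0 q * pCons 0 q)"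
      by (simp add: Y_def Z_def algebra_simps power2_eq_square)
    hence "\<Lambda> (q * q * (Y * Z)) = (\<Lambda> (q * q) - \<Lambda> (pCons 0 q * pCons 0 q) / R\<^sup>2) / 4"
      by (simp only: add smult) simp
    moreover have "\<Lambda> (pCons 0 q * pCons 0 q) / R\<^sup>2 \<le> \<Lambda> (q * q)"
      using bd[of q] R by (simp only: divide_le_eq zero_less_power mult.commute if_True)
    ultimately show ?thesis by (simp only: zero_le_divide_iff diff_ge_0_iff_ge) simp
  qed
  \<comment> \<open>By \<open>Y + Z = 1\<close> one has \<open>Y = Y^2 + Y * Z\<close> and
    \<open>Z = Z^2 + Y * Z\<close>.\<close>
  have Y: "\<Lambda> (q * q * Y) \<ge> 0" and Z: "\<Lambda> (q * q * Z) \<ge> 0" for q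
  proof -
    have "q * q * Y * (Y + Z) = (q * Y) * (q * Y) + q * q * (Y * Z)"
      "q * q * Z * (Y + Z) = (q * Z) * (q * Z) + q * q * (Y * Z)" by (simp_all only: algebra_simps)
    hence "\<Lambda> (q * q * Y) = \<Lambda> ((q * Y) * (q * Y)) + \<Lambda> (q * q * (Y * Z))"
      "\<Lambda> (q * q * Z) = \<Lambda> ((q * Z) * (q * Z)) + \<Lambda> (q * q * (Y * Z))"
      by (simp_all only: YZ1 mult_1_right add)
    thus "\<Lambda> (q * q * Y) \<ge> 0" "\<Lambda> (q * q * Z) \<ge> 0" using pos YZ by (simp_all add: add_nonneg_nonneg)
  qed
  have YZab: "\<Lambda> (Y ^ a * Z ^ b) \<ge> 0" for a b
  proof -
    \<comment> \<open>The even parts of the exponents form a square; at most one \<open>Y\<close>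
      and one \<open>Z\<close> remain.\<close>
    define q where "q = Y ^ (a div 2) * Z ^ (b div 2)"
    have sq: "x ^ n = x ^ (n div 2) * x ^ (n div 2) * x ^ (n mod 2)" for x :: "real poly" and n
      by (metis mult_2 mult_div_mod_eq power_add)
    have "Y ^ a * Z ^ b = q * q * (Y ^ (a mod 2) * Z ^ (b mod 2))"
      unfolding q_def by (subst sq[of Y a], subst sq[of Z b]) (simp only: mult_ac)
    moreover have "a mod 2 = 0 \<or> a mod 2 = 1" "b mod 2 = 0 \<or> b mod 2 = 1" by auto
    ultimately show ?thesis using pos[of q] Y[of q] Z[of q] YZ[of q] by auto
  qed
  have "\<exists>N. real_distribution N \<and> (AE y in N. 0 \<le> y \<and> y \<le> 1) \<and> (\<forall>m. \<Lambda> (Y ^ m) = (\<integral>y. y ^ m \<partial>N))"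
  proof (rule hausdorff_moment_unit_interval[where c = "\<lambda>n k. real (n choose k) * \<Lambda> (Y ^ k * Z ^ (n - k))"])
    show "real (n choose k) * \<Lambda> (Y ^ k * Z ^ (n - k)) \<ge> 0" for n k using YZab by simp
    show "\<Lambda> (Y ^ 0) = 1" using one by simp
    fix n m :: nat assume mn: "m \<le> n"
    have os: "of_nat k * p = smult (real k) p" for k and p :: "real poly"
      by (simp add: of_nat_poly)
    have "(\<Sum>k\<le>n. real (k choose m) * (real (n choose k) * \<Lambda> (Y ^ k * Z ^ (n - k))))
       = \<Lambda> (\<Sum>k\<le>n. of_nat (k choose m) * (of_nat (n choose k) * (Y ^ k * Z ^ (n - k))))"
      unfolding os sum smult ..
    also have "\<dots> = real (n choose m) * \<Lambda> (Y ^ m)"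
      by (subst bernstein_binomial_sum[OF YZ1 mn]) (simp only: os smult)
    finally show "(\<Sum>k\<le>n. real (k choose m) * (real (n choose k) * \<Lambda> (Y ^ k * Z ^ (n - k)))) = real (n choose m) * \<Lambda> (Y ^ m)" .
  qed
  then obtain N where N: "real_distribution N" and AEN: "AE y in N. 0 \<le> y \<and> y \<le> 1"
    and momN: "\<And>m. \<Lambda> (Y ^ m) = (\<integral>y. y ^ m \<partial>N)" by blast
  interpret N: real_distribution N by (rule N)
  define \<mu> where "\<mu> = distr N borel (\<lambda>y. 2 * R * y - R)"
  have "real_distribution \<mu>"
    unfolding \<mu>_def by (intro real_distribution.intro real_distribution_axioms.intro N.prob_space_distr) auto
  moreover have "AE t in \<mu>. \<bar>t\<bar> \<le> R"
    unfolding \<mu>_def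
  proof (subst AE_distr_iff)
    show "AE y in N. \<bar>2 * R * y - R\<bar> \<le> R"
      using AEN by eventually_elim (use R in \<open>auto simp: abs_le_iff algebra_simps\<close>)
  qed auto
  moreover have "\<Lambda> p = (\<integral>t. poly p t \<partial>\<mu>)" for p
  proof -
    \<comment> \<open>The inverse affine substitution writes \<open>p\<close> as a polynomial in
      \<open>Y\<close>, whose powers have known moments.\<close>
    define q where "q = pcompose p [:-R, 2*R:]"
    have "pcompose q Y = pcompose p (pcompose [:-R, 2*R:] Y)" by (simp add: q_def pcompose_assoc)
    also have "pcompose [:-R, 2*R:] Y = [:0, 1:]" using R by (simp add: Y_def pcompose_pCons)
    finally have pq: "p = pcompose q Y" by (simp add: pcompose_idR)
    have "\<Lambda> p = \<Lambda> (\<Sum>i\<le>degree q. smult (coeff q i) (Y ^ i))"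
      by (subst pq) (simp add: pcompose_altdef poly_altdef coeff_map_poly degree_map_poly)
    also have "\<dots> = (\<Sum>i\<le>degree q. coeff q i * (\<integral>y. y ^ i \<partial>N))"
      by (simp add: sum smult momN)
    also have "\<dots> = (\<integral>y. (\<Sum>i\<le>degree q. coeff q i * y ^ i) \<partial>N)"
    proof -
      have "integrable N (\<lambda>y. y ^ i)" for i
      proof (rule N.integrable_const_bound[of _ 1])
        show "AE y in N. norm (y ^ i) \<le> 1"
          using AEN by eventually_elim (auto simp: power_le_one)
      qed auto
      thus ?thesis by (simp add: Bochner_Integration.integral_sum)
    qed
    also have "\<dots> = (\<integral>y. poly p (2 * R * y - R) \<partial>N)"
    proof -
      have "(\<Sum>i\<le>degree q. coeff q i * y ^ i) = poly p (2 * R * y - R)" for y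
        unfolding poly_altdef[symmetric] by (simp add: q_def poly_pcompose algebra_simps)
      thus ?thesis by presburger
    qed
    also have "\<dots> = (\<integral>t. poly p t \<partial>\<mu>)"
      unfolding \<mu>_def by (rule integral_distr[symmetric]) (auto intro!: borel_measurable_continuous_onI continuous_intros)
    finally show ?thesis .
  qed
  ultimately show ?thesis by blast
qed

section \<open>Polynomial approximation of indicators and uniqueness of compactly supported
  measures\<close>

lemma real_polynomial_function_imp_poly:
  assumes "real_polynomial_function (f :: real \<Rightarrow> real)"
  obtains p where "f = poly p"
proof -
  obtain a n where f: "f = (\<lambda>x. \<Sum>i\<le>n. a i * x ^ i)"
    using assms real_polynomial_function_iff_sum by blast
  have "f = poly (\<Sum>i\<le>n. monom (a i) i)" by (auto simp: f poly_sum poly_monom)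
  thus ?thesis using that by blast
qed

text \<open>Weierstrass approximants of the tent functions
  \<open>max 0 (1 - n * dist(t, K))\<close>, which decrease to the indicator. Tents are at most 1
  and errors at most 1, whence the bound 2. Empty \<open>K\<close> is split off because
  \<open>infdist\<close> to it is 0.\<close>

lemma indicator_closed_poly_approx:
  fixes K :: "real set"
  assumes "closed K"
  obtains p :: "nat \<Rightarrow> real poly" where
    "\<And>t. \<bar>t\<bar> \<le> R \<Longrightarrow> (\<lambda>n. poly (p n) t) \<longlonglongrightarrow> indicator K t"
    "\<And>n t. \<bar>t\<bar> \<le> R \<Longrightarrow> \<bar>poly (p n) t\<bar> \<le> 2"
proof (cases "K = {}")
  case True
  show ?thesis by (rule that[of "\<lambda>n. 0"]) (auto simp: True)
next
  case False
  define f where "f n t = max 0 (1 - real n * infdist t K)" for n t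
  have cont: "continuous_on S (f n)" for n S
    unfolding f_def by (intro continuous_intros)
  have "\<exists>q. \<forall>t. \<bar>t\<bar> \<le> R \<longrightarrow> \<bar>f n t - poly q t\<bar> < inverse (real (Suc n))" for n
  proof -
    have pos: "0 < inverse (real (Suc n))" by simp
    obtain g where g: "real_polynomial_function g" "\<And>x. x \<in> {-R..R} \<Longrightarrow> \<bar>f n x - g x\<bar> < inverse (real (Suc n))"
      using Stone_Weierstrass_real_polynomial_function[OF compact_Icc[of "-R" R] cont[of "{-R..R}" n] pos] by blast
    moreover obtain q where "g = poly q" using real_polynomial_function_imp_poly[OF g(1)] .
    ultimately show ?thesis by (intro exI[of _ q]) (auto simp: abs_le_iff)
  qed
  then obtain p where p: "\<And>n t. \<bar>t\<bar> \<le> R \<Longrightarrow> \<bar>f n t - poly (p n) t\<bar> < inverse (real (Suc n))" by metis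
  have f01: "0 \<le> f n t" "f n t \<le> 1" for n t
    by (auto simp: f_def infdist_nonneg)
  show ?thesis
  proof (rule that)
    fix t :: real assume t: "\<bar>t\<bar> \<le> R"
    have "(\<lambda>n. f n t) \<longlonglongrightarrow> indicator K t"
    proof (cases "t \<in> K")
      case True
      thus ?thesis by (simp add: f_def)
    next
      case notin: False
      hence pos: "infdist t K > 0"
        using infdist_nonneg[of t K] in_closed_iff_infdist_zero[OF assms False, of t] by linarith
      obtain N :: nat where N: "1 / infdist t K < N" using reals_Archimedean2 by blast
      have "f n t = 0" if "n \<ge> N" for n
      proof -
        have "1 < real N * infdist t K" using N pos by (simp add: divide_less_eq)
        also have "\<dots> \<le> real n * infdist t K" using that pos by (simp add: mult_right_mono)
        finally show ?thesis by (simp add: f_def)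
      qed
      thus ?thesis using notin by (auto intro!: tendsto_eventually eventually_sequentiallyI[of N])
    qed
    moreover have "(\<lambda>n. f n t - poly (p n) t) \<longlonglongrightarrow> 0"
      by (rule Lim_null_comparison[OF _ LIMSEQ_inverse_real_of_nat])
        (use p[OF t] in \<open>auto intro!: always_eventually less_imp_le\<close>)
    ultimately have "(\<lambda>n. f n t - (f n t - poly (p n) t)) \<longlonglongrightarrow> indicator K t - 0"
      by (rule tendsto_diff)
    thus "(\<lambda>n. poly (p n) t) \<longlonglongrightarrow> indicator K t" by simp
    fix n
    have "inverse (real (Suc n)) \<le> 1" by (simp add: inverse_le_1_iff)
    thus "\<bar>poly (p n) t\<bar> \<le> 2" using p[OF t, of n] f01[of n t] by linarith
  qed
qed

text \<open>Squares appear because norms of \<open>p(T) \<phi>\<close> are integrals of squared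
  polynomials; the square of an indicator is again the indicator.\<close>

lemma integral_poly_sq_tendsto:
  fixes \<nu> :: "real measure"
  assumes fin: "finite_measure \<nu>" and s: "sets \<nu> = sets borel" and R: "AE t in \<nu>. \<bar>t\<bar> \<le> R"
    and h: "h \<in> borel_measurable borel" "\<And>t. \<bar>t\<bar> \<le> R \<Longrightarrow> \<bar>h t\<bar> \<le> B"
    and K: "closed K"
    and p: "\<And>t. \<bar>t\<bar> \<le> R \<Longrightarrow> (\<lambda>n. poly (p n) t) \<longlonglongrightarrow> indicator K t"
      "\<And>n t. \<bar>t\<bar> \<le> R \<Longrightarrow> \<bar>poly (p n) t\<bar> \<le> 2"
  shows "(\<lambda>n. \<integral>t. (poly (p n) t)\<^sup>2 * h t \<partial>\<nu>) \<longlonglongrightarrow> (\<integral>t. indicator K t * h t \<partial>\<nu>)"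
proof -
  interpret finite_measure \<nu> by (rule fin)
  note [measurable_cong] = s
  note [measurable] = h(1)
  have [measurable]: "K \<in> sets borel" using K by simp
  have [measurable]: "poly q \<in> borel_measurable borel" for q :: "real poly"
    by (intro borel_measurable_continuous_onI continuous_intros)
  show ?thesis
  proof (rule integral_dominated_convergence[where w = "\<lambda>_. 4 * B"])
    show "AE t in \<nu>. (\<lambda>n. (poly (p n) t)\<^sup>2 * h t) \<longlonglongrightarrow> indicator K t * h t"
      using R
    proof eventually_elim
      case (elim t)
      have "(\<lambda>n. (poly (p n) t)\<^sup>2 * h t) \<longlonglongrightarrow> (indicator K t)\<^sup>2 * h t"
        by (intro tendsto_intros p elim)
      moreover have "(indicator K t :: real)\<^sup>2 = indicator K t" by (simp split: split_indicator)
      ultimately show ?case by simp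
    qed
    fix n
    show "AE t in \<nu>. norm ((poly (p n) t)\<^sup>2 * h t) \<le> 4 * B"
      using R
    proof eventually_elim
      case (elim t)
      have "\<bar>poly (p n) t\<bar>\<^sup>2 \<le> 2\<^sup>2" using p(2)[OF elim, of n] by (intro power_mono) auto
      thus ?case unfolding norm_mult using h(2)[OF elim] by (intro mult_mono) auto
    qed
  qed auto
qed

text \<open>The device that turns inequalities between norms into inequalities between measures. Two
  measures on the right serve the estimate for a sum of two vectors; applications with one term take
  \<open>h2 = 0\<close>.\<close>

lemma closed_measure_le_of_poly:
  fixes \<mu> \<nu>1 \<nu>2 :: "real measure"
  assumes \<mu>: "finite_measure \<mu>" "sets \<mu> = sets borel" "AE t in \<mu>. \<bar>t\<bar> \<le> R"
    and \<nu>1: "finite_measure \<nu>1" "sets \<nu>1 = sets borel" "AE t in \<nu>1. \<bar>t\<bar> \<le> R"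
    and \<nu>2: "finite_measure \<nu>2" "sets \<nu>2 = sets borel" "AE t in \<nu>2. \<bar>t\<bar> \<le> R"
    and h1: "h1 \<in> borel_measurable borel" "\<And>t. \<bar>t\<bar> \<le> R \<Longrightarrow> \<bar>h1 t\<bar> \<le> B1"
    and h2: "h2 \<in> borel_measurable borel" "\<And>t. \<bar>t\<bar> \<le> R \<Longrightarrow> \<bar>h2 t\<bar> \<le> B2"
    and le: "\<And>p. (\<integral>t. (poly p t)\<^sup>2 \<partial>\<mu>) \<le> (\<integral>t. (poly p t)\<^sup>2 * h1 t \<partial>\<nu>1) + (\<integral>t. (poly p t)\<^sup>2 * h2 t \<partial>\<nu>2)"
    and K: "closed K"
  shows "measure \<mu> K \<le> (\<integral>t. indicator K t * h1 t \<partial>\<nu>1) + (\<integral>t. indicator K t * h2 t \<partial>\<nu>2)"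
proof -
  obtain p where p: "\<And>t. \<bar>t\<bar> \<le> R \<Longrightarrow> (\<lambda>n. poly (p n) t) \<longlonglongrightarrow> indicator K t"
      "\<And>n t. \<bar>t\<bar> \<le> R \<Longrightarrow> \<bar>poly (p n) t\<bar> \<le> 2"
    using indicator_closed_poly_approx[OF K, of R] by blast
  have "(\<lambda>n. \<integral>t. (poly (p n) t)\<^sup>2 * 1 \<partial>\<mu>) \<longlonglongrightarrow> (\<integral>t. indicator K t * 1 \<partial>\<mu>)"
    by (rule integral_poly_sq_tendsto[OF \<mu> _ _ K p]) auto
  moreover have "(\<lambda>n. (\<integral>t. (poly (p n) t)\<^sup>2 * h1 t \<partial>\<nu>1) + (\<integral>t. (poly (p n) t)\<^sup>2 * h2 t \<partial>\<nu>2))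
      \<longlonglongrightarrow> (\<integral>t. indicator K t * h1 t \<partial>\<nu>1) + (\<integral>t. indicator K t * h2 t \<partial>\<nu>2)"
    by (intro tendsto_add integral_poly_sq_tendsto[OF \<nu>1 h1 K p] integral_poly_sq_tendsto[OF \<nu>2 h2 K p])
  ultimately have "(\<integral>t. indicator K t * 1 \<partial>\<mu>) \<le> (\<integral>t. indicator K t * h1 t \<partial>\<nu>1) + (\<integral>t. indicator K t * h2 t \<partial>\<nu>2)"
    by (rule LIMSEQ_le) (use le in auto)
  moreover have "K \<subseteq> space \<mu>" using sets_eq_imp_space_eq[OF \<mu>(2)] by simp
  ultimately show ?thesis by (simp add: Int_absorb2)
qed

lemma measure_eqI_closed:
  fixes \<mu> \<nu> :: "real measure"
  assumes "finite_measure \<mu>" "sets \<mu> = sets borel" "finite_measure \<nu>" "sets \<nu> = sets borel"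
    and eq: "\<And>K. closed K \<Longrightarrow> measure \<mu> K = measure \<nu> K"
  shows "\<mu> = \<nu>"
proof (rule measure_eqI_generator_eq[of "{K. closed K}" UNIV _ _ "\<lambda>_. UNIV"])
  show "Int_stable {K :: real set. closed K}" by (auto simp: Int_stable_def)
  show "sets \<mu> = sigma_sets UNIV {K. closed K}" "sets \<nu> = sigma_sets UNIV {K. closed K}"
    using assms by (simp_all add: borel_eq_closed)
  show "emeasure \<mu> X = emeasure \<nu> X" if "X \<in> {K. closed K}" for X
    using assms that by (simp add: finite_measure.emeasure_eq_measure)
  show "emeasure \<mu> UNIV \<noteq> \<infinity>" using assms(1) by (simp add: finite_measure.emeasure_finite)
qed auto

lemma measure_eqI_moments_compact:
  fixes \<mu> \<nu> :: "real measure"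
  assumes \<mu>: "finite_measure \<mu>" "sets \<mu> = sets borel" "AE t in \<mu>. \<bar>t\<bar> \<le> R"
    and \<nu>: "finite_measure \<nu>" "sets \<nu> = sets borel" "AE t in \<nu>. \<bar>t\<bar> \<le> R"
    and eq: "\<And>p. (\<integral>t. poly p t \<partial>\<mu>) = (\<integral>t. poly p t \<partial>\<nu>)"
  shows "\<mu> = \<nu>"
proof (rule measure_eqI_closed[OF \<mu>(1,2) \<nu>(1,2)])
  have sq: "(\<integral>t. (poly p t)\<^sup>2 \<partial>\<mu>) = (\<integral>t. (poly p t)\<^sup>2 \<partial>\<nu>)" for p
    using eq[of "p\<^sup>2"] by simp
  fix K :: "real set" assume K: "closed K"
  have "K \<in> sets \<mu>" "K \<in> sets \<nu>" using K \<mu>(2) \<nu>(2) by simp_all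
  note sub = this[THEN sets.sets_into_space]
  have "measure \<mu> K \<le> (\<integral>t. indicator K t * 1 \<partial>\<nu>) + (\<integral>t. indicator K t * 0 \<partial>\<nu>)"
    by (rule closed_measure_le_of_poly[OF \<mu> \<nu> \<nu> _ _ _ _ _ K]) (auto simp: sq)
  moreover have "measure \<nu> K \<le> (\<integral>t. indicator K t * 1 \<partial>\<mu>) + (\<integral>t. indicator K t * 0 \<partial>\<mu>)"
    by (rule closed_measure_le_of_poly[OF \<nu> \<mu> \<mu> _ _ _ _ _ K]) (auto simp: sq)
  ultimately show "measure \<mu> K = measure \<nu> K" using sub by (simp add: Int_absorb2)
qed

section \<open>Square-summable functions\<close>

definition wsq :: "('v \<Rightarrow> real) \<Rightarrow> 'v set \<Rightarrow> ('v \<Rightarrow> complex) \<Rightarrow> real" where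
  "wsq w V \<phi> = (\<Sum>\<^sub>\<infinity>x\<in>V. w x * (cmod (\<phi> x))\<^sup>2)"

abbreviation norm_sq :: "'v set \<Rightarrow> ('v \<Rightarrow> complex) \<Rightarrow> real" where
  "norm_sq \<equiv> wsq (\<lambda>_. 1)"

lemma ell2_norm_eq: "ell2_norm V \<phi> = sqrt (norm_sq V \<phi>)"
  by (simp add: ell2_norm_def wsq_def)

text \<open>Young's inequality. The free \<open>e\<close> allows a factor close to 1 on one summand,
  so that a contraction is not spoiled.\<close>

lemma cmod_add_sq_le: "0 < e \<Longrightarrow> (cmod (a + b))\<^sup>2 \<le> (1 + 1 / e) * (cmod a)\<^sup>2 + (1 + e) * (cmod b)\<^sup>2"
proof -
  assume e: "0 < e"
  have "0 \<le> (cmod a - e * cmod b)\<^sup>2 / e" using e by simp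
  also have "\<dots> = (cmod a)\<^sup>2 / e + e * (cmod b)\<^sup>2 - 2 * (cmod a * cmod b)"
    using e by (simp add: power2_eq_square field_simps)
  finally have "2 * (cmod a * cmod b) \<le> (cmod a)\<^sup>2 / e + e * (cmod b)\<^sup>2" by simp
  moreover have "(cmod (a + b))\<^sup>2 \<le> (cmod a + cmod b)\<^sup>2"
    by (intro power_mono norm_triangle_ineq) auto
  ultimately show ?thesis by (simp add: power2_sum algebra_simps)
qed

lemma ell2_summable: "\<phi> \<in> ell2 V \<Longrightarrow> (\<lambda>x. (cmod (\<phi> x))\<^sup>2) summable_on V"
  by (simp add: ell2_def)

lemma ell2_outside: "\<phi> \<in> ell2 V \<Longrightarrow> x \<notin> V \<Longrightarrow> \<phi> x = 0"
  by (simp add: ell2_def)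

lemma wsq_summable:
  assumes "\<phi> \<in> ell2 V" "\<And>x. x \<in> V \<Longrightarrow> 0 \<le> w x \<and> w x \<le> c"
  shows "(\<lambda>x. w x * (cmod (\<phi> x))\<^sup>2) summable_on V"
  by (rule summable_on_comparison_test[OF summable_on_cmult_right[OF ell2_summable[OF assms(1)], of c]])
    (use assms(2) in \<open>auto intro: mult_right_mono\<close>)

lemma wsq_nonneg: "(\<And>x. x \<in> V \<Longrightarrow> 0 \<le> w x) \<Longrightarrow> 0 \<le> wsq w V \<phi>"
  unfolding wsq_def by (rule infsum_nonneg) simp

lemma wsq_mono:
  assumes "\<phi> \<in> ell2 V" "\<And>x. x \<in> V \<Longrightarrow> 0 \<le> w x \<and> w x \<le> c" "\<And>x. x \<in> V \<Longrightarrow> 0 \<le> w' x \<and> w' x \<le> c'"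
    and "\<And>x. x \<in> V \<Longrightarrow> w x \<le> C * w' x"
  shows "wsq w V \<phi> \<le> C * wsq w' V \<phi>"
proof -
  have "wsq w V \<phi> \<le> (\<Sum>\<^sub>\<infinity>x\<in>V. C * (w' x * (cmod (\<phi> x))\<^sup>2))"
    unfolding wsq_def
  proof (rule infsum_mono)
    show "w x * (cmod (\<phi> x))\<^sup>2 \<le> C * (w' x * (cmod (\<phi> x))\<^sup>2)" if "x \<in> V" for x
      using mult_right_mono[OF assms(4)[OF that], of "(cmod (\<phi> x))\<^sup>2"] by (simp add: mult.assoc)
  qed (use wsq_summable[OF assms(1,2)] wsq_summable[OF assms(1,3)] in \<open>auto intro: summable_on_cmult_right\<close>)
  thus ?thesis by (simp add: wsq_def infsum_cmult_right')
qed

lemma norm_sq_term_le: "\<phi> \<in> ell2 V \<Longrightarrow> (cmod (\<phi> x))\<^sup>2 \<le> norm_sq V \<phi>"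
proof (cases "x \<in> V")
  case True
  assume "\<phi> \<in> ell2 V"
  thus ?thesis using finite_sum_le_infsum[OF ell2_summable, of \<phi> V "{x}"] True by (simp add: wsq_def)
qed (simp add: ell2_outside wsq_nonneg)

lemma norm_sq_eq_0D: "\<phi> \<in> ell2 V \<Longrightarrow> norm_sq V \<phi> \<le> 0 \<Longrightarrow> \<phi> x = 0"
  using order_trans[OF norm_sq_term_le[of \<phi> V x], of 0] by simp

lemma ell2_zero: "(\<lambda>x. 0) \<in> ell2 V"
  by (simp add: ell2_def)

lemma ell2_add:
  assumes "\<phi> \<in> ell2 V" "\<psi> \<in> ell2 V"
  shows "(\<lambda>x. \<phi> x + \<psi> x) \<in> ell2 V"
  unfolding ell2_def mem_Collect_eq
proof (intro conjI allI impI)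
  have "(\<lambda>x. (1 + 1/1) * (cmod (\<phi> x))\<^sup>2 + (1 + 1) * (cmod (\<psi> x))\<^sup>2) summable_on V"
    by (intro summable_on_add summable_on_cmult_right ell2_summable assms)
  thus "(\<lambda>x. (cmod (\<phi> x + \<psi> x))\<^sup>2) summable_on V"
    by (rule summable_on_comparison_test) (auto intro: cmod_add_sq_le[of 1, simplified])
qed (use assms in \<open>auto simp: ell2_outside\<close>)

lemma ell2_cmult: "\<phi> \<in> ell2 V \<Longrightarrow> (\<lambda>x. c * \<phi> x) \<in> ell2 V"
  by (auto simp: ell2_def norm_mult power_mult_distrib intro: summable_on_cmult_right)

lemma ell2_diff: "\<phi> \<in> ell2 V \<Longrightarrow> \<psi> \<in> ell2 V \<Longrightarrow> (\<lambda>x. \<phi> x - \<psi> x) \<in> ell2 V"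
  using ell2_add[of \<phi> V "\<lambda>x. -1 * \<psi> x"] ell2_cmult[of \<psi> V "-1"] by simp

lemma ell2_sum: "(\<And>i. i \<in> I \<Longrightarrow> \<phi> i \<in> ell2 V) \<Longrightarrow> (\<lambda>x. \<Sum>i\<in>I. \<phi> i x) \<in> ell2 V"
  by (induction I rule: infinite_finite_induct) (auto intro: ell2_zero ell2_add)

lemma ell2_single: "v \<in> V \<Longrightarrow> (\<lambda>x. if x = v then c else 0) \<in> ell2 V"
  by (auto simp: ell2_def intro!: finite_nonzero_values_imp_summable_on intro: finite_subset[of _ "{v}"] split: if_splits)

lemma norm_sq_cmult: "norm_sq V (\<lambda>x. c * \<phi> x) = (cmod c)\<^sup>2 * norm_sq V \<phi>"
  by (simp add: wsq_def norm_mult power_mult_distrib infsum_cmult_right')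

lemma wsq_add_le:
  assumes "\<phi> \<in> ell2 V" "\<psi> \<in> ell2 V" "\<And>x. x \<in> V \<Longrightarrow> 0 \<le> w x \<and> w x \<le> c" "0 < e"
  shows "wsq w V (\<lambda>x. \<phi> x + \<psi> x) \<le> (1 + 1 / e) * wsq w V \<phi> + (1 + e) * wsq w V \<psi>"
proof -
  note s = wsq_summable[OF assms(1,3)] wsq_summable[OF assms(2,3)] wsq_summable[OF ell2_add[OF assms(1,2)] assms(3)]
  have "wsq w V (\<lambda>x. \<phi> x + \<psi> x)
      \<le> (\<Sum>\<^sub>\<infinity>x\<in>V. (1 + 1 / e) * (w x * (cmod (\<phi> x))\<^sup>2) + (1 + e) * (w x * (cmod (\<psi> x))\<^sup>2))"
    unfolding wsq_def
  proof (rule infsum_mono)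
    fix x assume "x \<in> V"
    hence "w x * (cmod (\<phi> x + \<psi> x))\<^sup>2 \<le> w x * ((1 + 1 / e) * (cmod (\<phi> x))\<^sup>2 + (1 + e) * (cmod (\<psi> x))\<^sup>2)"
      using assms(3,4) by (intro mult_left_mono cmod_add_sq_le) auto
    thus "w x * (cmod (\<phi> x + \<psi> x))\<^sup>2 \<le> (1 + 1 / e) * (w x * (cmod (\<phi> x))\<^sup>2) + (1 + e) * (w x * (cmod (\<psi> x))\<^sup>2)"
      by (simp add: distrib_left mult.left_commute)
  qed (use s in \<open>auto intro!: summable_on_add summable_on_cmult_right\<close>)
  also have "\<dots> = (1 + 1 / e) * wsq w V \<phi> + (1 + e) * wsq w V \<psi>"
    unfolding wsq_def using s by (subst infsum_add) (auto intro: summable_on_cmult_right simp: infsum_cmult_right')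
  finally show ?thesis .
qed

lemma norm_sq_add_le:
  "\<phi> \<in> ell2 V \<Longrightarrow> \<psi> \<in> ell2 V \<Longrightarrow> norm_sq V (\<lambda>x. \<phi> x + \<psi> x) \<le> 2 * norm_sq V \<phi> + 2 * norm_sq V \<psi>"
  using wsq_add_le[of \<phi> V \<psi> "\<lambda>_. 1" 1 1] by simp

lemma ell2_inner_abs_summable:
  assumes "\<phi> \<in> ell2 V" "\<psi> \<in> ell2 V"
  shows "(\<lambda>x. norm (cnj (\<phi> x) * \<psi> x)) summable_on V"
proof (rule summable_on_comparison_test)
  show "(\<lambda>x. (cmod (\<phi> x))\<^sup>2 + (cmod (\<psi> x))\<^sup>2) summable_on V"
    by (intro summable_on_add ell2_summable assms)
  show "norm (cnj (\<phi> x) * \<psi> x) \<le> (cmod (\<phi> x))\<^sup>2 + (cmod (\<psi> x))\<^sup>2" for x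
  proof -
    have "0 \<le> cmod (\<phi> x) * cmod (\<psi> x)" by simp
    thus ?thesis using sum_squares_bound[of "cmod (\<phi> x)" "cmod (\<psi> x)"] by (simp only: norm_mult complex_mod_cnj)
  qed
qed simp

lemma ell2_inner_summable:
  "\<phi> \<in> ell2 V \<Longrightarrow> \<psi> \<in> ell2 V \<Longrightarrow> (\<lambda>x. cnj (\<phi> x) * \<psi> x) summable_on V"
  by (rule abs_summable_summable) (rule ell2_inner_abs_summable)

lemma ell2_inner_add_right:
  "\<phi> \<in> ell2 V \<Longrightarrow> \<psi> \<in> ell2 V \<Longrightarrow> \<xi> \<in> ell2 V \<Longrightarrow>
    ell2_inner V \<phi> (\<lambda>x. \<psi> x + \<xi> x) = ell2_inner V \<phi> \<psi> + ell2_inner V \<phi> \<xi>"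
  by (simp add: ell2_inner_def distrib_left infsum_add ell2_inner_summable)

lemma ell2_inner_cmult_right: "ell2_inner V \<phi> (\<lambda>x. c * \<psi> x) = c * ell2_inner V \<phi> \<psi>"
  by (simp add: ell2_inner_def mult.left_commute infsum_cmult_right')

lemma ell2_inner_cnj: "cnj (ell2_inner V \<phi> \<psi>) = ell2_inner V \<psi> \<phi>"
  by (simp add: ell2_inner_def mult.commute flip: infsum_cnj)

lemma ell2_inner_add_left:
  "\<phi> \<in> ell2 V \<Longrightarrow> \<psi> \<in> ell2 V \<Longrightarrow> \<xi> \<in> ell2 V \<Longrightarrow>
    ell2_inner V (\<lambda>x. \<psi> x + \<xi> x) \<phi> = ell2_inner V \<psi> \<phi> + ell2_inner V \<xi> \<phi>"
  by (simp add: ell2_inner_add_right flip: ell2_inner_cnj[of V \<phi>])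

lemma ell2_inner_cmult_left: "ell2_inner V (\<lambda>x. c * \<psi> x) \<phi> = cnj c * ell2_inner V \<psi> \<phi>"
  by (simp add: ell2_inner_cmult_right flip: ell2_inner_cnj[of V \<phi>])

lemma ell2_inner_self:
  assumes "\<phi> \<in> ell2 V"
  shows "ell2_inner V \<phi> \<phi> = complex_of_real (norm_sq V \<phi>)"
proof -
  have "ell2_inner V \<phi> \<phi> = (\<Sum>\<^sub>\<infinity>x\<in>V. complex_of_real ((cmod (\<phi> x))\<^sup>2))"
    unfolding ell2_inner_def by (intro infsum_cong) (simp only: complex_norm_square mult.commute)
  also have "\<dots> = complex_of_real (\<Sum>\<^sub>\<infinity>x\<in>V. (cmod (\<phi> x))\<^sup>2)"
    by (intro infsumI has_sum_of_real has_sum_infsum ell2_summable assms)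
  finally show ?thesis by (simp add: wsq_def)
qed

lemma ell2_inner_single: "v \<in> V \<Longrightarrow> ell2_inner V (\<lambda>x. if x = v then c else 0) \<psi> = cnj c * \<psi> v"
proof -
  assume v: "v \<in> V"
  have "ell2_inner V (\<lambda>x. if x = v then c else 0) \<psi> = (\<Sum>\<^sub>\<infinity>x\<in>{v}. cnj c * \<psi> x)"
    unfolding ell2_inner_def using v by (intro infsum_cong_neutral) auto
  thus ?thesis by simp
qed

lemma ell2_finite_approx:
  assumes \<phi>: "\<phi> \<in> ell2 V" and e: "e > 0"
  obtains F where "finite F" "F \<subseteq> V" "norm_sq V (\<lambda>x. \<phi> x - (if x \<in> F then \<phi> x else 0)) \<le> e"
proof -
  note s = ell2_summable[OF \<phi>]
  obtain F where F: "finite F" "F \<subseteq> V" "dist (\<Sum>x\<in>F. (cmod (\<phi> x))\<^sup>2) (\<Sum>\<^sub>\<infinity>x\<in>V. (cmod (\<phi> x))\<^sup>2) \<le> e"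
    using infsum_finite_approximation[OF s e] by blast
  have "(\<Sum>\<^sub>\<infinity>x\<in>V. (cmod (\<phi> x))\<^sup>2) = (\<Sum>\<^sub>\<infinity>x\<in>F. (cmod (\<phi> x))\<^sup>2) + (\<Sum>\<^sub>\<infinity>x\<in>V - F. (cmod (\<phi> x))\<^sup>2)"
  proof -
    have "(\<Sum>\<^sub>\<infinity>x\<in>F \<union> (V - F). (cmod (\<phi> x))\<^sup>2) = (\<Sum>\<^sub>\<infinity>x\<in>F. (cmod (\<phi> x))\<^sup>2) + (\<Sum>\<^sub>\<infinity>x\<in>V - F. (cmod (\<phi> x))\<^sup>2)"
      using F s by (intro infsum_Un_disjoint summable_on_subset_banach[OF s]) auto
    thus ?thesis using F(2) by (simp add: Un_absorb1)
  qed
  moreover have "norm_sq V (\<lambda>x. \<phi> x - (if x \<in> F then \<phi> x else 0)) = (\<Sum>\<^sub>\<infinity>x\<in>V - F. (cmod (\<phi> x))\<^sup>2)"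
    unfolding wsq_def by (intro infsum_cong_neutral) auto
  ultimately have "norm_sq V (\<lambda>x. \<phi> x - (if x \<in> F then \<phi> x else 0)) \<le> e"
    using F by (simp add: dist_real_def)
  thus ?thesis using that F by blast
qed

text \<open>The setting for solving \<open>\<phi> = f + B \<phi>\<close>. As \<open>wsq\<close> is a
  squared norm, \<open>q\<close> is the square of a contraction factor. Continuity is asked only for
  pointwise convergence, which holds for operators that look at finitely many neighbours.\<close>

locale ell2_contraction =
  fixes V :: "'v set" and B :: "('v \<Rightarrow> complex) \<Rightarrow> 'v \<Rightarrow> complex" and w :: "'v \<Rightarrow> real" and lo hi q :: real
  assumes w: "\<And>x. x \<in> V \<Longrightarrow> lo \<le> w x \<and> w x \<le> hi" and lo: "0 < lo" and q: "0 < q" "q < 1"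
    and add: "\<And>\<phi> \<psi> x. B (\<lambda>y. \<phi> y + \<psi> y) x = B \<phi> x + B \<psi> x"
    and cont: "\<And>\<phi>n \<phi> x. (\<And>y. (\<lambda>n. \<phi>n n y) \<longlonglongrightarrow> \<phi> y) \<Longrightarrow> (\<lambda>n::nat. B (\<phi>n n) x) \<longlonglongrightarrow> B \<phi> x"
    and B_ell2: "\<And>\<phi>. \<phi> \<in> ell2 V \<Longrightarrow> B \<phi> \<in> ell2 V"
    and B_contr: "\<And>\<phi>. \<phi> \<in> ell2 V \<Longrightarrow> wsq w V (B \<phi>) \<le> q * wsq w V \<phi>"
begin

text \<open>The fixed point of \<open>x \<mapsto> c1 + (1 + q) / 2 * x\<close> with
  \<open>c1 = 1 + 2 * q / (1 - q)\<close>, the recursion produced by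
  \<open>step_bound\<close>.\<close>

definition "bound_const = (1 + 2 * q / (1 - q)) * (2 / (1 - q))"

lemma w0: "x \<in> V \<Longrightarrow> 0 \<le> w x \<and> w x \<le> hi"
  using w lo by (meson less_imp_le order_trans)

lemma bound_const_pos: "bound_const > 0"
  unfolding bound_const_def using q by (intro mult_pos_pos add_pos_pos) auto

text \<open>Young's inequality with \<open>e = (1 - q) / (2 * q)\<close>, chosen so that
  \<open>(1 + e) * q = (1 + q) / 2\<close> is still below 1.\<close>

lemma step_bound:
  assumes "\<phi> \<in> ell2 V" "f \<in> ell2 V"
  shows "wsq w V (\<lambda>x. f x + B \<phi> x) \<le> (1 + 2 * q / (1 - q)) * wsq w V f + (1 + q) / 2 * wsq w V \<phi>"
proof -
  have "1 + 1 / ((1 - q) / (2 * q)) = 1 + 2 * q / (1 - q)" "1 + (1 - q) / (2 * q) = (1 + q) / (2 * q)"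
    using q by (simp_all add: field_simps)
  hence "wsq w V (\<lambda>x. f x + B \<phi> x) \<le> (1 + 2 * q / (1 - q)) * wsq w V f + (1 + q) / (2 * q) * wsq w V (B \<phi>)"
    using wsq_add_le[where \<phi> = f and \<psi> = "B \<phi>" and V = V and w = w and c = hi and e = "(1 - q) / (2 * q)"]
      assms w0 q B_ell2 by simp
  also have "(1 + q) / (2 * q) * wsq w V (B \<phi>) \<le> (1 + q) / (2 * q) * (q * wsq w V \<phi>)"
    using q by (intro mult_left_mono B_contr assms) auto
  finally show ?thesis using q by simp
qed

lemma solution_bound:
  assumes "\<phi> \<in> ell2 V" "f \<in> ell2 V" "\<And>x. \<phi> x = f x + B \<phi> x"
  shows "wsq w V \<phi> \<le> bound_const * wsq w V f"
proof -
  have "(\<lambda>x. f x + B \<phi> x) = \<phi>" using assms(3) by auto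
  hence "wsq w V \<phi> \<le> (1 + 2 * q / (1 - q)) * wsq w V f + (1 + q) / 2 * wsq w V \<phi>"
    using step_bound[OF assms(1,2)] by simp
  moreover have "wsq w V \<phi> - (1 + q) / 2 * wsq w V \<phi> = wsq w V \<phi> * ((1 - q) / 2)"
    by (simp add: field_simps)
  ultimately have "wsq w V \<phi> * ((1 - q) / 2) \<le> (1 + 2 * q / (1 - q)) * wsq w V f" by linarith
  hence "wsq w V \<phi> \<le> (1 + 2 * q / (1 - q)) * wsq w V f / ((1 - q) / 2)"
    using q by (simp only: pos_le_divide_eq half_gt_zero_iff diff_gt_0_iff_gt)
  moreover have "c1 * F / ((1 - q) / 2) = c1 * (2 / (1 - q)) * F" for c1 F :: real by simp
  ultimately show ?thesis by (simp only: bound_const_def)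
qed

lemma norm_sq_le_wsq: "\<phi> \<in> ell2 V \<Longrightarrow> norm_sq V \<phi> \<le> (1 / lo) * wsq w V \<phi>"
  by (rule wsq_mono[where c = 1 and c' = hi]) (use w0 w lo in \<open>auto simp: field_simps\<close>)

lemma wsq_le_norm_sq: "\<phi> \<in> ell2 V \<Longrightarrow> wsq w V \<phi> \<le> hi * norm_sq V \<phi>"
  by (rule wsq_mono[where c = hi and c' = 1]) (use w0 w lo in \<open>auto\<close>)

text \<open>The Neumann series is summed pointwise, where its terms decay geometrically. Its partial
  sums have uniformly bounded weighted norms, and passing to the limit in finite subsums puts the
  solution into \<open>ell2 V\<close>.\<close>

lemma solution_exists:
  assumes f: "f \<in> ell2 V"
  shows "\<exists>\<phi>\<in>ell2 V. \<forall>x. \<phi> x = f x + B \<phi> x"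
proof -
  define F where "F n = (B ^^ n) f" for n
  define s where "s n = (\<lambda>x. \<Sum>i<n. F i x)" for n
  have zero: "B (\<lambda>y. 0) x = 0" for x using add[of "\<lambda>y. 0" "\<lambda>y. 0" x] by simp
  have Fe: "F n \<in> ell2 V" for n unfolding F_def by (induction n) (auto intro: f B_ell2)
  have Fb: "wsq w V (F n) \<le> q ^ n * wsq w V f" for n
  proof (induction n)
    case (Suc n)
    have "wsq w V (F (Suc n)) \<le> q * wsq w V (F n)" using B_contr[OF Fe[of n]] by (simp add: F_def)
    also have "\<dots> \<le> q * (q ^ n * wsq w V f)" using Suc q by (intro mult_left_mono) auto
    finally show ?case by simp
  qed (simp add: F_def)
  have sS: "s (Suc n) x = f x + B (s n) x" for n x
  proof -
    have "B (s n) x = (\<Sum>i<n. B (F i) x)" for n x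
      unfolding s_def by (induction n) (simp_all add: zero add)
    hence "f x + B (s n) x = F 0 x + (\<Sum>i<n. F (Suc i) x)" by (simp add: F_def)
    thus ?thesis unfolding s_def by (simp add: sum.lessThan_Suc_shift del: sum.lessThan_Suc)
  qed
  have se: "s n \<in> ell2 V" for n unfolding s_def by (intro ell2_sum Fe)
  have sb: "wsq w V (s n) \<le> bound_const * wsq w V f" for n
  proof (induction n)
    case 0
    thus ?case using bound_const_pos wsq_nonneg[of V w f] w0 by (simp add: s_def wsq_def)
  next
    case (Suc n)
    have "wsq w V (s (Suc n)) = wsq w V (\<lambda>x. f x + B (s n) x)" using sS by presburger
    also have "\<dots> \<le> (1 + 2 * q / (1 - q)) * wsq w V f + (1 + q) / 2 * wsq w V (s n)"
      by (rule step_bound[OF se f])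
    also have "\<dots> \<le> (1 + 2 * q / (1 - q)) * wsq w V f + (1 + q) / 2 * (bound_const * wsq w V f)"
      using Suc q by (intro add_left_mono mult_left_mono) auto
    also have "\<dots> = bound_const * wsq w V f"
    proof -
      define c1 where "c1 = 1 + 2 * q / (1 - q)"
      have c: "bound_const = c1 * (2 / (1 - q))" by (simp add: bound_const_def c1_def)
      have "c1 + (1 + q) / 2 * bound_const = bound_const" unfolding c using q by (simp add: field_simps)
      moreover have "c1 * F + (1 + q) / 2 * (bound_const * F) = (c1 + (1 + q) / 2 * bound_const) * F" for F
        by (simp add: distrib_right)
      ultimately show ?thesis by (simp only: c1_def)
    qed
    finally show ?case .
  qed
  define \<phi> where "\<phi> x = (\<Sum>i. F i x)" for x
  have sl: "(\<lambda>n. s n x) \<longlonglongrightarrow> \<phi> x" for x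
  proof -
    have "norm (F n x) \<le> sqrt ((1 / lo) * wsq w V f) * sqrt q ^ n" for n
    proof -
      have "(cmod (F n x))\<^sup>2 \<le> norm_sq V (F n)" by (rule norm_sq_term_le[OF Fe])
      also have "\<dots> \<le> (1 / lo) * (q ^ n * wsq w V f)"
        using lo by (intro order_trans[OF norm_sq_le_wsq[OF Fe] mult_left_mono[OF Fb]]) simp
      finally have "cmod (F n x) \<le> sqrt ((1 / lo) * (q ^ n * wsq w V f))" by (simp add: real_le_rsqrt)
      thus ?thesis by (simp add: real_sqrt_mult real_sqrt_power real_sqrt_divide mult_ac)
    qed
    moreover have "summable (\<lambda>n. sqrt ((1 / lo) * wsq w V f) * sqrt q ^ n)"
      using q by (intro summable_mult summable_geometric) (auto simp: real_sqrt_lt_1_iff)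
    ultimately have "summable (\<lambda>n. F n x)" by (meson summable_comparison_test')
    thus ?thesis unfolding s_def \<phi>_def by (rule summable_LIMSEQ)
  qed
  have eq: "\<phi> x = f x + B \<phi> x" for x
  proof (rule LIMSEQ_unique)
    show "(\<lambda>n. s (Suc n) x) \<longlonglongrightarrow> \<phi> x" using sl by (rule LIMSEQ_Suc)
    show "(\<lambda>n. s (Suc n) x) \<longlonglongrightarrow> f x + B \<phi> x"
      unfolding sS by (intro tendsto_add tendsto_const cont sl)
  qed
  have "\<phi> \<in> ell2 V"
    unfolding ell2_def mem_Collect_eq
  proof (intro conjI allI impI)
    show "\<phi> x = 0" if "x \<notin> V" for x
      using ell2_outside[OF Fe that] by (simp add: \<phi>_def)
    show "(\<lambda>x. (cmod (\<phi> x))\<^sup>2) summable_on V"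
    proof (rule nonneg_bdd_above_summable_on)
      show "bdd_above (sum (\<lambda>x. (cmod (\<phi> x))\<^sup>2) ` {F. F \<subseteq> V \<and> finite F})"
      proof (rule bdd_aboveI2[where M = "(1 / lo) * (bound_const * wsq w V f)"])
        fix G assume "G \<in> {F. F \<subseteq> V \<and> finite F}"
        hence G: "G \<subseteq> V" "finite G" by auto
        have "(\<lambda>n. \<Sum>x\<in>G. (cmod (s n x))\<^sup>2) \<longlonglongrightarrow> (\<Sum>x\<in>G. (cmod (\<phi> x))\<^sup>2)"
          by (intro tendsto_intros sl)
        moreover have "(\<Sum>x\<in>G. (cmod (s n x))\<^sup>2) \<le> (1 / lo) * (bound_const * wsq w V f)" for n
        proof -
          have "(\<Sum>x\<in>G. (cmod (s n x))\<^sup>2) \<le> norm_sq V (s n)"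
            using finite_sum_le_infsum[OF ell2_summable[OF se] G(2,1)] by (simp add: wsq_def)
          also have "\<dots> \<le> (1 / lo) * (bound_const * wsq w V f)"
            using lo by (intro order_trans[OF norm_sq_le_wsq[OF se] mult_left_mono[OF sb]]) simp
          finally show ?thesis .
        qed
        ultimately show "(\<Sum>x\<in>G. (cmod (\<phi> x))\<^sup>2) \<le> (1 / lo) * (bound_const * wsq w V f)"
          by (meson LIMSEQ_le_const2)
      qed
    qed auto
  qed
  thus ?thesis using eq by blast
qed

end

lemma contraction_solution_bound:
  assumes "ell2_contraction V B w lo hi q"
  shows "\<exists>K. \<forall>\<phi>\<in>ell2 V. \<forall>f\<in>ell2 V. (\<forall>x. \<phi> x = f x + B \<phi> x) \<longrightarrow> norm_sq V \<phi> \<le> K * norm_sq V f"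
proof -
  interpret ell2_contraction V B w lo hi q by fact
  have "norm_sq V \<phi> \<le> (1 / lo * (bound_const * hi)) * norm_sq V f"
    if "\<phi> \<in> ell2 V" "f \<in> ell2 V" "\<And>x. \<phi> x = f x + B \<phi> x" for \<phi> f
  proof -
    have "norm_sq V \<phi> \<le> 1 / lo * wsq w V \<phi>" by (rule norm_sq_le_wsq[OF that(1)])
    also have "\<dots> \<le> 1 / lo * (bound_const * wsq w V f)"
      using lo by (intro mult_left_mono solution_bound that) auto
    also have "\<dots> \<le> 1 / lo * (bound_const * (hi * norm_sq V f))"
      using lo bound_const_pos by (intro mult_left_mono wsq_le_norm_sq that) auto
    finally show ?thesis by (simp add: mult.assoc)
  qed
  thus ?thesis by blast
qed

lemma wsq_neg: "wsq w V (\<lambda>x. - \<phi> x) = wsq w V \<phi>"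
  by (simp add: wsq_def)

lemma ell2_neg: "\<phi> \<in> ell2 V \<Longrightarrow> (\<lambda>x. - \<phi> x) \<in> ell2 V"
  using ell2_cmult[of \<phi> V "-1"] by simp

section \<open>Spectral measures of bounded symmetric operators\<close>

lemma poly_functional_eqI:
  fixes f g :: "real poly \<Rightarrow> real"
  assumes "\<And>p q. f (p + q) = f p + f q" "\<And>c p. f (smult c p) = c * f p"
    and "\<And>p q. g (p + q) = g p + g q" "\<And>c p. g (smult c p) = c * g p"
    and "\<And>n. f (monom 1 n) = g (monom 1 n)"
  shows "f p = g p"
proof -
  have z: "f 0 = 0" "g 0 = 0" using assms(2)[of 0 0] assms(4)[of 0 0] by simp_all
  have s: "f (sum h I) = (\<Sum>i\<in>I. f (h i))" "g (sum h I) = (\<Sum>i\<in>I. g (h i))" for h and I :: "nat set"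
    by (induction I rule: infinite_finite_induct) (auto simp: assms z)
  have "f (monom (coeff p i) i) = g (monom (coeff p i) i)" for i
    using assms(2)[of "coeff p i" "monom 1 i"] assms(4)[of "coeff p i" "monom 1 i"] assms(5)[of i]
    by (simp add: smult_monom)
  hence "f (\<Sum>i\<le>degree p. monom (coeff p i) i) = g (\<Sum>i\<le>degree p. monom (coeff p i) i)" by (simp add: s)
  thus ?thesis by (simp add: poly_as_sum_of_monoms)
qed

lemma integrable_poly_compact:
  fixes \<mu> :: "real measure"
  assumes "finite_measure \<mu>" "sets \<mu> = sets borel" "AE t in \<mu>. \<bar>t\<bar> \<le> R"
  shows "integrable \<mu> (\<lambda>t. poly p t)"
proof -
  interpret finite_measure \<mu> by fact
  have c: "continuous_on UNIV (poly p)" by (intro continuous_intros)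
  hence "bounded (poly p ` {-R..R})"
    by (intro compact_imp_bounded compact_continuous_image) (auto intro: continuous_on_subset)
  then obtain B where "\<forall>y\<in>poly p ` {-R..R}. norm y \<le> B" unfolding bounded_iff by blast
  hence B: "norm (poly p t) \<le> B" if "\<bar>t\<bar> \<le> R" for t using that by (auto simp: abs_le_iff)
  show ?thesis
  proof (rule integrable_const_bound[of _ B])
    show "AE t in \<mu>. norm (poly p t) \<le> B" using assms(3) by eventually_elim (rule B)
    show "poly p \<in> borel_measurable \<mu>"
      using borel_measurable_continuous_onI[OF c] by (simp add: measurable_cong_sets[OF assms(2) refl])
  qed
qed

text \<open>A null set lies in an open set of small Lebesgue measure; its components are disjoint
  intervals, on each of which the hypothesis compares the two measures.\<close>

lemma absolutely_continuous_intervalI: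
  fixes \<mu> :: "real measure"
  assumes fin: "finite_measure \<mu>" and s: "sets \<mu> = sets borel" and R: "AE t in \<mu>. \<bar>t\<bar> \<le> R"
    and C: "\<And>a b. a < b \<Longrightarrow> measure \<mu> {a..b} \<le> C * (b - a)"
  shows "absolutely_continuous lborel \<mu>"
  unfolding absolutely_continuous_def
proof
  interpret finite_measure \<mu> by (rule fin)
  fix N :: "real set" assume N: "N \<in> null_sets lborel"
  hence Nb: "N \<in> sets borel" by auto
  have C0: "C \<ge> 0" using order_trans[OF measure_nonneg C[of 0 1]] by simp
  have interval: "emeasure \<mu> I \<le> ennreal C * emeasure lborel I" if I: "open I" "connected I" "bounded I" "I \<noteq> {}" for I :: "real set"
  proof -
    have bd: "bdd_above I" "bdd_below I" using I bounded_imp_bdd_above bounded_imp_bdd_below by auto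
    let ?a = "Inf I" and ?b = "Sup I"
    have sub: "I \<subseteq> {?a..?b}" using bd by (auto intro: cInf_lower cSup_upper)
    have sup: "{?a<..<?b} \<subseteq> I"
    proof
      fix t assume t: "t \<in> {?a<..<?b}"
      then obtain x y where "x \<in> I" "x < t" "y \<in> I" "t < y"
        using cInf_less_iff[of I t] less_cSup_iff[of I t] I(4) bd by auto
      thus "t \<in> I" using I(2) by (meson connected_contains_Icc atLeastAtMost_iff less_imp_le subsetD)
    qed
    obtain x where x: "x \<in> I" using I by auto
    obtain e where e: "e > 0" "ball x e \<subseteq> I" using I(1) x openE by blast
    have "x + e/2 \<in> I" using e by (auto simp: dist_real_def intro!: subsetD[OF e(2)])
    hence "x \<in> {?a..?b}" "x + e/2 \<in> {?a..?b}" using sub x by blast+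
    hence lt: "?a < ?b" using e(1) by simp
    have "emeasure \<mu> I \<le> emeasure \<mu> {?a..?b}" using sub s by (intro emeasure_mono) auto
    also have "\<dots> \<le> ennreal (C * (?b - ?a))" using C[OF lt] by (simp add: emeasure_eq_measure ennreal_leI)
    also have "\<dots> = ennreal C * emeasure lborel {?a<..<?b}" using lt C0 by (simp add: ennreal_mult)
    also have "\<dots> \<le> ennreal C * emeasure lborel I"
      using sup I(1) by (intro mult_left_mono emeasure_mono) auto
    finally show ?thesis .
  qed
  have bound: "emeasure \<mu> (N \<inter> {-R-1<..<R+1}) \<le> ennreal C * ennreal e" if e: "e > 0" for e
  proof -
    obtain U where U: "open U" "N \<subseteq> U" "emeasure lborel (U - N) < ennreal e"
      using outer_regular_lborel[OF Nb, of e] e by auto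
    have U2: "emeasure lborel U \<le> ennreal e"
    proof -
      have "emeasure lborel U = emeasure lborel (N \<union> (U - N))" using U(2) by (simp add: Un_absorb1)
      also have "\<dots> \<le> emeasure lborel N + emeasure lborel (U - N)"
        using Nb U(1) by (intro emeasure_subadditive) auto
      finally show ?thesis using N U(3) by auto
    qed
    \<comment> \<open>Cutting with a bounded window makes all components bounded; the margin 1 keeps
      the support, up to \<open>\<plusminus>R\<close>, inside the open window.\<close>
    define W where "W = U \<inter> {-R-1<..<R+1}"
    have W: "open W" "bounded W" using U(1) by (auto simp: W_def intro: bounded_subset[of "{-R-1<..<R+1}"])
    have cnt: "countable (components W)"
      using pairwise_disjoint_components[of W] open_components[OF W(1)]
      by (intro countable_disjoint_open_subsets) (auto simp: pairwise_def disjnt_def)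
    have comp: "open I" "connected I" "bounded I" "I \<noteq> {}" if "I \<in> components W" for I
      using open_components[OF W(1) that] in_components_connected[OF that] in_components_nonempty[OF that]
        bounded_subset[OF W(2) in_components_subset[OF that]] by blast+
    have disj: "disjoint_family_on (\<lambda>I. I) (components W)"
      using pairwise_disjoint_components[of W] by (auto simp: disjoint_family_on_def pairwise_def disjnt_def)
    have WU: "W = (\<Union>I\<in>components W. I)" using Union_components[of W] by simp
    have "emeasure \<mu> (\<Union>I\<in>components W. I) = (\<integral>\<^sup>+I. emeasure \<mu> I \<partial>count_space (components W))"
      using cnt comp disj s by (intro emeasure_UN_countable) auto
    also have "\<dots> \<le> (\<integral>\<^sup>+I. ennreal C * emeasure lborel I \<partial>count_space (components W))"
      using interval comp by (intro nn_integral_mono) auto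
    also have "\<dots> = ennreal C * (\<integral>\<^sup>+I. emeasure lborel I \<partial>count_space (components W))"
      by (rule nn_integral_cmult) auto
    also have "(\<integral>\<^sup>+I. emeasure lborel I \<partial>count_space (components W)) = emeasure lborel (\<Union>I\<in>components W. I)"
      using cnt comp disj by (intro emeasure_UN_countable[symmetric]) auto
    finally have "emeasure \<mu> W \<le> ennreal C * emeasure lborel W" using WU by simp
    also have "\<dots> \<le> ennreal C * emeasure lborel U"
      using U(1) by (intro mult_left_mono emeasure_mono) (auto simp: W_def)
    also have "\<dots> \<le> ennreal C * ennreal e" by (intro mult_left_mono U2) auto
    finally have "emeasure \<mu> W \<le> ennreal C * ennreal e" .
    moreover have "emeasure \<mu> (N \<inter> {-R-1<..<R+1}) \<le> emeasure \<mu> W"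
      using U(2) W(1) s by (intro emeasure_mono) (auto simp: W_def)
    ultimately show ?thesis by (rule order_trans[rotated])
  qed
  have "measure \<mu> (N \<inter> {-R-1<..<R+1}) \<le> 0"
  proof (rule field_le_epsilon)
    fix e :: real assume e: "e > 0"
    have "measure \<mu> (N \<inter> {-R-1<..<R+1}) \<le> C * (e / (C + 1))"
      using bound[of "e / (C + 1)"] e C0 by (simp add: emeasure_eq_measure ennreal_mult[symmetric])
    also have "\<dots> \<le> 0 + e" using e C0 by (simp add: field_simps)
    finally show "measure \<mu> (N \<inter> {-R-1<..<R+1}) \<le> 0 + e" .
  qed
  hence "emeasure \<mu> (N \<inter> {-R-1<..<R+1}) = 0" by (simp add: emeasure_eq_measure measure_le_0_iff)
  hence 1: "N \<inter> {-R-1<..<R+1} \<in> null_sets \<mu>"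
    by (rule null_setsI) (use Nb s in auto)
  have "AE t in \<mu>. t \<notin> N \<inter> {-R-1<..<R+1}" using 1 by (rule AE_not_in)
  hence "AE t in \<mu>. t \<notin> N" using R by eventually_elim auto
  thus "N \<in> null_sets \<mu>" using Nb s by (simp add: AE_iff_null_sets)
qed

section \<open>Polynomials of one symmetric operator and their moments\<close>

locale symmetric_operator =
  fixes V :: "'v set" and T :: "('v \<Rightarrow> complex) \<Rightarrow> 'v \<Rightarrow> complex" and R :: real
  assumes T_add: "\<And>\<phi> \<psi>. T (\<lambda>y. \<phi> y + \<psi> y) = (\<lambda>x. T \<phi> x + T \<psi> x)"
    and T_cmult: "\<And>c \<phi>. T (\<lambda>y. c * \<phi> y) = (\<lambda>x. c * T \<phi> x)"
    and T_ell2: "\<And>\<phi>. \<phi> \<in> ell2 V \<Longrightarrow> T \<phi> \<in> ell2 V"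
    and T_sym: "\<And>\<phi> \<psi>. \<phi> \<in> ell2 V \<Longrightarrow> \<psi> \<in> ell2 V \<Longrightarrow> ell2_inner V \<phi> (T \<psi>) = ell2_inner V (T \<phi>) \<psi>"
    and T_bound: "\<And>\<phi>. \<phi> \<in> ell2 V \<Longrightarrow> norm_sq V (T \<phi>) \<le> R\<^sup>2 * norm_sq V \<phi>"
    and R_pos: "R > 0"
begin

lemma T_zero: "T (\<lambda>y. 0) = (\<lambda>x. 0)"
  using T_cmult[of 0 "\<lambda>y. 0"] by simp

definition poly_op :: "real poly \<Rightarrow> ('v \<Rightarrow> complex) \<Rightarrow> 'v \<Rightarrow> complex" where
  "poly_op p \<phi> = fold_coeffs (\<lambda>a F x. complex_of_real a * \<phi> x + T F x) p (\<lambda>x. 0)"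

lemma poly_op_0 [simp]: "poly_op 0 \<phi> = (\<lambda>x. 0)"
  by (simp add: poly_op_def)

lemma poly_op_pCons [simp]: "poly_op (pCons a p) \<phi> = (\<lambda>x. complex_of_real a * \<phi> x + T (poly_op p \<phi>) x)"
  by (cases "a = 0 \<and> p = 0") (auto simp: poly_op_def T_zero)

lemma poly_op_add: "poly_op (p + q) \<phi> = (\<lambda>x. poly_op p \<phi> x + poly_op q \<phi> x)"
  by (induction p q rule: poly_induct2) (auto simp: T_add algebra_simps)

lemma poly_op_smult: "poly_op (smult c p) \<phi> = (\<lambda>x. complex_of_real c * poly_op p \<phi> x)"
  by (induction p) (auto simp: T_cmult algebra_simps)

lemma poly_op_mult: "poly_op (p * q) \<phi> = poly_op p (poly_op q \<phi>)"
  by (induction p) (auto simp: poly_op_add poly_op_smult)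

lemma poly_op_monom: "poly_op (monom 1 n) \<phi> = (T ^^ n) \<phi>"
  by (induction n) (auto simp: monom_0 monom_Suc T_zero)

lemma poly_op_add_arg: "poly_op p (\<lambda>x. \<phi> x + \<psi> x) = (\<lambda>x. poly_op p \<phi> x + poly_op p \<psi> x)"
  by (induction p) (auto simp: T_add algebra_simps)

lemma poly_op_cmult_arg: "poly_op p (\<lambda>x. c * \<phi> x) = (\<lambda>x. c * poly_op p \<phi> x)"
  by (induction p) (auto simp: T_cmult algebra_simps)

lemma poly_op_T: "poly_op p (T \<phi>) = T (poly_op p \<phi>)"
  by (induction p) (auto simp: T_add T_cmult T_zero)

lemma poly_op_ell2: "\<phi> \<in> ell2 V \<Longrightarrow> poly_op p \<phi> \<in> ell2 V"
  by (induction p) (auto intro: ell2_zero ell2_add ell2_cmult T_ell2)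

lemma poly_op_sym: "\<phi> \<in> ell2 V \<Longrightarrow> \<psi> \<in> ell2 V \<Longrightarrow> ell2_inner V \<phi> (poly_op p \<psi>) = ell2_inner V (poly_op p \<phi>) \<psi>"
proof (induction p arbitrary: \<phi> \<psi>)
  case 0
  thus ?case by (simp add: ell2_inner_def)
next
  case (pCons a p)
  have "ell2_inner V \<phi> (T (poly_op p \<psi>)) = ell2_inner V (T (poly_op p \<phi>)) \<psi>"
    using pCons.IH[of \<phi> "T \<psi>"] pCons.prems by (simp add: poly_op_T T_sym T_ell2 poly_op_ell2)
  thus ?case using pCons.prems
    by (simp add: ell2_inner_add_right ell2_inner_add_left ell2_inner_cmult_right ell2_inner_cmult_left
        ell2_cmult T_ell2 poly_op_ell2)
qed

definition moment :: "('v \<Rightarrow> complex) \<Rightarrow> real poly \<Rightarrow> real" where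
  "moment \<phi> p = Re (ell2_inner V \<phi> (poly_op p \<phi>))"

lemma inner_poly_op_real:
  assumes "\<phi> \<in> ell2 V"
  shows "ell2_inner V \<phi> (poly_op p \<phi>) = complex_of_real (moment \<phi> p)"
proof -
  have "cnj (ell2_inner V \<phi> (poly_op p \<phi>)) = ell2_inner V \<phi> (poly_op p \<phi>)"
    by (simp add: ell2_inner_cnj poly_op_sym assms)
  thus ?thesis by (simp add: moment_def complex_eq_iff)
qed

lemma moment_add: "\<phi> \<in> ell2 V \<Longrightarrow> moment \<phi> (p + q) = moment \<phi> p + moment \<phi> q"
  by (simp add: moment_def poly_op_add ell2_inner_add_right poly_op_ell2)

lemma moment_smult: "moment \<phi> (smult c p) = c * moment \<phi> p"
  by (simp add: moment_def poly_op_smult ell2_inner_cmult_right)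

lemma moment_sq: "\<phi> \<in> ell2 V \<Longrightarrow> moment \<phi> (p * p) = norm_sq V (poly_op p \<phi>)"
  by (simp add: moment_def poly_op_mult poly_op_sym poly_op_ell2 ell2_inner_self)

lemma moment_1: "\<phi> \<in> ell2 V \<Longrightarrow> moment \<phi> 1 = norm_sq V \<phi>"
  by (simp add: moment_def one_pCons T_zero ell2_inner_self)

text \<open>On a square the functional is the squared norm of \<open>poly_op p \<phi>\<close>, and
  the norm bound of \<open>T\<close> controls multiplication by \<open>t\<close>. Division by
  \<open>norm_sq V \<phi>\<close> normalizes it for the moment theorem; the zero vector gets the
  zero measure.\<close>

lemma moment_measure_exists:
  assumes \<phi>: "\<phi> \<in> ell2 V"
  shows "\<exists>\<mu>. finite_measure \<mu> \<and> sets \<mu> = sets borel \<and> (AE t in \<mu>. \<bar>t\<bar> \<le> R) \<and> (\<forall>p. moment \<phi> p = (\<integral>t. poly p t \<partial>\<mu>))"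
proof (cases "norm_sq V \<phi> \<le> 0")
  case True
  hence "\<phi> = (\<lambda>x. 0)" using norm_sq_eq_0D[OF \<phi>] by auto
  hence "moment \<phi> p = 0" for p by (simp add: moment_def ell2_inner_def)
  moreover have "(\<integral>t. poly p t \<partial>density (return borel 0) (\<lambda>_. ennreal 0)) = 0" for p :: "real poly"
    by (subst integral_density) (auto intro!: borel_measurable_continuous_onI continuous_intros)
  ultimately show ?thesis
    by (intro exI[of _ "density (return borel 0) (\<lambda>_. 0)"] conjI allI finite_measureI)
       (auto simp: AE_density emeasure_density)
next
  case False
  define c where "c = norm_sq V \<phi>"
  have c: "c > 0" using False by (simp add: c_def)
  have "\<exists>\<mu>. real_distribution \<mu> \<and> (AE t in \<mu>. \<bar>t\<bar> \<le> R) \<and> (\<forall>p. moment \<phi> p / c = (\<integral>t. poly p t \<partial>\<mu>))"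
  proof (rule moment_problem_compact[OF _ _ _ _ R_pos])
    show "moment \<phi> (pCons 0 p * pCons 0 p) / c \<le> R\<^sup>2 * (moment \<phi> (p * p) / c)" for p
      using divide_right_mono[OF T_bound[OF poly_op_ell2[OF \<phi>, of p]], of c] c
      unfolding moment_sq[OF \<phi>] by simp
    show "moment \<phi> (p * p) / c \<ge> 0" for p using c moment_sq[OF \<phi>] by (simp add: wsq_nonneg)
  qed (use c \<phi> in \<open>auto simp: moment_add moment_smult add_divide_distrib moment_1 c_def\<close>)
  then obtain \<mu> where \<mu>: "real_distribution \<mu>" "AE t in \<mu>. \<bar>t\<bar> \<le> R" "\<And>p. moment \<phi> p / c = (\<integral>t. poly p t \<partial>\<mu>)" by blast
  interpret real_distribution \<mu> by fact
  have i: "integrable \<mu> (\<lambda>t. poly p t)" for p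
    by (rule integrable_poly_compact[OF finite_measure_axioms _ \<mu>(2)]) simp
  let ?\<nu> = "density \<mu> (\<lambda>_. ennreal c)"
  have "finite_measure ?\<nu>"
    by (rule finite_measureI) (simp add: emeasure_density emeasure_space_1[simplified] ennreal_mult_eq_top_iff)
  moreover have "AE t in ?\<nu>. \<bar>t\<bar> \<le> R" using \<mu>(2) by (subst AE_density) auto
  moreover have "moment \<phi> p = (\<integral>t. poly p t \<partial>?\<nu>)" for p
    using \<mu>(3)[of p] c borel_measurable_integrable[OF i[of p]] by (subst integral_density) (auto simp: field_simps)
  ultimately show ?thesis by (intro exI[of _ ?\<nu>]) auto
qed

lemma resolvent_bound:
  assumes "z \<notin> op_spectrum V T"
  shows "\<exists>K>0. \<forall>\<phi>\<in>ell2 V. norm_sq V \<phi> \<le> K * norm_sq V (\<lambda>x. T \<phi> x - z * \<phi> x)"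
proof -
  from assms obtain C where C: "\<And>\<phi>. \<phi> \<in> ell2 V \<Longrightarrow> ell2_norm V \<phi> \<le> C * ell2_norm V (\<lambda>x. T \<phi> x - z * \<phi> x)"
    unfolding op_spectrum_def resolvent_set_def by auto
  have "norm_sq V \<phi> \<le> (C\<^sup>2 + 1) * norm_sq V (\<lambda>x. T \<phi> x - z * \<phi> x)" if "\<phi> \<in> ell2 V" for \<phi>
  proof -
    have nn: "norm_sq V \<psi> \<ge> 0" for \<psi> by (simp add: wsq_nonneg)
    have "(ell2_norm V \<phi>)\<^sup>2 \<le> (C * ell2_norm V (\<lambda>x. T \<phi> x - z * \<phi> x))\<^sup>2"
      using C[OF that] nn by (intro power_mono) (auto simp: ell2_norm_eq)
    hence "norm_sq V \<phi> \<le> C\<^sup>2 * norm_sq V (\<lambda>x. T \<phi> x - z * \<phi> x)" using nn by (simp add: ell2_norm_eq power_mult_distrib)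
    thus ?thesis using nn[of "\<lambda>x. T \<phi> x - z * \<phi> x"] by (simp add: distrib_right)
  qed
  thus ?thesis by (intro exI[of _ "C\<^sup>2 + 1"]) (auto simp: add_nonneg_pos)
qed

lemma moment_shift_sq:
  assumes "\<phi> \<in> ell2 V"
  shows "moment \<phi> ([:-E, 1:] * p * ([:-E, 1:] * p)) = norm_sq V (\<lambda>x. T (poly_op p \<phi>) x - complex_of_real E * poly_op p \<phi> x)"
proof -
  have "poly_op ([:-E, 1:] * p) \<phi> = (\<lambda>x. T (poly_op p \<phi>) x - complex_of_real E * poly_op p \<phi> x)"
    unfolding poly_op_mult by (auto simp: T_zero)
  thus ?thesis by (simp only: moment_sq[OF assms])
qed

text \<open>The lower bound for \<open>T - E\<close> gives
  \<open>\<mu> I \<le> \<integral> K * (t - E)^2\<close> over closed \<open>I\<close>. For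
  \<open>I\<close> of half-length \<open>e\<close> with \<open>K * e^2 = 1 / 2\<close> the right
  side is at most \<open>\<mu> I / 2\<close>, which forces \<open>\<mu> I = 0\<close>.\<close>

lemma resolvent_null:
  assumes \<phi>: "\<phi> \<in> ell2 V" and E: "complex_of_real E \<notin> op_spectrum V T"
    and \<mu>: "finite_measure \<mu>" "sets \<mu> = sets borel" "AE t in \<mu>. \<bar>t\<bar> \<le> R"
      "\<And>p. moment \<phi> p = (\<integral>t. poly p t \<partial>\<mu>)"
  shows "\<exists>e>0. measure \<mu> {E - e..E + e} = 0"
proof -
  obtain K where K: "K > 0" "\<And>\<phi>. \<phi> \<in> ell2 V \<Longrightarrow> norm_sq V \<phi> \<le> K * norm_sq V (\<lambda>x. T \<phi> x - complex_of_real E * \<phi> x)"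
    using resolvent_bound[OF E] by blast
  interpret finite_measure \<mu> by (rule \<mu>)
  note [measurable_cong] = \<mu>(2)
  define e where "e = sqrt (1 / (2 * K))"
  have e: "e > 0" "K * e\<^sup>2 = 1 / 2" using K(1) by (auto simp: e_def)
  let ?I = "{E - e..E + e}" and ?h = "\<lambda>t. K * (t - E)\<^sup>2"
  have "measure \<mu> ?I \<le> (\<integral>t. indicator ?I t * ?h t \<partial>\<mu>) + (\<integral>t. indicator ?I t * 0 \<partial>\<mu>)"
  proof (rule closed_measure_le_of_poly[OF \<mu>(1-3) \<mu>(1-3) \<mu>(1-3), where ?h2.0 = "\<lambda>_. 0" and ?B2.0 = 0 and ?B1.0 = "K * (R + \<bar>E\<bar>)\<^sup>2"])
    show "\<bar>?h t\<bar> \<le> K * (R + \<bar>E\<bar>)\<^sup>2" if "\<bar>t\<bar> \<le> R" for t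
    proof -
      have "\<bar>t - E\<bar>\<^sup>2 \<le> (R + \<bar>E\<bar>)\<^sup>2" using that by (intro power_mono) auto
      thus ?thesis using K(1) by (simp add: abs_mult)
    qed
    fix p
    have "(\<integral>t. (poly p t)\<^sup>2 \<partial>\<mu>) = moment \<phi> (p * p)" by (simp add: \<mu>(4) power2_eq_square)
    also have "\<dots> \<le> K * moment \<phi> ([:-E, 1:] * p * ([:-E, 1:] * p))"
      unfolding moment_shift_sq[OF \<phi>] unfolding moment_sq[OF \<phi>] by (rule K(2)[OF poly_op_ell2[OF \<phi>]])
    also have "\<dots> = (\<integral>t. (poly p t)\<^sup>2 * (K * (t - E)\<^sup>2) \<partial>\<mu>)"
      unfolding \<mu>(4) integral_mult_right_zero[symmetric]
      by (intro Bochner_Integration.integral_cong refl) (simp add: power2_eq_square algebra_simps)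
    finally show "(\<integral>t. (poly p t)\<^sup>2 \<partial>\<mu>) \<le> (\<integral>t. (poly p t)\<^sup>2 * (K * (t - E)\<^sup>2) \<partial>\<mu>) + (\<integral>t. (poly p t)\<^sup>2 * 0 \<partial>\<mu>)" by simp
  qed auto
  also have "\<dots> \<le> (\<integral>t. indicator ?I t * (1 / 2) \<partial>\<mu>)"
  proof -
    have "(\<integral>t. indicator ?I t * ?h t \<partial>\<mu>) \<le> (\<integral>t. indicator ?I t * (1 / 2) \<partial>\<mu>)"
    proof (rule integral_mono)
      have le: "indicator ?I t * ?h t \<le> indicator ?I t * (1 / 2)" for t
      proof (cases "t \<in> ?I")
        case True
        hence "\<bar>t - E\<bar>\<^sup>2 \<le> e\<^sup>2" by (intro power_mono) auto
        hence "K * (t - E)\<^sup>2 \<le> K * e\<^sup>2" using K(1) by (intro mult_left_mono) auto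
        thus ?thesis using True e by simp
      qed simp
      show "indicator ?I t * ?h t \<le> indicator ?I t * (1 / 2)" if "t \<in> space \<mu>" for t by (rule le)
      show "integrable \<mu> (\<lambda>t. indicator ?I t * ?h t)"
      proof (rule integrable_const_bound[of _ 1])
        have "\<bar>indicator ?I t * ?h t\<bar> \<le> 1" for t
        proof -
          have "0 \<le> indicator ?I t * ?h t" using K(1) by simp
          moreover have "indicator ?I t * (1 / 2) \<le> (1::real)" by (simp split: split_indicator)
          ultimately show ?thesis using le[of t] by linarith
        qed
        thus "AE t in \<mu>. norm (indicator ?I t * ?h t) \<le> 1" by simp
      qed auto
      show "integrable \<mu> (\<lambda>t. indicator ?I t * (1 / 2 :: real))"
        by (rule integrable_const_bound[of _ 1]) (auto split: split_indicator)
    qed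
    thus ?thesis by simp
  qed
  also have "\<dots> = measure \<mu> ?I / 2"
    using sets_eq_imp_space_eq[OF \<mu>(2)] by simp
  finally have "measure \<mu> ?I \<le> 0" by simp
  thus ?thesis using e(1) by (intro exI[of _ e]) (simp add: measure_le_0_iff)
qed

lemma inner_T_real: "\<phi> \<in> ell2 V \<Longrightarrow> Im (ell2_inner V \<phi> (T \<phi>)) = 0"
  using inner_poly_op_real[of \<phi> "[:0, 1:]"] by (simp add: T_zero)

text \<open>Pythagoras: \<open>T - E\<close> is symmetric and the added term is an imaginary
  multiple of \<open>\<phi>\<close>, so the cross terms cancel.\<close>

lemma norm_sq_shift:
  assumes \<phi>: "\<phi> \<in> ell2 V"
  shows "norm_sq V (\<lambda>x. T \<phi> x - Complex E \<eta> * \<phi> x) = norm_sq V (\<lambda>x. T \<phi> x - complex_of_real E * \<phi> x) + \<eta>\<^sup>2 * norm_sq V \<phi>"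
proof -
  define a where "a = (\<lambda>x. T \<phi> x + complex_of_real (- E) * \<phi> x)"
  have a: "a \<in> ell2 V" unfolding a_def by (intro ell2_add T_ell2 \<phi> ell2_cmult)
  let ?c = "- (\<i> * complex_of_real \<eta>)"
  have r: "ell2_inner V a \<phi> = ell2_inner V \<phi> a"
    unfolding a_def using \<phi>
    by (simp add: ell2_inner_add_left ell2_inner_add_right ell2_inner_cmult_left ell2_inner_cmult_right T_ell2 ell2_cmult T_sym
        del: of_real_minus)
  have "(\<lambda>x. a x + ?c * \<phi> x) = (\<lambda>x. T \<phi> x - Complex E \<eta> * \<phi> x)"
    by (auto simp: a_def Complex_eq algebra_simps)
  hence "complex_of_real (norm_sq V (\<lambda>x. T \<phi> x - Complex E \<eta> * \<phi> x)) = ell2_inner V (\<lambda>x. a x + ?c * \<phi> x) (\<lambda>x. a x + ?c * \<phi> x)"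
    using ell2_inner_self[OF ell2_add[OF a ell2_cmult[OF \<phi>, of ?c]]] by simp
  also have "\<dots> = ell2_inner V a a + ?c * ell2_inner V a \<phi> + (cnj ?c * ell2_inner V \<phi> a + cnj ?c * ?c * ell2_inner V \<phi> \<phi>)"
    by (simp only: ell2_inner_add_left[OF ell2_add[OF a ell2_cmult[OF \<phi>]] a ell2_cmult[OF \<phi>]]
        ell2_inner_add_right[OF a a ell2_cmult[OF \<phi>]] ell2_inner_add_right[OF \<phi> a ell2_cmult[OF \<phi>]]
        ell2_inner_cmult_left ell2_inner_cmult_right distrib_left mult.assoc)
  also have "\<dots> = complex_of_real (norm_sq V a + \<eta>\<^sup>2 * norm_sq V \<phi>)"
    unfolding r by (simp add: ell2_inner_self a \<phi> power2_eq_square complex_eq_iff)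
  finally have "norm_sq V (\<lambda>x. T \<phi> x - Complex E \<eta> * \<phi> x) = norm_sq V a + \<eta>\<^sup>2 * norm_sq V \<phi>" by (simp only: of_real_eq_iff)
  thus ?thesis by (simp add: a_def)
qed

text \<open>The inner product of \<open>\<psi>\<close> with \<open>T \<psi>\<close> is real, so only
  the imaginary part of the spectral parameter survives.\<close>

lemma Im_inner_resolvent:
  assumes "\<psi> \<in> ell2 V" and "\<phi> = (\<lambda>x. T \<psi> x - Complex E \<eta> * \<psi> x)"
  shows "\<eta> * norm_sq V \<psi> = Im (ell2_inner V \<phi> \<psi>)"
proof -
  have "\<phi> = (\<lambda>x. T \<psi> x + (- Complex E \<eta>) * \<psi> x)" by (simp add: assms(2))
  hence "ell2_inner V \<psi> \<phi> = ell2_inner V \<psi> (T \<psi>) + (- Complex E \<eta>) * ell2_inner V \<psi> \<psi>"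
    by (simp only: ell2_inner_add_right[OF assms(1) T_ell2[OF assms(1)] ell2_cmult[OF assms(1)]] ell2_inner_cmult_right)
  hence "Im (ell2_inner V \<psi> \<phi>) = - \<eta> * norm_sq V \<psi>"
    using inner_T_real[OF assms(1)] by (simp add: ell2_inner_self[OF assms(1)])
  moreover have "ell2_inner V \<phi> \<psi> = cnj (ell2_inner V \<psi> \<phi>)" by (simp add: ell2_inner_cnj)
  ultimately show ?thesis by simp
qed

end

section \<open>Existence and uniqueness of spectral measures, and estimates for them\<close>

text \<open>The bound on the real spectrum confines every measure carried by the spectrum to a
  compact interval, where moments determine it.\<close>

locale bounded_symmetric = symmetric_operator +
  assumes spectrum_bound: "\<And>E. complex_of_real E \<in> op_spectrum V T \<Longrightarrow> \<bar>E\<bar> \<le> R"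
begin

text \<open>Being carried by the spectrum is exchanged for being carried by a fixed interval, which
  is what the moment theorems provide. For the return direction every real resolvent point has a
  null neighbourhood, and by Lindelof countably many of them cover all such points.\<close>

lemma is_spectral_measure_iff:
  assumes \<phi>: "\<phi> \<in> ell2 V"
  shows "is_spectral_measure V T \<phi> \<mu> \<longleftrightarrow>
    finite_measure \<mu> \<and> sets \<mu> = sets borel \<and> (AE t in \<mu>. \<bar>t\<bar> \<le> R) \<and> (\<forall>p. moment \<phi> p = (\<integral>t. poly p t \<partial>\<mu>))"
proof
  assume sm: "is_spectral_measure V T \<phi> \<mu>"
  hence fs: "finite_measure \<mu>" "sets \<mu> = sets borel" by (auto simp: is_spectral_measure_def)
  have AE: "AE t in \<mu>. \<bar>t\<bar> \<le> R"
    using sm unfolding is_spectral_measure_def by (auto elim!: eventually_mono intro: spectrum_bound)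
  have i: "integrable \<mu> (\<lambda>t. poly p t)" for p by (rule integrable_poly_compact[OF fs AE])
  have "moment \<phi> p = (\<integral>t. poly p t \<partial>\<mu>)" for p
  proof (rule poly_functional_eqI[of "moment \<phi>" "\<lambda>p. \<integral>t. poly p t \<partial>\<mu>"])
    show "moment \<phi> (monom 1 n) = (\<integral>t. poly (monom 1 n) t \<partial>\<mu>)" for n
      using sm unfolding is_spectral_measure_def moment_def poly_op_monom by (simp add: poly_monom)
  qed (use i in \<open>auto simp: moment_add moment_smult \<phi>\<close>)
  thus "finite_measure \<mu> \<and> sets \<mu> = sets borel \<and> (AE t in \<mu>. \<bar>t\<bar> \<le> R) \<and> (\<forall>p. moment \<phi> p = (\<integral>t. poly p t \<partial>\<mu>))"
    using fs AE by blast
next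
  assume "finite_measure \<mu> \<and> sets \<mu> = sets borel \<and> (AE t in \<mu>. \<bar>t\<bar> \<le> R) \<and> (\<forall>p. moment \<phi> p = (\<integral>t. poly p t \<partial>\<mu>))"
  hence \<mu>: "finite_measure \<mu>" "sets \<mu> = sets borel" "AE t in \<mu>. \<bar>t\<bar> \<le> R" "\<And>p. moment \<phi> p = (\<integral>t. poly p t \<partial>\<mu>)" by auto
  interpret finite_measure \<mu> by (rule \<mu>)
  let ?\<rho> = "{E. complex_of_real E \<notin> op_spectrum V T}"
  obtain e where e: "\<And>E. E \<in> ?\<rho> \<Longrightarrow> e E > 0 \<and> measure \<mu> {E - e E..E + e E} = 0"
    using resolvent_null[OF \<phi> _ \<mu>] by (metis mem_Collect_eq)
  have op: "open S" if "S \<in> (\<lambda>E. {E - e E<..<E + e E}) ` ?\<rho>" for S using that by auto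
  obtain F where F: "F \<subseteq> (\<lambda>E. {E - e E<..<E + e E}) ` ?\<rho>" "countable F" "\<Union>F = \<Union>((\<lambda>E. {E - e E<..<E + e E}) ` ?\<rho>)"
    using Lindelof[OF op] by blast
  have "A \<in> null_sets \<mu>" if "A \<in> F" for A
  proof -
    have "A \<in> (\<lambda>E. {E - e E<..<E + e E}) ` ?\<rho>" using F(1) that by blast
    then obtain E where E: "E \<in> ?\<rho>" "A = {E - e E<..<E + e E}" by blast
    have "{E - e E..E + e E} \<in> null_sets \<mu>"
      using e[OF E(1)] \<mu>(2) by (intro null_setsI) (auto simp: emeasure_eq_measure)
    thus ?thesis unfolding E(2) by (rule null_sets_subset) (auto simp: \<mu>(2))
  qed
  hence "\<Union>F \<in> null_sets \<mu>" using F(2) null_sets_UN'[of F "\<lambda>A. A"] by simp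
  hence "AE t in \<mu>. t \<notin> \<Union>F" by (rule AE_not_in)
  moreover have "E \<in> \<Union>F" if "E \<in> ?\<rho>" for E
    unfolding F(3) using e[OF that] that by (auto intro!: bexI[of _ E])
  ultimately have "AE t in \<mu>. complex_of_real t \<in> op_spectrum V T" by (auto elim!: eventually_mono)
  moreover have "integrable \<mu> (\<lambda>t. t ^ n)" for n
    using integrable_poly_compact[OF \<mu>(1-3), of "monom 1 n"] by (simp add: poly_monom)
  moreover have "ell2_inner V \<phi> ((T ^^ n) \<phi>) = complex_of_real (\<integral>t. t ^ n \<partial>\<mu>)" for n
    using inner_poly_op_real[OF \<phi>, of "monom 1 n"] \<mu>(4)[of "monom 1 n"] by (simp add: poly_op_monom poly_monom)
  ultimately show "is_spectral_measure V T \<phi> \<mu>" using \<mu> by (simp add: is_spectral_measure_def)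
qed

lemma spectral_measure:
  assumes \<phi>: "\<phi> \<in> ell2 V"
  shows "is_spectral_measure V T \<phi> (spectral_measure V T \<phi>)"
proof -
  obtain \<mu> where "is_spectral_measure V T \<phi> \<mu>"
    using moment_measure_exists[OF \<phi>] is_spectral_measure_iff[OF \<phi>] by blast
  moreover have "\<nu> = \<mu>" if "is_spectral_measure V T \<phi> \<nu>" for \<nu>
    using that calculation unfolding is_spectral_measure_iff[OF \<phi>]
    by (intro measure_eqI_moments_compact[of _ R]) auto
  ultimately show ?thesis unfolding spectral_measure_def by (rule theI)
qed

lemma spectral_measure_props:
  assumes "\<phi> \<in> ell2 V"
  shows "finite_measure (spectral_measure V T \<phi>)" "sets (spectral_measure V T \<phi>) = sets borel"
    "AE t in spectral_measure V T \<phi>. \<bar>t\<bar> \<le> R"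
    "moment \<phi> p = (\<integral>t. poly p t \<partial>spectral_measure V T \<phi>)"
  using spectral_measure[OF assms] unfolding is_spectral_measure_iff[OF assms] by auto

lemma spectral_measure_add_closed:
  assumes "\<phi> \<in> ell2 V" "\<psi> \<in> ell2 V" "closed K"
  shows "measure (spectral_measure V T (\<lambda>x. \<phi> x + \<psi> x)) K
    \<le> 2 * measure (spectral_measure V T \<phi>) K + 2 * norm_sq V \<psi>"
proof -
  let ?\<mu> = "spectral_measure V T"
  note s = ell2_add[OF assms(1,2)]
  note p1 = spectral_measure_props[OF s] and p2 = spectral_measure_props[OF assms(1)] and p3 = spectral_measure_props[OF assms(2)]
  have "measure (?\<mu> (\<lambda>x. \<phi> x + \<psi> x)) K \<le> (\<integral>t. indicator K t * 2 \<partial>?\<mu> \<phi>) + (\<integral>t. indicator K t * 2 \<partial>?\<mu> \<psi>)"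
  proof (rule closed_measure_le_of_poly[OF p1(1-3) p2(1-3) p3(1-3) _ _ _ _ _ assms(3), where ?B1.0 = 2 and ?B2.0 = 2])
    fix p
    have e: "(\<integral>t. (poly p t)\<^sup>2 \<partial>?\<mu> \<xi>) = norm_sq V (poly_op p \<xi>)" if "\<xi> \<in> ell2 V" for \<xi>
      using spectral_measure_props(4)[OF that, of "p * p"] moment_sq[OF that, of p] by (simp add: power2_eq_square)
    show "(\<integral>t. (poly p t)\<^sup>2 \<partial>?\<mu> (\<lambda>x. \<phi> x + \<psi> x)) \<le> (\<integral>t. (poly p t)\<^sup>2 * 2 \<partial>?\<mu> \<phi>) + (\<integral>t. (poly p t)\<^sup>2 * 2 \<partial>?\<mu> \<psi>)"
      using norm_sq_add_le[OF poly_op_ell2[OF assms(1), of p] poly_op_ell2[OF assms(2), of p]]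
      by (simp add: e assms s poly_op_add_arg)
  qed auto
  also have "(\<integral>t. indicator K t * 2 \<partial>?\<mu> \<phi>) = 2 * measure (?\<mu> \<phi>) K"
    using sets_eq_imp_space_eq[OF p2(2)] by simp
  also have "(\<integral>t. indicator K t * 2 \<partial>?\<mu> \<psi>) = 2 * measure (?\<mu> \<psi>) K"
    using sets_eq_imp_space_eq[OF p3(2)] by simp
  also have "measure (?\<mu> \<psi>) K \<le> norm_sq V \<psi>"
  proof -
    interpret finite_measure "?\<mu> \<psi>" by (rule p3)
    have "measure (?\<mu> \<psi>) (space (?\<mu> \<psi>)) = norm_sq V \<psi>"
      using p3(4)[of 1] moment_1[OF assms(2)] by simp
    thus ?thesis using bounded_measure[of K] by simp
  qed
  finally show ?thesis by simp
qed

text \<open>The comparison of \<open>\<phi>\<close> with \<open>\<psi>\<close> is available on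
  closed sets only, so inner regularity reduces a null set to its compact subsets, whose measure is
  at most twice the squared error.\<close>

lemma absolutely_continuous_closure:
  assumes \<phi>: "\<phi> \<in> ell2 V"
    and approx: "\<And>e. e > 0 \<Longrightarrow> \<exists>\<psi>\<in>ell2 V. norm_sq V (\<lambda>x. \<phi> x - \<psi> x) \<le> e \<and> absolutely_continuous lborel (spectral_measure V T \<psi>)"
  shows "absolutely_continuous lborel (spectral_measure V T \<phi>)"
  unfolding absolutely_continuous_def
proof
  let ?\<mu> = "spectral_measure V T \<phi>"
  note p = spectral_measure_props[OF \<phi>]
  interpret finite_measure ?\<mu> by (rule p)
  fix N :: "real set" assume N: "N \<in> null_sets lborel"
  hence Nb: "N \<in> sets borel" by auto
  have "measure ?\<mu> K = 0" if K: "K \<subseteq> N" "compact K" for K :: "real set"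
  proof -
    have "measure ?\<mu> K \<le> 0"
    proof (rule field_le_epsilon)
      fix e :: real assume "e > 0"
      then obtain \<psi> where \<psi>: "\<psi> \<in> ell2 V" "norm_sq V (\<lambda>x. \<phi> x - \<psi> x) \<le> e / 2"
        "absolutely_continuous lborel (spectral_measure V T \<psi>)" using approx[of "e / 2"] by auto
      have "K \<in> null_sets lborel"
        using N K by (intro null_sets_subset[OF N]) (auto intro: borel_compact)
      hence "measure (spectral_measure V T \<psi>) K = 0"
        using \<psi>(3) unfolding absolutely_continuous_def by (auto simp: measure_eq_0_null_sets)
      thus "measure ?\<mu> K \<le> 0 + e"
        using spectral_measure_add_closed[OF \<psi>(1) ell2_diff[OF \<phi> \<psi>(1)] compact_imp_closed[OF K(2)]] \<psi>(2) by simp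
    qed
    thus ?thesis by (simp add: measure_le_0_iff)
  qed
  hence K0: "emeasure ?\<mu> K \<le> 0" if "K \<in> {K. K \<subseteq> N \<and> compact K}" for K
    using that by (simp add: emeasure_eq_measure)
  have "emeasure ?\<mu> N = (SUP K\<in>{K. K \<subseteq> N \<and> compact K}. emeasure ?\<mu> K)"
    using inner_regular[OF p(2) _ Nb] by simp
  also have "\<dots> \<le> 0" by (rule SUP_least) (rule K0)
  finally have "emeasure ?\<mu> N = 0" by simp
  thus "N \<in> null_sets ?\<mu>" by (rule null_setsI) (simp add: Nb p(2))
qed

text \<open>A one-sided Stone formula with real integrals. The measure of
  \<open>\<phi> = (T - z) \<psi>\<close> has density \<open>(t - E)^2 + \<eta>^2\<close> with
  respect to that of \<open>\<psi>\<close>; this is at most \<open>2 * \<eta>^2\<close> on the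
  interval, and \<open>\<eta> * norm_sq V \<psi>\<close> is the imaginary part of the resolvent
  matrix element.\<close>

lemma spectral_measure_interval_bound:
  assumes \<psi>: "\<psi> \<in> ell2 V" and \<phi>: "\<phi> = (\<lambda>x. T \<psi> x - Complex E \<eta> * \<psi> x)" and \<eta>: "\<eta> > 0"
  shows "measure (spectral_measure V T \<phi>) {E - \<eta>..E + \<eta>} \<le> 2 * \<eta> * Im (ell2_inner V \<phi> \<psi>)"
proof -
  have \<phi>e: "\<phi> \<in> ell2 V" unfolding \<phi> by (intro ell2_diff T_ell2 \<psi> ell2_cmult)
  let ?\<mu> = "spectral_measure V T" and ?I = "{E - \<eta>..E + \<eta>}"
  let ?h = "\<lambda>t. (t - E)\<^sup>2 + \<eta>\<^sup>2"
  note p1 = spectral_measure_props[OF \<phi>e] and p2 = spectral_measure_props[OF \<psi>]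
  interpret finite_measure "?\<mu> \<psi>" by (rule p2)
  note [measurable_cong] = p2(2)
  have "measure (?\<mu> \<phi>) ?I \<le> (\<integral>t. indicator ?I t * ?h t \<partial>?\<mu> \<psi>) + (\<integral>t. indicator ?I t * 0 \<partial>?\<mu> \<psi>)"
  proof (rule closed_measure_le_of_poly[OF p1(1-3) p2(1-3) p2(1-3), where ?h2.0 = "\<lambda>_. 0" and ?B2.0 = 0 and ?B1.0 = "(R + \<bar>E\<bar>)\<^sup>2 + \<eta>\<^sup>2"])
    show "\<bar>?h t\<bar> \<le> (R + \<bar>E\<bar>)\<^sup>2 + \<eta>\<^sup>2" if "\<bar>t\<bar> \<le> R" for t
    proof -
      have "\<bar>t - E\<bar>\<^sup>2 \<le> (R + \<bar>E\<bar>)\<^sup>2" using that by (intro power_mono) auto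
      thus ?thesis by simp
    qed
    fix p
    have "poly_op p \<phi> = (\<lambda>x. T (poly_op p \<psi>) x - Complex E \<eta> * poly_op p \<psi> x)"
      using poly_op_add_arg[of p "T \<psi>" "\<lambda>x. (- Complex E \<eta>) * \<psi> x"] poly_op_cmult_arg[of p "- Complex E \<eta>" \<psi>]
      by (simp add: \<phi> poly_op_T)
    hence "moment \<phi> (p * p) = moment \<psi> ([:-E, 1:] * p * ([:-E, 1:] * p)) + \<eta>\<^sup>2 * moment \<psi> (p * p)"
      unfolding moment_shift_sq[OF \<psi>] moment_sq[OF \<phi>e, of p] moment_sq[OF \<psi>, of p]
      by (simp only: norm_sq_shift[OF poly_op_ell2[OF \<psi>]])
    also have "\<dots> = moment \<psi> ([:-E, 1:] * p * ([:-E, 1:] * p) + smult (\<eta>\<^sup>2) (p * p))"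
      by (simp only: moment_add[OF \<psi>] moment_smult)
    also have "\<dots> = (\<integral>t. (poly p t)\<^sup>2 * ?h t \<partial>?\<mu> \<psi>)"
      unfolding p2(4) by (intro Bochner_Integration.integral_cong refl) (simp add: power2_eq_square algebra_simps)
    finally show "(\<integral>t. (poly p t)\<^sup>2 \<partial>?\<mu> \<phi>) \<le> (\<integral>t. (poly p t)\<^sup>2 * ?h t \<partial>?\<mu> \<psi>) + (\<integral>t. (poly p t)\<^sup>2 * 0 \<partial>?\<mu> \<psi>)"
      by (simp add: p1(4) power2_eq_square)
  qed auto
  also have "\<dots> \<le> (\<integral>t. 2 * \<eta>\<^sup>2 \<partial>?\<mu> \<psi>)"
  proof -
    have le: "indicator ?I t * ?h t \<le> 2 * \<eta>\<^sup>2" for t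
    proof (cases "t \<in> ?I")
      case True
      hence "\<bar>t - E\<bar>\<^sup>2 \<le> \<eta>\<^sup>2" by (intro power_mono) auto
      thus ?thesis using True by simp
    qed simp
    have "(\<integral>t. indicator ?I t * ?h t \<partial>?\<mu> \<psi>) \<le> (\<integral>t. 2 * \<eta>\<^sup>2 \<partial>?\<mu> \<psi>)"
    proof (rule integral_mono)
      show "integrable (?\<mu> \<psi>) (\<lambda>t. indicator ?I t * ?h t)"
      proof (rule integrable_const_bound[of _ "2 * \<eta>\<^sup>2"])
        show "AE t in ?\<mu> \<psi>. norm (indicator ?I t * ?h t) \<le> 2 * \<eta>\<^sup>2"
          using le by (intro AE_I2) (simp add: abs_mult)
      qed auto
    qed (use le in auto)
    thus ?thesis by simp
  qed
  also have "\<dots> = 2 * \<eta> * (\<eta> * norm_sq V \<psi>)"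
    using p2(4)[of 1] moment_1[OF \<psi>] by (simp add: power2_eq_square)
  also have "\<eta> * norm_sq V \<psi> = Im (ell2_inner V \<phi> \<psi>)" by (rule Im_inner_resolvent[OF \<psi> \<phi>])
  finally show ?thesis .
qed

text \<open>The counterpart of \<open>resolvent_null\<close>: absence of mass near \<open>E\<close>
  gives back a lower bound for \<open>T - E\<close>.\<close>

lemma spectral_gap_bound:
  assumes \<phi>: "\<phi> \<in> ell2 V" and e: "e > 0" and gap: "AE t in spectral_measure V T \<phi>. e \<le> \<bar>t - E\<bar>"
  shows "e\<^sup>2 * norm_sq V \<phi> \<le> norm_sq V (\<lambda>x. T \<phi> x - complex_of_real E * \<phi> x)"
proof -
  let ?\<mu> = "spectral_measure V T \<phi>"
  note p = spectral_measure_props[OF \<phi>]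
  interpret finite_measure ?\<mu> by (rule p)
  have i: "integrable ?\<mu> (\<lambda>t. poly q t)" for q by (rule integrable_poly_compact[OF p(1-3)])
  have pw: "poly ([:-E, 1:] * 1 * ([:-E, 1:] * 1)) t = (t - E)\<^sup>2" for t :: real
    by (simp add: power2_eq_square algebra_simps)
  have "e\<^sup>2 * norm_sq V \<phi> = (\<integral>t. e\<^sup>2 \<partial>?\<mu>)" using p(4)[of 1] moment_1[OF \<phi>] by simp
  also have "\<dots> \<le> (\<integral>t. (t - E)\<^sup>2 \<partial>?\<mu>)"
  proof (rule integral_mono_AE)
    show "integrable ?\<mu> (\<lambda>t. (t - E)\<^sup>2)" using i[of "[:-E, 1:] * 1 * ([:-E, 1:] * 1)"] unfolding pw .
    show "AE t in ?\<mu>. e\<^sup>2 \<le> (t - E)\<^sup>2"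
      using gap
    proof eventually_elim
      case (elim t)
      have "e\<^sup>2 \<le> \<bar>t - E\<bar>\<^sup>2" using elim e by (intro power_mono) auto
      thus ?case by simp
    qed
  qed simp
  also have "\<dots> = moment \<phi> ([:-E, 1:] * 1 * ([:-E, 1:] * 1))" unfolding p(4) pw ..
  also have "\<dots> = norm_sq V (\<lambda>x. T \<phi> x - complex_of_real E * \<phi> x)"
    unfolding moment_shift_sq[OF \<phi>] by (simp add: one_pCons T_zero)
  finally show ?thesis .
qed

end

section \<open>The adjacency operator\<close>

locale cone_tree =
  fixes M :: "nat ^ 'a ^ ('a::finite)" and j :: 'a
begin

abbreviation "V \<equiv> tree_vertices M j"
abbreviation "lab \<equiv> vertex_label j"

definition steps :: "'a vertex \<Rightarrow> ('a \<times> nat) set" where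
  "steps x = (SIGMA i:UNIV. {..<M $ i $ lab x})"

text \<open>\<open>down g\<close> and \<open>up g\<close> both put on an edge the value of
  \<open>g\<close> at its outer end, so they are transposes of each other; for \<open>g = 1\<close>
  their sum is the adjacency operator.\<close>

definition down :: "('a \<Rightarrow> complex) \<Rightarrow> ('a vertex \<Rightarrow> complex) \<Rightarrow> 'a vertex \<Rightarrow> complex" where
  "down g \<phi> x = (if x \<in> V then \<Sum>c\<in>steps x. g (fst c) * \<phi> (c # x) else 0)"

definition up :: "('a \<Rightarrow> complex) \<Rightarrow> ('a vertex \<Rightarrow> complex) \<Rightarrow> 'a vertex \<Rightarrow> complex" where
  "up g \<phi> y = (case y of [] \<Rightarrow> 0 | c # x \<Rightarrow> if y \<in> V then g (fst c) * \<phi> x else 0)"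

lemma finite_steps [simp]: "finite (steps x)"
  by (simp add: steps_def)

lemma Nil_in_V [simp]: "[] \<in> V"
  by (rule tree_vertices.root)

lemma lab_Cons [simp]: "lab (c # x) = fst c"
  by (cases c) simp

lemma Cons_in_V_iff: "c # x \<in> V \<longleftrightarrow> x \<in> V \<and> c \<in> steps x"
  by (cases c) (auto simp: steps_def intro: tree_vertices.step elim: tree_vertices.cases)

lemma sum_steps: "(\<Sum>c\<in>steps x. h (fst c)) = (\<Sum>i\<in>UNIV. of_nat (M $ i $ lab x) * h i)"
  for h :: "'a \<Rightarrow> 'b::comm_semiring_1"
proof -
  have "(\<Sum>c\<in>steps x. h (fst c)) = (\<Sum>i\<in>UNIV. \<Sum>m<M $ i $ lab x. h i)"
    unfolding steps_def by (subst sum.Sigma) (auto intro!: sum.cong)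
  thus ?thesis by simp
qed

lemma up_Nil [simp]: "up g \<phi> [] = 0"
  by (simp add: up_def)

lemma up_Cons: "c # x \<in> V \<Longrightarrow> up g \<phi> (c # x) = g (fst c) * \<phi> x"
  by (simp add: up_def)

lemma up_outside: "x \<notin> V \<Longrightarrow> up g \<phi> x = 0"
  by (cases x) (auto simp: up_def)

lemma down_outside: "x \<notin> V \<Longrightarrow> down g \<phi> x = 0"
  by (simp add: down_def)

lemma tree_adj_op_eq: "tree_adj_op M j \<phi> x = down (\<lambda>_. 1) \<phi> x + up (\<lambda>_. 1) \<phi> x"
proof (cases "x \<in> V")
  case True
  have kids: "(\<Sum>y\<in>(\<lambda>c. c # x) ` steps x. \<phi> y) = (\<Sum>c\<in>steps x. \<phi> (c # x))"
    by (subst sum.reindex) (auto simp: inj_on_def)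
  show ?thesis
  proof (cases x)
    case Nil
    have "{y. tree_adj M j x y} = (\<lambda>c. c # x) ` steps x"
      using True Nil by (auto simp: tree_adj_def Cons_in_V_iff)
    thus ?thesis using kids True Nil by (simp add: tree_adj_op_def down_def)
  next
    case (Cons d y)
    have yV: "y \<in> V" using True Cons Cons_in_V_iff by blast
    have "{y. tree_adj M j x y} = insert y ((\<lambda>c. c # x) ` steps x)"
      using True Cons yV by (auto simp: tree_adj_def Cons_in_V_iff)
    moreover have "y \<notin> (\<lambda>c. c # x) ` steps x" using Cons by auto
    ultimately show ?thesis using kids True Cons
      by (simp add: tree_adj_op_def down_def up_def)
  qed
next
  case False
  thus ?thesis by (simp add: tree_adj_op_def tree_adj_def down_outside up_outside)
qed

text \<open>Fibering the vertices other than the root over their parents turns a sum over the tree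
  into a sum over families of children.\<close>

lemma bij_steps: "bij_betw (\<lambda>(x, c). c # x) (Sigma V steps) (V - {[]})"
proof (rule bij_betwI')
  fix y assume "y \<in> V - {[]}"
  thus "\<exists>xc\<in>Sigma V steps. y = (case xc of (x, c) \<Rightarrow> c # x)"
    by (cases y) (auto simp: Cons_in_V_iff)
qed (auto simp: Cons_in_V_iff)

lemma infsum_tree:
  fixes f :: "'a vertex \<Rightarrow> 'b::banach"
  assumes "f summable_on (V - {[]})"
  shows "(\<lambda>x. \<Sum>c\<in>steps x. f (c # x)) summable_on V"
    and "(\<Sum>\<^sub>\<infinity>x\<in>V. \<Sum>c\<in>steps x. f (c # x)) = (\<Sum>\<^sub>\<infinity>y\<in>V - {[]}. f y)"
proof -
  have s: "(\<lambda>(x, c). f (c # x)) summable_on Sigma V steps"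
    using assms summable_on_reindex_bij_betw[OF bij_steps, of f] by (simp add: case_prod_unfold)
  show "(\<lambda>x. \<Sum>c\<in>steps x. f (c # x)) summable_on V"
    using summable_on_Sigma_banach[OF s] by simp
  show "(\<Sum>\<^sub>\<infinity>x\<in>V. \<Sum>c\<in>steps x. f (c # x)) = (\<Sum>\<^sub>\<infinity>y\<in>V - {[]}. f y)"
    using infsum_Sigma'_banach[OF s] infsum_reindex_bij_betw[OF bij_steps, of f] by (simp add: case_prod_unfold)
qed

lemma summable_tree:
  fixes f :: "'a vertex \<Rightarrow> real"
  assumes "\<And>x. f x \<ge> 0" "(\<lambda>x. \<Sum>c\<in>steps x. f (c # x)) summable_on V"
  shows "f summable_on (V - {[]})"
proof -
  have "(\<lambda>(x, c). f (c # x)) summable_on Sigma V steps"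
    by (rule summable_on_SigmaI[where g = "\<lambda>x. \<Sum>c\<in>steps x. f (c # x)"]) (use assms in auto)
  thus ?thesis using summable_on_reindex_bij_betw[OF bij_steps, of f] by (simp add: case_prod_unfold)
qed

lemma summable_tree_insert:
  fixes f :: "'a vertex \<Rightarrow> real"
  shows "f summable_on (V - {[]}) \<Longrightarrow> f summable_on V"
  using summable_on_insert_iff[of f "[]" "V - {[]}"] by (simp add: insert_absorb)

lemma label_bounds:
  fixes W :: "'a \<Rightarrow> real"
  assumes "\<And>k. W k > 0"
  shows "\<exists>lo hi. 0 < lo \<and> (\<forall>k. lo \<le> W k \<and> W k \<le> hi)"
proof -
  have "Min (range W) \<in> range W" by (intro Min_in) auto
  hence "0 < Min (range W)" using assms by auto
  thus ?thesis by (intro exI[of _ "Min (range W)"] exI[of _ "Max (range W)"]) simp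
qed

text \<open>The children of \<open>x\<close> together contribute
  \<open>(cmod (\<phi> x))\<^sup>2\<close> times a sum over column \<open>lab x\<close>, so an
  inequality between labels suffices vertex by vertex.\<close>

lemma up_bound:
  assumes \<phi>: "\<phi> \<in> ell2 V" and W: "\<And>k. W k > 0" and q: "q \<ge> 0"
    and le: "\<And>k. (\<Sum>i\<in>UNIV. real (M $ i $ k) * (W i * (cmod (g i))\<^sup>2)) \<le> q * W k"
  shows "up g \<phi> \<in> ell2 V" "wsq (\<lambda>x. W (lab x)) V (up g \<phi>) \<le> q * wsq (\<lambda>x. W (lab x)) V \<phi>"
proof -
  obtain lo hi where lo: "0 < lo" and b: "\<And>k. lo \<le> W k \<and> W k \<le> hi" using label_bounds[of W, OF W] by blast
  have Wb: "0 \<le> W k \<and> W k \<le> hi" for k using b W less_imp_le by blast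
  let ?f = "\<lambda>y. W (lab y) * (cmod (up g \<phi> y))\<^sup>2"
  have kids: "(\<Sum>c\<in>steps x. ?f (c # x)) = (cmod (\<phi> x))\<^sup>2 * (\<Sum>i\<in>UNIV. real (M $ i $ lab x) * (W i * (cmod (g i))\<^sup>2))" if "x \<in> V" for x
  proof -
    have "(\<Sum>c\<in>steps x. ?f (c # x)) = (\<Sum>c\<in>steps x. (cmod (\<phi> x))\<^sup>2 * (W (fst c) * (cmod (g (fst c)))\<^sup>2))"
      using that by (intro sum.cong refl) (simp add: up_Cons Cons_in_V_iff norm_mult power_mult_distrib mult_ac)
    thus ?thesis by (simp add: sum_distrib_left[symmetric] sum_steps[where h = "\<lambda>i. W i * (cmod (g i))\<^sup>2"])
  qed
  have kle: "(\<Sum>c\<in>steps x. ?f (c # x)) \<le> q * (W (lab x) * (cmod (\<phi> x))\<^sup>2)" if "x \<in> V" for x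
  proof -
    have "(\<Sum>c\<in>steps x. ?f (c # x)) \<le> (cmod (\<phi> x))\<^sup>2 * (q * W (lab x))"
      unfolding kids[OF that] by (intro mult_left_mono le) simp
    thus ?thesis by (simp only: mult_ac)
  qed
  have f0: "?f y \<ge> 0" for y using Wb by simp
  have sq: "(\<lambda>x. q * (W (lab x) * (cmod (\<phi> x))\<^sup>2)) summable_on V"
    by (intro summable_on_cmult_right wsq_summable[OF \<phi>]) (rule Wb)
  have s1: "(\<lambda>x. \<Sum>c\<in>steps x. ?f (c # x)) summable_on V"
    by (rule summable_on_comparison_test[OF sq kle], assumption, intro sum_nonneg f0)
  have s2: "?f summable_on (V - {[]})" by (rule summable_tree[OF f0 s1])
  hence s3: "?f summable_on V" by (rule summable_tree_insert)
  have "(\<lambda>x. (1 / lo) * ?f x) summable_on V" using s3 by (rule summable_on_cmult_right)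
  hence "(\<lambda>x. (cmod (up g \<phi> x))\<^sup>2) summable_on V"
  proof (rule summable_on_comparison_test)
    show "(cmod (up g \<phi> x))\<^sup>2 \<le> (1 / lo) * ?f x" for x
      using mult_right_mono[of 1 "W (lab x) / lo" "(cmod (up g \<phi> x))\<^sup>2"] b lo by simp
  qed simp
  thus "up g \<phi> \<in> ell2 V" by (auto simp: ell2_def up_outside)
  have "wsq (\<lambda>x. W (lab x)) V (up g \<phi>) = (\<Sum>\<^sub>\<infinity>y\<in>V - {[]}. ?f y)"
    unfolding wsq_def by (intro infsum_cong_neutral) auto
  also have "\<dots> = (\<Sum>\<^sub>\<infinity>x\<in>V. \<Sum>c\<in>steps x. ?f (c # x))" by (rule infsum_tree(2)[symmetric, OF s2])
  also have "\<dots> \<le> (\<Sum>\<^sub>\<infinity>x\<in>V. q * (W (lab x) * (cmod (\<phi> x))\<^sup>2))"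
    by (intro infsum_mono s1 sq kle)
  also have "\<dots> = q * wsq (\<lambda>x. W (lab x)) V \<phi>" by (simp add: wsq_def infsum_cmult_right')
  finally show "wsq (\<lambda>x. W (lab x)) V (up g \<phi>) \<le> q * wsq (\<lambda>x. W (lab x)) V \<phi>" .
qed

text \<open>The weights \<open>1 / W\<close> define the dual norm and \<open>down g\<close> is the
  transpose of \<open>up g\<close>, hence the same hypothesis and the same \<open>q\<close>.
  Concretely this is Cauchy-Schwarz over the children, with the factors \<open>sqrt (W i)\<close>
  split off.\<close>

lemma down_bound:
  assumes \<phi>: "\<phi> \<in> ell2 V" and W: "\<And>k. W k > 0" and q: "q \<ge> 0"
    and le: "\<And>k. (\<Sum>i\<in>UNIV. real (M $ i $ k) * (W i * (cmod (g i))\<^sup>2)) \<le> q * W k"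
  shows "down g \<phi> \<in> ell2 V" "wsq (\<lambda>x. 1 / W (lab x)) V (down g \<phi>) \<le> q * wsq (\<lambda>x. 1 / W (lab x)) V \<phi>"
proof -
  obtain lo hi where lo: "0 < lo" and b: "\<And>k. lo \<le> W k \<and> W k \<le> hi" using label_bounds[of W, OF W] by blast
  have Wb: "0 \<le> 1 / W k \<and> 1 / W k \<le> 1 / lo" for k using b[of k] W[of k] lo by (simp add: frac_le)
  have hi: "1 \<le> hi * (1 / W k)" for k using b[of k] W[of k] by simp
  let ?f = "\<lambda>y. 1 / W (lab y) * (cmod (\<phi> y))\<^sup>2"
  have f0: "?f y \<ge> 0" for y using Wb by simp
  have sV: "?f summable_on V" by (rule wsq_summable[OF \<phi>]) (rule Wb)
  hence s: "?f summable_on (V - {[]})" by (rule summable_on_subset) auto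
  have kle: "1 / W (lab x) * (cmod (down g \<phi> x))\<^sup>2 \<le> q * (\<Sum>c\<in>steps x. ?f (c # x))" if "x \<in> V" for x
  proof -
    have sW: "sqrt (W k) * sqrt (W k) = W k" "sqrt (W k) > 0" for k using W[of k] by simp_all
    let ?a = "\<lambda>c. cmod (g (fst c)) * sqrt (W (fst c))" and ?b = "\<lambda>c. cmod (\<phi> (c # x)) / sqrt (W (fst c))"
    have "cmod (down g \<phi> x) \<le> (\<Sum>c\<in>steps x. ?a c * ?b c)"
      unfolding down_def using that sW(2) by (auto intro!: sum_norm_le simp: norm_mult less_imp_neq[symmetric])
    hence "(cmod (down g \<phi> x))\<^sup>2 \<le> (\<Sum>c\<in>steps x. ?a c * ?b c)\<^sup>2" by (intro power_mono) auto
    also have "\<dots> \<le> (\<Sum>c\<in>steps x. (?a c)\<^sup>2) * (\<Sum>c\<in>steps x. (?b c)\<^sup>2)" by (rule Cauchy_Schwarz_ineq_sum)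
    also have "(\<Sum>c\<in>steps x. (?a c)\<^sup>2) = (\<Sum>i\<in>UNIV. real (M $ i $ lab x) * (W i * (cmod (g i))\<^sup>2))"
    proof -
      have "(\<Sum>c\<in>steps x. (?a c)\<^sup>2) = (\<Sum>c\<in>steps x. W (fst c) * (cmod (g (fst c)))\<^sup>2)"
        using W by (intro sum.cong refl) (simp add: power_mult_distrib less_imp_le mult.commute)
      thus ?thesis by (simp add: sum_steps[where h = "\<lambda>i. W i * (cmod (g i))\<^sup>2"])
    qed
    also have "(\<Sum>c\<in>steps x. (?b c)\<^sup>2) = (\<Sum>c\<in>steps x. ?f (c # x))"
      using W by (intro sum.cong refl) (simp add: power_divide less_imp_le)
    finally have "(cmod (down g \<phi> x))\<^sup>2 \<le> (\<Sum>i\<in>UNIV. real (M $ i $ lab x) * (W i * (cmod (g i))\<^sup>2)) * (\<Sum>c\<in>steps x. ?f (c # x))" .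
    also have "\<dots> \<le> (q * W (lab x)) * (\<Sum>c\<in>steps x. ?f (c # x))"
      by (intro mult_right_mono le sum_nonneg f0)
    finally show ?thesis using W[of "lab x"] by (simp add: divide_le_eq mult_ac)
  qed
  have sk: "(\<lambda>x. q * (\<Sum>c\<in>steps x. ?f (c # x))) summable_on V"
    by (intro summable_on_cmult_right infsum_tree(1)[OF s])
  have s1: "(\<lambda>x. 1 / W (lab x) * (cmod (down g \<phi> x))\<^sup>2) summable_on V"
    by (rule summable_on_comparison_test[OF sk kle]) (use Wb in auto)
  have "(\<lambda>x. hi * (1 / W (lab x) * (cmod (down g \<phi> x))\<^sup>2)) summable_on V"
    using s1 by (rule summable_on_cmult_right)
  hence "(\<lambda>x. (cmod (down g \<phi> x))\<^sup>2) summable_on V"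
  proof (rule summable_on_comparison_test)
    show "(cmod (down g \<phi> x))\<^sup>2 \<le> hi * (1 / W (lab x) * (cmod (down g \<phi> x))\<^sup>2)" for x
      using mult_right_mono[OF hi, of "(cmod (down g \<phi> x))\<^sup>2" "lab x"] by (simp add: mult.assoc)
  qed simp
  thus "down g \<phi> \<in> ell2 V" by (auto simp: ell2_def down_outside)
  have "wsq (\<lambda>x. 1 / W (lab x)) V (down g \<phi>) \<le> (\<Sum>\<^sub>\<infinity>x\<in>V. q * (\<Sum>c\<in>steps x. ?f (c # x)))"
    unfolding wsq_def by (intro infsum_mono s1 sk kle)
  also have "\<dots> = q * (\<Sum>\<^sub>\<infinity>y\<in>V - {[]}. ?f y)" using infsum_tree(2)[OF s] by (simp add: infsum_cmult_right')
  also have "\<dots> \<le> q * wsq (\<lambda>x. 1 / W (lab x)) V \<phi>"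
    unfolding wsq_def using q by (intro mult_left_mono infsum_mono2 s sV) (use f0 in auto)
  finally show "wsq (\<lambda>x. 1 / W (lab x)) V (down g \<phi>) \<le> q * wsq (\<lambda>x. 1 / W (lab x)) V \<phi>" .
qed

lemma up_down_adjoint:
  assumes "\<phi> \<in> ell2 V" "\<psi> \<in> ell2 V"
  shows "ell2_inner V \<phi> (down (\<lambda>_. 1) \<psi>) = ell2_inner V (up (\<lambda>_. 1) \<phi>) \<psi>"
proof -
  have u: "up (\<lambda>_. 1) \<phi> \<in> ell2 V"
    by (rule up_bound(1)[OF assms(1), where W = "\<lambda>_. 1" and q = "\<Sum>k\<in>UNIV. \<Sum>i\<in>UNIV. real (M $ i $ k)"])
      (auto intro!: sum_nonneg member_le_sum)
  let ?f = "\<lambda>y. cnj (up (\<lambda>_. 1) \<phi> y) * \<psi> y"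
  have s: "?f summable_on (V - {[]})"
    using ell2_inner_summable[OF u assms(2)] by (rule summable_on_subset) auto
  have "ell2_inner V (up (\<lambda>_. 1) \<phi>) \<psi> = (\<Sum>\<^sub>\<infinity>y\<in>V - {[]}. ?f y)"
    unfolding ell2_inner_def by (intro infsum_cong_neutral) auto
  also have "\<dots> = (\<Sum>\<^sub>\<infinity>x\<in>V. \<Sum>c\<in>steps x. ?f (c # x))" by (rule infsum_tree(2)[symmetric, OF s])
  also have "\<dots> = (\<Sum>\<^sub>\<infinity>x\<in>V. cnj (\<phi> x) * down (\<lambda>_. 1) \<psi> x)"
    by (intro infsum_cong) (auto simp: down_def sum_distrib_left up_Cons Cons_in_V_iff intro!: sum.cong)
  finally show ?thesis by (simp add: ell2_inner_def)
qed

lemma up_add: "up g (\<lambda>y. \<phi> y + \<psi> y) x = up g \<phi> x + up g \<psi> x"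
  by (auto simp: up_def distrib_left split: list.splits)

lemma down_add: "down g (\<lambda>y. \<phi> y + \<psi> y) x = down g \<phi> x + down g \<psi> x"
  by (auto simp: down_def distrib_left sum.distrib)

lemma up_cmult: "up g (\<lambda>y. c * \<phi> y) x = c * up g \<phi> x"
  by (auto simp: up_def split: list.splits)

lemma down_cmult: "down g (\<lambda>y. c * \<phi> y) x = c * down g \<phi> x"
  by (auto simp: down_def sum_distrib_left mult.left_commute)

lemma up_tendsto: "(\<And>y. (\<lambda>n. \<phi>n n y) \<longlonglongrightarrow> \<phi> y) \<Longrightarrow> (\<lambda>n. up g (\<phi>n n) x) \<longlonglongrightarrow> up g \<phi> x"
  by (cases x) (auto simp: up_def intro!: tendsto_intros)

lemma down_tendsto: "(\<And>y. (\<lambda>n. \<phi>n n y) \<longlonglongrightarrow> \<phi> y) \<Longrightarrow> (\<lambda>n. down g (\<phi>n n) x) \<longlonglongrightarrow> down g \<phi> x"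
  by (auto simp: down_def intro!: tendsto_intros)

text \<open>With \<open>D\<close> the multiplication by \<open>g (lab x)\<close> and \<open>g * \<psi> = (1 + up g) \<phi>\<close> this is the factorization
  \<open>L - z = (1 + down g) D\<^sup>-\<^sup>1 (1 + up g)\<close>.\<close>

lemma factorization:
  assumes g: "green_solution M z g"
    and \<psi>: "\<And>x. x \<in> V \<Longrightarrow> g (lab x) * \<psi> x = \<phi> x + up g \<phi> x" and x: "x \<in> V"
  shows "tree_adj_op M j \<phi> x - z * \<phi> x = \<psi> x + down g \<psi> x"
proof -
  let ?S = "\<Sum>i\<in>UNIV. of_nat (M $ i $ lab x) * g i"
  have g0: "g k \<noteq> 0" for k by (rule green_solution_nonzero[OF g])
  have "down g \<psi> x = (\<Sum>c\<in>steps x. \<phi> (c # x) + g (fst c) * \<phi> x)"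
  proof -
    have "g (fst c) * \<psi> (c # x) = \<phi> (c # x) + g (fst c) * \<phi> x" if "c \<in> steps x" for c
      using \<psi>[of "c # x"] that x by (simp add: Cons_in_V_iff up_Cons)
    thus ?thesis using x by (simp add: down_def)
  qed
  also have "\<dots> = down (\<lambda>_. 1) \<phi> x + ?S * \<phi> x"
    using x by (simp add: down_def sum.distrib sum_distrib_right[symmetric] sum_steps)
  finally have d: "down g \<psi> x = down (\<lambda>_. 1) \<phi> x + ?S * \<phi> x" .
  have u: "up g \<phi> x = g (lab x) * up (\<lambda>_. 1) \<phi> x"
    using x by (cases x) (auto simp: up_def)
  have e: "g (lab x) * (\<psi> x - up (\<lambda>_. 1) \<phi> x) = \<phi> x" using \<psi>[OF x] u by (simp add: right_diff_distrib)
  have "g (lab x) * ((\<psi> x - up (\<lambda>_. 1) \<phi> x) + (z + ?S) * \<phi> x)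
      = \<phi> x + (g (lab x) * (z + ?S)) * \<phi> x"
    by (simp only: distrib_left[of "g (lab x)" "\<psi> x - up (\<lambda>_. 1) \<phi> x"] e mult.assoc)
  also have "g (lab x) * (z + ?S) = -1" using g by (simp add: green_solution_def)
  finally have "(\<psi> x - up (\<lambda>_. 1) \<phi> x) + (z + ?S) * \<phi> x = 0" using g0[of "lab x"] by simp
  thus ?thesis unfolding tree_adj_op_eq d by (simp add: algebra_simps)
qed

end

section \<open>Green functions in the upper half plane\<close>

text \<open>Multiplying the recursion by \<open>cnj (g k)\<close> gives
  \<open>|g k|^2 * u = - cnj (g k)\<close> for the denominator \<open>u\<close>; imaginary parts are
  compared.\<close>

lemma green_solution_Im:
  assumes g: "green_solution M z g"
  shows "Im (g k) = (cmod (g k))\<^sup>2 * (Im z + (child_sum M (\<lambda>i. Im (g i)) k))"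
proof -
  let ?u = "z + (\<Sum>i\<in>UNIV. of_nat (M $ i $ k) * g i)"
  have "g k * ?u = -1" using g by (simp add: green_solution_def)
  hence "cnj (g k) * (g k * ?u) = - cnj (g k)" by simp
  moreover have "cnj (g k) * (g k * ?u) = complex_of_real ((cmod (g k))\<^sup>2) * ?u"
    by (simp only: complex_norm_square mult_ac)
  ultimately have "Im (complex_of_real ((cmod (g k))\<^sup>2) * ?u) = Im (- cnj (g k))" by simp
  thus ?thesis by (simp del: of_real_power)
qed

lemma green_solution_subcritical:
  assumes "green_solution M z g" "Im z > 0" "\<And>k. Im (g k) > 0"
  shows "subcritical M g"
  unfolding subcritical_def
proof (intro exI allI conjI)
  fix k
  show "Im (g k) > 0" by (rule assms)
  have "(cmod (g k))\<^sup>2 * Im z > 0" using assms(2) green_solution_nonzero[OF assms(1)] by simp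
  thus "(cmod (g k))\<^sup>2 * (child_sum M (\<lambda>i. Im (g i)) k) < Im (g k)"
    using green_solution_Im[OF assms(1), of k] by (simp add: distrib_left)
qed

text \<open>A child with the same label contributes \<open>Im (g k)\<close> itself, so
  \<open>Im (g k) \<ge> |g k|^2 * Im (g k)\<close>, and the positive \<open>Im (g k)\<close>
  cancels.\<close>

lemma green_solution_norm_le_1:
  assumes "green_solution M z g" "Im z > 0" "\<And>k. Im (g k) > 0" "\<forall>k. M $ k $ k \<ge> 1"
  shows "cmod (g k) \<le> 1"
proof -
  have "Im (g k) \<le> real (M $ k $ k) * Im (g k)"
    using assms(3)[of k] assms(4) by simp
  also have "\<dots> \<le> (child_sum M (\<lambda>i. Im (g i)) k)"
    by (rule member_le_sum, simp) (intro mult_nonneg_nonneg of_nat_0_le_iff less_imp_le[OF assms(3)], simp_all)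
  also have "\<dots> \<le> Im z + (child_sum M (\<lambda>i. Im (g i)) k)" using assms(2) by simp
  finally have "(cmod (g k))\<^sup>2 * Im (g k) \<le> (cmod (g k))\<^sup>2 * (Im z + (child_sum M (\<lambda>i. Im (g i)) k))"
    by (intro mult_left_mono) auto
  hence "(cmod (g k))\<^sup>2 * Im (g k) \<le> 1 * Im (g k)" using green_solution_Im[OF assms(1), of k] by simp
  hence "(cmod (g k))\<^sup>2 \<le> 1" using assms(3)[of k] by (simp only: mult_le_cancel_right_pos)
  thus ?thesis by (simp add: power_le_one_iff abs_square_le_1)
qed

text \<open>If all \<open>Im (h k) \<ge> 0\<close>, the denominators have imaginary part at least
  \<open>\<eta>\<close>, so \<open>-1 / u\<close> maps the compact convex set \<open>?C\<close>, a
  half disc of radius \<open>1 / \<eta>\<close>, into itself.\<close>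

lemma upper_solution_exists:
  fixes M :: "nat ^ 'a ^ ('a::finite)"
  assumes "Im z > 0"
  shows "\<exists>g. green_solution M z g \<and> (\<forall>k. Im (g k) > 0)"
proof -
  define \<eta> where "\<eta> = Im z"
  have \<eta>: "\<eta> > 0" using assms by (simp add: \<eta>_def)
  let ?C = "{w. Im w \<ge> 0 \<and> cmod w \<le> 1 / \<eta>}"
  let ?S = "{h :: complex ^ 'a. \<forall>k. h $ k \<in> ?C}"
  let ?u = "\<lambda>h k. z + (\<Sum>i\<in>UNIV. of_nat (M $ i $ k) * h $ i)"
  let ?F = "\<lambda>h::complex^'a. \<chi> k. - 1 / ?u h k"
  have Imu: "Im (?u h k) \<ge> \<eta>" if "h \<in> ?S" for h k
    using that by (auto simp: \<eta>_def intro!: sum_nonneg)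
  have u0: "?u h k \<noteq> 0" if "h \<in> ?S" for h k
  proof
    assume "?u h k = 0"
    hence "Im (?u h k) = 0" by (simp only: zero_complex.sel)
    thus False using Imu[OF that, of k] \<eta> by linarith
  qed
  have "closed ?S"
    unfolding mem_Collect_eq by (intro closed_Collect_all closed_Collect_conj closed_Collect_le continuous_intros)
  moreover have "bounded ?S"
  proof (rule boundedI)
    fix h assume h: "h \<in> ?S"
    have "norm h \<le> (\<Sum>k\<in>UNIV. norm (h $ k))" unfolding norm_vec_def by (rule L2_set_le_sum) simp
    also have "\<dots> \<le> (\<Sum>k\<in>(UNIV :: 'a set). 1 / \<eta>)" using h by (intro sum_mono) auto
    finally show "norm h \<le> real CARD('a) * (1 / \<eta>)" by simp
  qed
  ultimately have cpt: "compact ?S" by (simp add: compact_eq_bounded_closed)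
  have "convex ?C" using \<eta>
  proof -
    have "?C = {w. 0 \<le> inner \<i> w} \<inter> cball 0 (1 / \<eta>)" by (auto simp: inner_complex_def)
    thus ?thesis by (simp only: convex_Int convex_cball convex_halfspace_ge)
  qed
  hence cvx: "convex ?S" unfolding convex_def by simp
  have ne: "?S \<noteq> {}" using \<eta> by (auto intro!: exI[of _ "\<chi> k. 0"])
  have cont: "continuous_on ?S ?F"
  proof (rule continuous_on_vec_lambda)
    fix k
    have "continuous_on ?S (\<lambda>h. ?u h k)" by (intro continuous_intros)
    thus "continuous_on ?S (\<lambda>h. - 1 / ?u h k)"
      by (rule continuous_on_divide[OF continuous_on_const]) (use u0 in blast)
  qed
  have maps: "?F \<in> ?S \<rightarrow> ?S"
  proof
    fix h assume h: "h \<in> ?S"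
    have "- 1 / ?u h k \<in> ?C" for k
    proof -
      have "cmod (?u h k) \<ge> \<eta>" using Imu[OF h, of k] abs_Im_le_cmod[of "?u h k"] by linarith
      hence "cmod (- 1 / ?u h k) \<le> 1 / \<eta>" using \<eta> by (simp add: norm_divide frac_le)
      moreover have "Im (- 1 / u) = Im u / (cmod u)\<^sup>2" for u :: complex by (simp add: Im_divide cmod_power2)
      ultimately show ?thesis using Imu[OF h, of k] \<eta> by simp
    qed
    thus "?F h \<in> ?S" by simp
  qed
  obtain h where h: "h \<in> ?S" "?F h = h" using brouwer[OF cpt cvx ne cont maps] by blast
  have hk: "- 1 / ?u h k = h $ k" for k using h(2) by (metis (no_types, lifting) vec_lambda_beta)
  have sol: "green_solution M z (\<lambda>k. h $ k)"
    unfolding green_solution_def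
  proof
    fix k
    show "h $ k * ?u h k = -1" using u0[OF h(1), of k] hk[of k] by (metis nonzero_divide_eq_eq)
  qed
  moreover have "Im (h $ k) > 0" for k
  proof -
    have "Im z + (\<Sum>i\<in>UNIV. real (M $ i $ k) * Im (h $ i)) > 0"
      using assms h(1) by (intro add_pos_nonneg sum_nonneg) auto
    thus ?thesis using green_solution_Im[OF sol, of k] green_solution_nonzero[OF sol, of k] by simp
  qed
  ultimately show ?thesis by blast
qed

section \<open>Inverting the factors of \<open>L - z\<close>\<close>

context cone_tree
begin

text \<open>With \<open>W = p / |g|^2\<close> one has \<open>W * |g|^2 = p\<close>, and the
  hypothesis shared by \<open>up_bound\<close> and \<open>down_bound\<close> becomes the
  subcriticality of \<open>g\<close>.\<close>

lemma up_down_solvable: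
  assumes g: "\<And>k. g k \<noteq> 0" and sub: "subcritical M g"
  shows "f \<in> ell2 V \<Longrightarrow> \<exists>\<phi>\<in>ell2 V. \<forall>x. \<phi> x = f x - up g \<phi> x"
    and "f \<in> ell2 V \<Longrightarrow> \<exists>\<phi>\<in>ell2 V. \<forall>x. \<phi> x = f x - down g \<phi> x"
    and "\<exists>K. \<forall>\<phi>\<in>ell2 V. \<forall>f\<in>ell2 V. (\<forall>x. \<phi> x = f x - up g \<phi> x) \<longrightarrow> norm_sq V \<phi> \<le> K * norm_sq V f"
    and "\<exists>K. \<forall>\<phi>\<in>ell2 V. \<forall>f\<in>ell2 V. (\<forall>x. \<phi> x = f x - down g \<phi> x) \<longrightarrow> norm_sq V \<phi> \<le> K * norm_sq V f"
proof -
  obtain p where p: "\<And>k. p k > 0" "\<And>k. (cmod (g k))\<^sup>2 * (child_sum M p k) < p k"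
    using sub unfolding subcritical_def by blast
  define W where "W k = p k / (cmod (g k))\<^sup>2" for k
  have W: "W k > 0" for k using p(1) g by (simp add: W_def)
  have Wg: "W k * (cmod (g k))\<^sup>2 = p k" for k using g by (simp add: W_def)
  define s where "s k = (child_sum M p k) / W k" for k
  \<comment> \<open>The maximum over the finitely many labels is below 1; the value
    \<open>1 / 2\<close> secures \<open>q > 0\<close>.\<close>
  define q where "q = max (1 / 2) (Max (range s))"
  have s1: "s k < 1" for k
  proof -
    have "(child_sum M p k) < W k"
      unfolding W_def using p(2)[of k] g[of k] by (simp add: less_divide_eq mult.commute)
    thus ?thesis using W[of k] by (simp add: s_def)
  qed
  have "Max (range s) \<in> range s" by (intro Max_in) auto
  hence q: "0 < q" "q < 1" using s1 by (auto simp: q_def)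
  have sq: "s k \<le> q" for k
  proof -
    have "s k \<le> Max (range s)" by (intro Max_ge) auto
    thus ?thesis by (simp add: q_def max.coboundedI2)
  qed
  have le: "(\<Sum>i\<in>UNIV. real (M $ i $ k) * (W i * (cmod (g i))\<^sup>2)) \<le> q * W k" for k
    using sq[of k] W[of k] by (simp add: Wg s_def divide_le_eq)
  obtain lo hi where lo: "0 < lo" and b: "\<And>k. lo \<le> W k \<and> W k \<le> hi" using label_bounds[of W, OF W] by blast
  have hi: "hi > 0" using lo b by (meson less_le_trans order_trans)
  have q0: "q \<ge> 0" using q by simp
  have contr_up: "ell2_contraction V (\<lambda>\<phi> x. - up g \<phi> x) (\<lambda>x. W (lab x)) lo hi q"
  proof
    fix \<phi> assume \<phi>: "\<phi> \<in> ell2 V"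
    show "(\<lambda>x. - up g \<phi> x) \<in> ell2 V" by (intro ell2_neg up_bound(1)[OF \<phi> W q0 le])
    show "wsq (\<lambda>x. W (lab x)) V (\<lambda>x. - up g \<phi> x) \<le> q * wsq (\<lambda>x. W (lab x)) V \<phi>"
      unfolding wsq_neg by (rule up_bound(2)[OF \<phi> W q0 le])
  qed (use b lo q in \<open>auto simp: up_add intro!: tendsto_minus up_tendsto\<close>)
  have contr_down: "ell2_contraction V (\<lambda>\<phi> x. - down g \<phi> x) (\<lambda>x. 1 / W (lab x)) (1 / hi) (1 / lo) q"
  proof
    fix \<phi> assume \<phi>: "\<phi> \<in> ell2 V"
    show "(\<lambda>x. - down g \<phi> x) \<in> ell2 V" by (intro ell2_neg down_bound(1)[OF \<phi> W q0 le])
    show "wsq (\<lambda>x. 1 / W (lab x)) V (\<lambda>x. - down g \<phi> x) \<le> q * wsq (\<lambda>x. 1 / W (lab x)) V \<phi>"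
      unfolding wsq_neg by (rule down_bound(2)[OF \<phi> W q0 le])
  next
    show "1 / hi \<le> 1 / W (lab x) \<and> 1 / W (lab x) \<le> 1 / lo" for x
      using b[of "lab x"] lo W[of "lab x"] by (simp add: frac_le)
  qed (use hi q in \<open>auto simp: down_add intro!: tendsto_minus down_tendsto\<close>)
  show "f \<in> ell2 V \<Longrightarrow> \<exists>\<phi>\<in>ell2 V. \<forall>x. \<phi> x = f x - up g \<phi> x"
    using ell2_contraction.solution_exists[OF contr_up, of f] by simp
  show "f \<in> ell2 V \<Longrightarrow> \<exists>\<phi>\<in>ell2 V. \<forall>x. \<phi> x = f x - down g \<phi> x"
    using ell2_contraction.solution_exists[OF contr_down, of f] by simp
  show "\<exists>K. \<forall>\<phi>\<in>ell2 V. \<forall>f\<in>ell2 V. (\<forall>x. \<phi> x = f x - up g \<phi> x) \<longrightarrow> norm_sq V \<phi> \<le> K * norm_sq V f"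
    using contraction_solution_bound[OF contr_up] by simp
  show "\<exists>K. \<forall>\<phi>\<in>ell2 V. \<forall>f\<in>ell2 V. (\<forall>x. \<phi> x = f x - down g \<phi> x) \<longrightarrow> norm_sq V \<phi> \<le> K * norm_sq V f"
    using contraction_solution_bound[OF contr_down] by simp
qed

abbreviation "L \<equiv> tree_adj_op M j"

definition total_deg :: real where "total_deg = (\<Sum>k\<in>UNIV. \<Sum>i\<in>UNIV. real (M $ i $ k))"

lemma total_deg_nonneg: "total_deg \<ge> 0"
  unfolding total_deg_def by (intro sum_nonneg) auto

lemma column_le_total_deg: "(\<Sum>i\<in>UNIV. real (M $ i $ k)) \<le> total_deg"
  unfolding total_deg_def by (rule member_le_sum) (auto intro: sum_nonneg)

lemma up_1:
  assumes "\<phi> \<in> ell2 V"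
  shows "up (\<lambda>_. 1) \<phi> \<in> ell2 V" "norm_sq V (up (\<lambda>_. 1) \<phi>) \<le> total_deg * norm_sq V \<phi>"
  using up_bound[OF assms, where W = "\<lambda>_. 1" and q = total_deg and g = "\<lambda>_. 1"] total_deg_nonneg column_le_total_deg by simp_all

lemma down_1:
  assumes "\<phi> \<in> ell2 V"
  shows "down (\<lambda>_. 1) \<phi> \<in> ell2 V" "norm_sq V (down (\<lambda>_. 1) \<phi>) \<le> total_deg * norm_sq V \<phi>"
  using down_bound[OF assms, where W = "\<lambda>_. 1" and q = total_deg and g = "\<lambda>_. 1"] total_deg_nonneg column_le_total_deg by simp_all

lemma L_eq: "L \<phi> = (\<lambda>x. down (\<lambda>_. 1) \<phi> x + up (\<lambda>_. 1) \<phi> x)"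
  using tree_adj_op_eq by auto

lemma L_ell2: "\<phi> \<in> ell2 V \<Longrightarrow> L \<phi> \<in> ell2 V"
  unfolding L_eq by (intro ell2_add down_1 up_1)

lemma L_bound: "\<phi> \<in> ell2 V \<Longrightarrow> norm_sq V (L \<phi>) \<le> 4 * total_deg * norm_sq V \<phi>"
  using norm_sq_add_le[OF down_1(1) up_1(1), of \<phi> \<phi>] down_1(2)[of \<phi>] up_1(2)[of \<phi>] unfolding L_eq by simp

lemma L_add: "L (\<lambda>y. \<phi> y + \<psi> y) = (\<lambda>x. L \<phi> x + L \<psi> x)"
  unfolding L_eq by (auto simp: down_add up_add)

lemma L_cmult: "L (\<lambda>y. c * \<phi> y) = (\<lambda>x. c * L \<phi> x)"
  unfolding L_eq by (auto simp: down_cmult up_cmult distrib_left)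

text \<open>The constant is positive, and its square dominates the factor
  \<open>4 * total_deg\<close> of \<open>L_bound\<close>.\<close>

lemma symmetric_operator_L: "symmetric_operator V L (2 * (total_deg + 1))"
proof
  fix \<phi> \<psi> assume e: "\<phi> \<in> ell2 V" "\<psi> \<in> ell2 V"
  have "ell2_inner V \<phi> (up (\<lambda>_. 1) \<psi>) = ell2_inner V (down (\<lambda>_. 1) \<phi>) \<psi>"
  proof -
    have "ell2_inner V \<phi> (up (\<lambda>_. 1) \<psi>) = cnj (ell2_inner V (up (\<lambda>_. 1) \<psi>) \<phi>)"
      by (rule ell2_inner_cnj[symmetric])
    also have "\<dots> = cnj (ell2_inner V \<psi> (down (\<lambda>_. 1) \<phi>))" by (simp only: up_down_adjoint[OF e(2,1)])
    finally show ?thesis by (simp only: ell2_inner_cnj)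
  qed
  thus "ell2_inner V \<phi> (L \<psi>) = ell2_inner V (L \<phi>) \<psi>"
    unfolding L_eq using e by (simp add: ell2_inner_add_left ell2_inner_add_right down_1 up_1 up_down_adjoint)
next
  fix \<phi> assume \<phi>: "\<phi> \<in> ell2 V"
  have "norm_sq V (L \<phi>) \<le> 4 * total_deg * norm_sq V \<phi>" by (rule L_bound[OF \<phi>])
  also have "\<dots> \<le> (2 * (total_deg + 1))\<^sup>2 * norm_sq V \<phi>"
  proof (rule mult_right_mono)
    show "4 * total_deg \<le> (2 * (total_deg + 1))\<^sup>2" using total_deg_nonneg by (simp add: power2_eq_square algebra_simps)
  qed (simp add: wsq_nonneg)
  finally show "norm_sq V (L \<phi>) \<le> (2 * (total_deg + 1))\<^sup>2 * norm_sq V \<phi>" .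
qed (use total_deg_nonneg in \<open>auto simp: L_add L_cmult L_ell2\<close>)

sublocale symmetric_operator V L "2 * (total_deg + 1)"
  by (rule symmetric_operator_L)

lemma L_minus_diff: "L (\<lambda>y. \<phi> y - \<psi> y) x = L \<phi> x - L \<psi> x"
  using fun_cong[OF L_add[of \<phi> "\<lambda>y. - 1 * \<psi> y"], of x] fun_cong[OF L_cmult[of "-1" \<psi>], of x] by simp

lemma mult_label_ell2: "\<phi> \<in> ell2 V \<Longrightarrow> (\<lambda>x. h (lab x) * \<phi> x) \<in> ell2 V"
  and mult_label_norm_sq: "\<phi> \<in> ell2 V \<Longrightarrow> norm_sq V (\<lambda>x. h (lab x) * \<phi> x) \<le> (\<Sum>k\<in>UNIV. (cmod (h k))\<^sup>2) * norm_sq V \<phi>"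
proof -
  assume \<phi>: "\<phi> \<in> ell2 V"
  let ?c = "\<Sum>k\<in>UNIV. (cmod (h k))\<^sup>2"
  have le: "(cmod (h k))\<^sup>2 \<le> ?c" for k by (rule member_le_sum) auto
  have eq: "(cmod (h (lab x) * \<phi> x))\<^sup>2 = (cmod (h (lab x)))\<^sup>2 * (cmod (\<phi> x))\<^sup>2" for x
    by (simp add: norm_mult power_mult_distrib)
  have "(\<lambda>x. (cmod (h (lab x)))\<^sup>2 * (cmod (\<phi> x))\<^sup>2) summable_on V"
    by (rule wsq_summable[OF \<phi>, of _ ?c]) (use le in auto)
  thus "(\<lambda>x. h (lab x) * \<phi> x) \<in> ell2 V" using \<phi> by (simp add: ell2_def norm_mult power_mult_distrib)
  have "wsq (\<lambda>x. (cmod (h (lab x)))\<^sup>2) V \<phi> \<le> ?c * norm_sq V \<phi>"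
    by (rule wsq_mono[OF \<phi>, where c = ?c and c' = 1]) (use le in auto)
  thus "norm_sq V (\<lambda>x. h (lab x) * \<phi> x) \<le> ?c * norm_sq V \<phi>" by (simp add: wsq_def norm_mult power_mult_distrib)
qed

text \<open>The a priori bounds of the two triangular equations yield injectivity and the bounded
  inverse; for surjectivity the \<open>down\<close> equation is solved first, then the
  \<open>up\<close> equation.\<close>

lemma resolvent_of_green_solution:
  assumes g: "green_solution M z g" and sub: "subcritical M g"
  shows "z \<in> resolvent_set V L"
proof -
  have g0: "g k \<noteq> 0" for k by (rule green_solution_nonzero[OF g])
  let ?T = "\<lambda>\<phi> x. L \<phi> x - z * \<phi> x"
  have Te: "?T \<phi> \<in> ell2 V" if "\<phi> \<in> ell2 V" for \<phi> by (intro ell2_diff L_ell2 ell2_cmult that)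
  have outside: "?T \<phi> x = 0" "down g \<psi> x = 0" if "\<phi> \<in> ell2 V" "x \<notin> V" for \<phi> \<psi> x
    using ell2_outside[OF Te[OF that(1)] that(2)] that(2) by (simp_all add: down_outside)
  obtain K1 where K1: "\<And>\<phi> f. \<phi> \<in> ell2 V \<Longrightarrow> f \<in> ell2 V \<Longrightarrow> (\<forall>x. \<phi> x = f x - up g \<phi> x) \<Longrightarrow> norm_sq V \<phi> \<le> K1 * norm_sq V f"
    using up_down_solvable(3)[OF g0 sub] by blast
  obtain K2 where K2: "\<And>\<phi> f. \<phi> \<in> ell2 V \<Longrightarrow> f \<in> ell2 V \<Longrightarrow> (\<forall>x. \<phi> x = f x - down g \<phi> x) \<Longrightarrow> norm_sq V \<phi> \<le> K2 * norm_sq V f"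
    using up_down_solvable(4)[OF g0 sub] by blast
  have bound: "norm_sq V \<phi> \<le> (\<bar>K1\<bar> * ((\<Sum>k\<in>UNIV. (cmod (g k))\<^sup>2) * \<bar>K2\<bar>)) * norm_sq V (?T \<phi>)" if \<phi>: "\<phi> \<in> ell2 V" for \<phi>
  proof -
    \<comment> \<open>This is \<open>(\<phi> + up g \<phi>) / g\<close>, with \<open>g\<close>
      cancelled in the second term.\<close>
    define \<psi> where "\<psi> x = 1 / g (lab x) * \<phi> x + up (\<lambda>_. 1) \<phi> x" for x
    have \<psi>: "\<psi> \<in> ell2 V" unfolding \<psi>_def by (intro ell2_add mult_label_ell2[of \<phi> "\<lambda>k. 1 / g k"] up_1 \<phi>)
    have u: "up g \<phi> x = g (lab x) * up (\<lambda>_. 1) \<phi> x" for x by (cases x) (auto simp: up_def)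
    have g\<psi>: "g (lab x) * \<psi> x = \<phi> x + up g \<phi> x" for x
      unfolding \<psi>_def u using g0[of "lab x"] by (simp add: distrib_left)
    have f: "?T \<phi> x = \<psi> x + down g \<psi> x" for x
      using factorization[OF g g\<psi>, of x] outside[OF \<phi>, of x] ell2_outside[OF \<psi>, of x] by (cases "x \<in> V") auto
    have nn: "norm_sq V \<xi> \<ge> 0" for \<xi> by (simp add: wsq_nonneg)
    have 1: "norm_sq V \<phi> \<le> K1 * norm_sq V (\<lambda>x. g (lab x) * \<psi> x)"
      by (rule K1[OF \<phi> mult_label_ell2[OF \<psi>]]) (simp add: g\<psi>)
    have 2: "norm_sq V (\<lambda>x. g (lab x) * \<psi> x) \<le> (\<Sum>k\<in>UNIV. (cmod (g k))\<^sup>2) * norm_sq V \<psi>"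
      by (rule mult_label_norm_sq[OF \<psi>])
    have 3: "norm_sq V \<psi> \<le> K2 * norm_sq V (?T \<phi>)"
      by (rule K2[OF \<psi> Te[OF \<phi>]]) (simp add: f)
    have "norm_sq V \<phi> \<le> \<bar>K1\<bar> * norm_sq V (\<lambda>x. g (lab x) * \<psi> x)"
      by (rule order_trans[OF 1 mult_right_mono]) (auto simp: nn)
    also have "\<dots> \<le> \<bar>K1\<bar> * ((\<Sum>k\<in>UNIV. (cmod (g k))\<^sup>2) * norm_sq V \<psi>)" by (intro mult_left_mono 2) auto
    also have "\<dots> \<le> \<bar>K1\<bar> * ((\<Sum>k\<in>UNIV. (cmod (g k))\<^sup>2) * (\<bar>K2\<bar> * norm_sq V (?T \<phi>)))"
      by (intro mult_left_mono order_trans[OF 3 mult_right_mono]) (auto simp: nn sum_nonneg)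
    finally show ?thesis by (simp add: mult.assoc)
  qed
  have inj: "inj_on ?T (ell2 V)"
  proof (rule inj_onI)
    fix \<phi> \<psi> assume e: "\<phi> \<in> ell2 V" "\<psi> \<in> ell2 V" and eq: "?T \<phi> = ?T \<psi>"
    have "?T (\<lambda>x. \<phi> x - \<psi> x) x = 0" for x
      using fun_cong[OF eq, of x] by (simp add: L_minus_diff algebra_simps)
    hence "norm_sq V (?T (\<lambda>x. \<phi> x - \<psi> x)) = 0" by (simp add: wsq_def)
    hence "norm_sq V (\<lambda>x. \<phi> x - \<psi> x) \<le> 0" using bound[OF ell2_diff[OF e]] by simp
    hence "\<phi> x - \<psi> x = 0" for x by (rule norm_sq_eq_0D[OF ell2_diff[OF e]])
    thus "\<phi> = \<psi>" by (auto simp: fun_eq_iff)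
  qed
  have surj: "?T ` ell2 V = ell2 V"
  proof
    show "ell2 V \<subseteq> ?T ` ell2 V"
    proof
      fix f assume f: "f \<in> ell2 V"
      obtain \<psi> where \<psi>: "\<psi> \<in> ell2 V" "\<And>x. \<psi> x = f x - down g \<psi> x" using up_down_solvable(2)[OF g0 sub f] by blast
      obtain \<phi> where \<phi>: "\<phi> \<in> ell2 V" "\<And>x. \<phi> x = g (lab x) * \<psi> x - up g \<phi> x"
        using up_down_solvable(1)[OF g0 sub mult_label_ell2[OF \<psi>(1)]] by blast
      have g\<psi>: "g (lab x) * \<psi> x = \<phi> x + up g \<phi> x" for x using \<phi>(2)[of x] by simp
      have "?T \<phi> x = f x" for x
        using factorization[OF g g\<psi>, of x] \<psi>(2)[of x] outside[OF \<phi>(1), of x] ell2_outside[OF f, of x] by (cases "x \<in> V") auto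
      hence "?T \<phi> = f" by auto
      thus "f \<in> ?T ` ell2 V" using \<phi>(1) by blast
    qed
  qed (use Te in auto)
  have "ell2_norm V \<phi> \<le> sqrt (\<bar>K1\<bar> * ((\<Sum>k\<in>UNIV. (cmod (g k))\<^sup>2) * \<bar>K2\<bar>)) * ell2_norm V (?T \<phi>)" if "\<phi> \<in> ell2 V" for \<phi>
    using real_sqrt_le_mono[OF bound[OF that]] by (simp add: ell2_norm_eq real_sqrt_mult)
  thus ?thesis unfolding resolvent_set_def bij_betw_def using inj surj by blast
qed

text \<open>Choosing the intermediate function of the factorization as the unit vector at
  \<open>y\<close>. The result is a resolvent column up to the term \<open>down g\<close>, which
  sits at the parent of \<open>y\<close> only.\<close>

lemma green_column:
  assumes g: "green_solution M z g" and sub: "subcritical M g" and y: "y \<in> V"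
  shows "\<exists>\<tau>\<in>ell2 V. (\<forall>x. \<tau> x = (if x = y then g (lab y) else 0) - up g \<tau> x) \<and>
    (\<forall>x. L \<tau> x - z * \<tau> x = (if x = y then 1 else 0) + down g (\<lambda>x. if x = y then 1 else 0) x)"
proof -
  have g0: "g k \<noteq> 0" for k by (rule green_solution_nonzero[OF g])
  obtain \<tau> where \<tau>: "\<tau> \<in> ell2 V" "\<And>x. \<tau> x = (if x = y then g (lab y) else 0) - up g \<tau> x"
    using up_down_solvable(1)[OF g0 sub ell2_single[OF y, of "g (lab y)"]] by blast
  have "L \<tau> x - z * \<tau> x = (if x = y then 1 else 0) + down g (\<lambda>x. if x = y then 1 else 0) x" for x
  proof (cases "x \<in> V")
    case True
    show ?thesis
    proof (rule factorization[OF g _ True])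
      show "g (lab x) * (if x = y then 1 else 0) = \<tau> x + up g \<tau> x" for x using \<tau>(2)[of x] by simp
    qed
  next
    case False
    thus ?thesis using y ell2_outside[OF L_ell2[OF \<tau>(1)]] ell2_outside[OF \<tau>(1)] by (auto simp: down_outside)
  qed
  thus ?thesis using \<tau> by blast
qed

end

section \<open>Resolvent set and absolute continuity\<close>

text \<open>The recursion gives \<open>|g k| * |u| = 1\<close>, and the bound on all
  \<open>g i\<close> limits the denominator \<open>u\<close>.\<close>

lemma green_solution_norm_ge:
  fixes M :: "nat ^ 'a ^ ('a::finite)"
  assumes "green_solution M z g" "\<And>k. cmod (g k) \<le> 1"
  shows "1 \<le> (cmod (g k))\<^sup>2 * (cmod z + (\<Sum>i\<in>UNIV. real (M $ i $ k)))\<^sup>2"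
proof -
  let ?u = "z + (\<Sum>i\<in>UNIV. of_nat (M $ i $ k) * g i)"
  have "g k * ?u = -1" using assms(1) by (simp add: green_solution_def)
  hence "1 = cmod (g k * ?u)" by simp
  also have "\<dots> = cmod (g k) * cmod ?u" by (rule norm_mult)
  also have "cmod ?u \<le> cmod z + (\<Sum>i\<in>UNIV. real (M $ i $ k))"
  proof -
    have "cmod (\<Sum>i\<in>UNIV. of_nat (M $ i $ k) * g i) \<le> (\<Sum>i\<in>UNIV. real (M $ i $ k))"
      using assms(2) by (intro sum_norm_le) (simp add: norm_mult mult_left_le)
    thus ?thesis by (intro order_trans[OF norm_triangle_ineq]) simp
  qed
  finally have "1 \<le> cmod (g k) * (cmod z + (\<Sum>i\<in>UNIV. real (M $ i $ k)))" by (simp add: mult_left_mono)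
  hence "1\<^sup>2 \<le> (cmod (g k) * (cmod z + (\<Sum>i\<in>UNIV. real (M $ i $ k))))\<^sup>2" by (intro power_mono) auto
  thus ?thesis by (simp add: power_mult_distrib)
qed

text \<open>A positive entry of the \<open>n\<close>-th power is a path of length \<open>n\<close>,
  each step of which costs a factor \<open>C\<close>.\<close>

lemma mat_pow_path_bound:
  fixes M :: "nat ^ 'a ^ ('a::finite)" and p :: "'a \<Rightarrow> real"
  assumes step: "\<And>i k. M $ i $ k > 0 \<Longrightarrow> p i \<le> C * p k" and C: "C \<ge> 0"
  shows "mat_pow M n $ i $ j > 0 \<Longrightarrow> p i \<le> C ^ n * p j"
proof (induction n arbitrary: i)
  case 0
  thus ?case by (simp add: mat_pow_def mat_def split: if_splits)
next
  case (Suc n)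
  have "mat_pow M (Suc n) $ i $ j = (\<Sum>l\<in>UNIV. M $ i $ l * mat_pow M n $ l $ j)"
    by (simp add: mat_pow_def matrix_matrix_mult_def)
  hence "(\<Sum>l\<in>UNIV. M $ i $ l * mat_pow M n $ l $ j) \<noteq> 0" using Suc.prems by (metis less_irrefl)
  then obtain l where "M $ i $ l * mat_pow M n $ l $ j \<noteq> 0" by (rule sum.not_neutral_contains_not_neutral)
  hence l: "M $ i $ l > 0" "mat_pow M n $ l $ j > 0" by simp_all
  have "p i \<le> C * p l" by (rule step[OF l(1)])
  also have "\<dots> \<le> C * (C ^ n * p j)" by (intro mult_left_mono Suc.IH l C)
  finally show ?case by simp
qed

text \<open>Compactness for the pair of \<open>g n\<close> and \<open>P n\<close>. The identity
  \<open>P = |g|^2 * (1 + child_sum M P)\<close> passes to the limit, where the summand 1 and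
  \<open>h k \<noteq> 0\<close> make the limit of \<open>P\<close> a strict supersolution.\<close>

lemma real_solution_of_limit:
  fixes M :: "nat ^ 'a ^ ('a::finite)"
  assumes \<eta>: "\<And>n. \<eta> n > 0" "\<eta> \<longlonglongrightarrow> 0"
    and g: "\<And>n. green_solution M (Complex E (\<eta> n)) (g n)"
    and g1: "\<And>n k. cmod (g n k) \<le> 1" and pos: "\<And>n k. Im (g n k) > 0" and B: "\<And>n k. Im (g n k) \<le> B * \<eta> n"
  shows "\<exists>h p. real_solution M E h p"
proof -
  define P where "P n k = Im (g n k) / \<eta> n" for n k
  have P: "P n k = (cmod (g n k))\<^sup>2 * (1 + (child_sum M (P n) k))" for n k
  proof -
    have "P n k = (cmod (g n k))\<^sup>2 * ((\<eta> n + (child_sum M (\<lambda>i. Im (g n i)) k)) / \<eta> n)"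
      using green_solution_Im[OF g, of n k] by (simp add: P_def)
    also have "(\<eta> n + (child_sum M (\<lambda>i. Im (g n i)) k)) / \<eta> n = 1 + (child_sum M (P n) k)"
      using \<eta>(1)[of n] by (simp add: add_divide_distrib sum_divide_distrib P_def)
    finally show ?thesis .
  qed
  have P0: "0 \<le> P n k" "P n k \<le> B" for n k
    using pos[of n k] B[of n k] \<eta>(1)[of n] by (simp_all add: P_def divide_le_eq)
  let ?X = "\<lambda>n. ((\<chi> k. g n k) :: complex ^ 'a, (\<chi> k. P n k) :: real ^ 'a)"
  have "bounded (range ?X)"
  proof (rule boundedI)
    fix x assume "x \<in> range ?X"
    then obtain n where x: "x = ?X n" by auto
    have "norm x \<le> norm ((\<chi> k. g n k) :: complex ^ 'a) + norm ((\<chi> k. P n k) :: real ^ 'a)"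
      unfolding x by (rule norm_Pair_le)
    also have "\<dots> \<le> (\<Sum>k\<in>(UNIV::'a set). 1) + (\<Sum>k\<in>(UNIV::'a set). B)"
    proof (rule add_mono)
      have "norm ((\<chi> k. g n k) :: complex ^ 'a) \<le> (\<Sum>k\<in>UNIV. norm (((\<chi> k. g n k) :: complex ^ 'a) $ k))"
        unfolding norm_vec_def by (rule L2_set_le_sum) simp
      also have "\<dots> \<le> (\<Sum>k\<in>(UNIV::'a set). 1)" using g1 by (intro sum_mono) simp
      finally show "norm ((\<chi> k. g n k) :: complex ^ 'a) \<le> (\<Sum>k\<in>(UNIV::'a set). 1)" .
      have "norm ((\<chi> k. P n k) :: real ^ 'a) \<le> (\<Sum>k\<in>UNIV. norm (((\<chi> k. P n k) :: real ^ 'a) $ k))"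
        unfolding norm_vec_def by (rule L2_set_le_sum) simp
      also have "\<dots> \<le> (\<Sum>k\<in>(UNIV::'a set). B)" using P0 by (intro sum_mono) simp
      finally show "norm ((\<chi> k. P n k) :: real ^ 'a) \<le> (\<Sum>k\<in>(UNIV::'a set). B)" .
    qed
    finally show "norm x \<le> (\<Sum>k\<in>(UNIV::'a set). 1) + (\<Sum>k\<in>(UNIV::'a set). B)" .
  qed
  then obtain l r where r: "strict_mono (r :: nat \<Rightarrow> nat)" and l: "(?X \<circ> r) \<longlonglongrightarrow> l"
    using bounded_imp_convergent_subsequence[of ?X] by blast
  have G: "(\<lambda>n. g (r n) k) \<longlonglongrightarrow> fst l $ k" for k
    using tendsto_vec_nth[OF tendsto_fst[OF l], of k] by (simp add: o_def)
  have Q: "(\<lambda>n. P (r n) k) \<longlonglongrightarrow> snd l $ k" for k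
    using tendsto_vec_nth[OF tendsto_snd[OF l], of k] by (simp add: o_def)
  have er: "(\<lambda>n. \<eta> (r n)) \<longlonglongrightarrow> 0" using LIMSEQ_subseq_LIMSEQ[OF \<eta>(2) r] by (simp add: o_def)
  have Im0: "Im (fst l $ k) = 0" for k
  proof (rule LIMSEQ_unique)
    show "(\<lambda>n. Im (g (r n) k)) \<longlonglongrightarrow> Im (fst l $ k)" by (intro tendsto_Im G)
    have "(\<lambda>n. \<eta> (r n) * P (r n) k) \<longlonglongrightarrow> 0 * snd l $ k" by (intro tendsto_mult er Q)
    moreover have "\<eta> n * P n k = Im (g n k)" for n using \<eta>(1)[of n] by (simp add: P_def)
    ultimately show "(\<lambda>n. Im (g (r n) k)) \<longlonglongrightarrow> 0" by simp
  qed
  define h where "h k = Re (fst l $ k)" for k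
  have lh: "fst l $ k = complex_of_real (h k)" for k using Im0[of k] by (simp add: h_def complex_eq_iff)
  have eq: "fst l $ k * (complex_of_real E + (\<Sum>i\<in>UNIV. of_nat (M $ i $ k) * fst l $ i)) = -1" for k
  proof (rule LIMSEQ_unique)
    have "(\<lambda>n. Complex E (\<eta> (r n))) \<longlonglongrightarrow> Complex E 0" by (intro tendsto_Complex tendsto_const er)
    hence "(\<lambda>n. Complex E (\<eta> (r n))) \<longlonglongrightarrow> complex_of_real E" by (simp add: complex_of_real_def)
    thus "(\<lambda>n. g (r n) k * (Complex E (\<eta> (r n)) + (\<Sum>i\<in>UNIV. of_nat (M $ i $ k) * g (r n) i)))
        \<longlonglongrightarrow> fst l $ k * (complex_of_real E + (\<Sum>i\<in>UNIV. of_nat (M $ i $ k) * fst l $ i))"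
      by (intro tendsto_intros G)
    show "(\<lambda>n. g (r n) k * (Complex E (\<eta> (r n)) + (\<Sum>i\<in>UNIV. of_nat (M $ i $ k) * g (r n) i))) \<longlonglongrightarrow> -1"
      using g unfolding green_solution_def by simp
  qed
  have hE: "h k * (E + (child_sum M h k)) = -1" for k
  proof -
    have "complex_of_real (h k * (E + (child_sum M h k))) = complex_of_real (-1)"
      using eq[of k] by (simp add: lh)
    thus ?thesis by (simp only: of_real_eq_iff)
  qed
  have Peq: "snd l $ k = (h k)\<^sup>2 * (1 + (\<Sum>i\<in>UNIV. real (M $ i $ k) * snd l $ i))" for k
  proof (rule LIMSEQ_unique)
    show "(\<lambda>n. P (r n) k) \<longlonglongrightarrow> snd l $ k" by (rule Q)
    have "(\<lambda>n. (cmod (g (r n) k))\<^sup>2 * (1 + (child_sum M (P (r n)) k)))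
       \<longlonglongrightarrow> (cmod (fst l $ k))\<^sup>2 * (1 + (\<Sum>i\<in>UNIV. real (M $ i $ k) * snd l $ i))"
      by (intro tendsto_intros G Q)
    thus "(\<lambda>n. P (r n) k) \<longlonglongrightarrow> (h k)\<^sup>2 * (1 + (\<Sum>i\<in>UNIV. real (M $ i $ k) * snd l $ i))"
      unfolding P[symmetric] by (simp add: lh)
  qed
  have l0: "snd l $ k \<ge> 0" for k
    by (rule LIMSEQ_le_const[OF Q]) (use P0 in auto)
  have h0: "(h k)\<^sup>2 > 0" for k using hE[of k] by auto
  have "snd l $ k > (h k)\<^sup>2 * (\<Sum>i\<in>UNIV. real (M $ i $ k) * snd l $ i)" for k
    using Peq[of k] h0[of k] by (simp add: distrib_left)
  moreover have "(h k)\<^sup>2 * (\<Sum>i\<in>UNIV. real (M $ i $ k) * snd l $ i) \<ge> 0" for k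
    by (intro mult_nonneg_nonneg sum_nonneg l0) auto
  ultimately have "real_solution M E h (\<lambda>k. snd l $ k)"
    unfolding real_solution_def using hE by (intro allI conjI) (auto intro: le_less_trans)
  thus ?thesis by blast
qed

lemma real_solution_green:
  assumes "real_solution M E g p"
  shows "green_solution M (complex_of_real E) (\<lambda>k. complex_of_real (g k))" "subcritical M (\<lambda>k. complex_of_real (g k))"
proof -
  have "complex_of_real (g k * (E + (child_sum M g k))) = complex_of_real (-1)" for k
    using assms unfolding real_solution_def by simp
  thus "green_solution M (complex_of_real E) (\<lambda>k. complex_of_real (g k))"
    unfolding green_solution_def by simp
  show "subcritical M (\<lambda>k. complex_of_real (g k))"
    unfolding subcritical_def using assms unfolding real_solution_def
    by (intro exI[of _ p]) simp
qed

lemma green_solution_cnj: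
  assumes "green_solution M z g"
  shows "green_solution M (cnj z) (\<lambda>k. cnj (g k))"
  unfolding green_solution_def
proof
  fix k
  have "cnj (g k * (z + (\<Sum>i\<in>UNIV. of_nat (M $ i $ k) * g i))) = cnj (-1)"
    using assms unfolding green_solution_def by simp
  thus "cnj (g k) * (cnj z + (\<Sum>i\<in>UNIV. of_nat (M $ i $ k) * cnj (g i))) = -1" by simp
qed

locale primitive_cone_tree = cone_tree +
  assumes M1: "\<forall>j. M $ j $ j \<ge> 1"
    and M2: "\<exists>n\<ge>1. \<forall>i k. mat_pow M n $ i $ k > 0"
begin

lemma upper_solution:
  assumes "Im z > 0"
  shows "\<exists>g. green_solution M z g \<and> subcritical M g \<and> (\<forall>k. Im (g k) > 0) \<and> (\<forall>k. cmod (g k) \<le> 1)"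
  using upper_solution_exists[OF assms, of M] green_solution_subcritical[OF _ assms] green_solution_norm_le_1[OF _ assms _ M1]
  by blast

lemma nonreal_in_resolvent:
  assumes "Im z \<noteq> 0"
  shows "z \<in> resolvent_set V L"
proof (cases "Im z > 0")
  case True
  thus ?thesis using upper_solution resolvent_of_green_solution by blast
next
  case False
  hence "Im (cnj z) > 0" using assms by simp
  then obtain g where g: "green_solution M (cnj z) g" "subcritical M g" using upper_solution by blast
  have "green_solution M z (\<lambda>k. cnj (g k))" using green_solution_cnj[OF g(1)] by simp
  moreover have "subcritical M (\<lambda>k. cnj (g k))" using g(2) unfolding subcritical_def by simp
  ultimately show ?thesis by (rule resolvent_of_green_solution)
qed

text \<open>The root has no parent, so the correction term vanishes and \<open>g j\<close> is the
  diagonal resolvent entry at the root.\<close>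

lemma root_column:
  assumes g: "green_solution M z g" and sub: "subcritical M g"
  shows "\<exists>\<tau>\<in>ell2 V. \<tau> [] = g j \<and> (\<lambda>x. L \<tau> x - z * \<tau> x) = (\<lambda>x. if x = [] then 1 else 0)"
proof -
  have d: "down g (\<lambda>x. if x = [] then 1 else 0) x = 0" for x by (simp add: down_def)
  obtain \<tau> where \<tau>: "\<tau> \<in> ell2 V" "\<And>x. \<tau> x = (if x = [] then g (lab []) else 0) - up g \<tau> x"
    "\<And>x. L \<tau> x - z * \<tau> x = (if x = [] then 1 else 0) + down g (\<lambda>x. if x = [] then 1 else 0) x"
    using green_column[OF g sub Nil_in_V] by blast
  have "\<tau> [] = g j" using \<tau>(2)[of "[]"] by simp
  thus ?thesis using \<tau>(1,3) d by (intro bexI[of _ \<tau>]) auto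
qed

text \<open>The lower bound keeps the root column of the resolvent at \<open>E + \<i>\<eta>\<close>
  bounded, and \<open>Im (g n j)\<close> is \<open>\<eta> n\<close> times its squared norm. This
  controls the label \<open>j\<close>; the other labels are reached along paths of
  \<open>M\<close>.\<close>

lemma real_solution_of_bound:
  assumes K: "K > 0" "\<And>\<phi>. \<phi> \<in> ell2 V \<Longrightarrow> norm_sq V \<phi> \<le> K * norm_sq V (\<lambda>x. L \<phi> x - complex_of_real E * \<phi> x)"
  shows "\<exists>g p. real_solution M E g p"
proof -
  \<comment> \<open>Small enough that the term with \<open>\<eta> n\<close>, after doubling, costs
    at most half of \<open>norm_sq V \<tau>\<close> and can be absorbed.\<close>
  define e0 where "e0 = min 1 (1 / (2 * sqrt K))"
  have e0: "e0 > 0" "e0 \<le> 1" "K * e0\<^sup>2 \<le> 1 / 4"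
  proof -
    show "e0 > 0" "e0 \<le> 1" using K(1) by (auto simp: e0_def)
    have "e0\<^sup>2 \<le> (1 / (2 * sqrt K))\<^sup>2" using K(1) by (intro power_mono) (auto simp: e0_def)
    also have "\<dots> = 1 / (4 * K)" using K(1) by (simp add: power_divide power_mult_distrib)
    finally show "K * e0\<^sup>2 \<le> 1 / 4" using K(1) by (simp add: field_simps)
  qed
  define \<eta> where "\<eta> n = e0 / real (Suc n)" for n
  have \<eta>: "\<eta> n > 0" "\<eta> n \<le> e0" for n using e0 by (auto simp: \<eta>_def divide_le_eq mult_left_le)
  have \<eta>0: "\<eta> \<longlonglongrightarrow> 0" unfolding \<eta>_def by real_asymp
  have "\<exists>g. green_solution M (Complex E (\<eta> n)) g \<and> subcritical M g \<and> (\<forall>k. Im (g k) > 0) \<and> (\<forall>k. cmod (g k) \<le> 1)" for n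
    by (rule upper_solution) (simp add: \<eta>)
  then obtain g where g: "\<And>n. green_solution M (Complex E (\<eta> n)) (g n)" "\<And>n. subcritical M (g n)"
    "\<And>n k. Im (g n k) > 0" "\<And>n k. cmod (g n k) \<le> 1" by metis
  have root: "Im (g n j) \<le> 4 * K * \<eta> n" for n
  proof -
    obtain \<tau> where \<tau>: "\<tau> \<in> ell2 V" "\<tau> [] = g n j"
      "(\<lambda>x. L \<tau> x - Complex E (\<eta> n) * \<tau> x) = (\<lambda>x. if x = [] then 1 else 0)"
      using root_column[OF g(1,2)] by blast
    let ?d = "\<lambda>x::'a vertex. if x = [] then (1::complex) else 0"
    have de: "?d \<in> ell2 V" using ell2_single[OF Nil_in_V, of 1] .
    have dn: "norm_sq V ?d = 1"
    proof -
      have "complex_of_real (norm_sq V ?d) = 1"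
        using ell2_inner_self[OF de] ell2_inner_single[OF Nil_in_V, of 1 ?d] by simp
      thus ?thesis by simp
    qed
    have "L \<tau> x - complex_of_real E * \<tau> x = ?d x + (\<i> * complex_of_real (\<eta> n)) * \<tau> x" for x
      using fun_cong[OF \<tau>(3), of x] by (simp add: Complex_eq algebra_simps)
    hence "norm_sq V \<tau> \<le> K * norm_sq V (\<lambda>x. ?d x + (\<i> * complex_of_real (\<eta> n)) * \<tau> x)"
      using K(2)[OF \<tau>(1)] by simp
    also have "\<dots> \<le> K * (2 * norm_sq V ?d + 2 * norm_sq V (\<lambda>x. (\<i> * complex_of_real (\<eta> n)) * \<tau> x))"
      using K(1) by (intro mult_left_mono norm_sq_add_le de ell2_cmult \<tau>) auto
    also have "\<dots> = 2 * K + 2 * (K * (\<eta> n)\<^sup>2) * norm_sq V \<tau>"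
      unfolding dn norm_sq_cmult by (simp add: norm_mult power_mult_distrib algebra_simps)
    also have "\<dots> \<le> 2 * K + 2 * (1 / 4) * norm_sq V \<tau>"
    proof -
      have "(\<eta> n)\<^sup>2 \<le> e0\<^sup>2" using \<eta>[of n] by (intro power_mono) auto
      hence "K * (\<eta> n)\<^sup>2 \<le> 1 / 4"
        using K(1) by (intro order_trans[OF mult_left_mono e0(3)]) simp_all
      thus ?thesis by (intro add_left_mono mult_right_mono) (auto simp: wsq_nonneg)
    qed
    finally have "norm_sq V \<tau> \<le> 4 * K" by simp
    moreover have "\<eta> n * norm_sq V \<tau> = Im (g n j)"
      using Im_inner_resolvent[OF \<tau>(1) \<tau>(3)[symmetric]] ell2_inner_single[OF Nil_in_V, of 1 \<tau>] \<tau>(2) by simp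
    ultimately show ?thesis using mult_left_mono[of "norm_sq V \<tau>" "4 * K" "\<eta> n"] \<eta>(1)[of n] by (simp add: mult.commute)
  qed
  \<comment> \<open>A bound for \<open>1 / |g|^2\<close>, the squared modulus of the denominator:
    \<open>\<bar>E\<bar> + 1\<close> covers the energy and \<open>total_deg\<close> the
    children.\<close>
  define C where "C = (\<bar>E\<bar> + 1 + total_deg)\<^sup>2"
  have step: "Im (g n i) \<le> C * Im (g n k)" if "M $ i $ k > 0" for n i k
  proof -
    let ?S = "\<Sum>i\<in>UNIV. real (M $ i $ k)"
    have "Im (g n i) \<le> real (M $ i $ k) * Im (g n i)" using that g(3)[of n i] by simp
    also have "\<dots> \<le> (child_sum M (\<lambda>i. Im (g n i)) k)"
      by (rule member_le_sum, simp) (intro mult_nonneg_nonneg of_nat_0_le_iff less_imp_le[OF g(3)], simp_all)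
    finally have 1: "Im (g n i) \<le> \<eta> n + (child_sum M (\<lambda>i. Im (g n i)) k)" using \<eta>(1)[of n] by simp
    have "(cmod (g n k))\<^sup>2 * Im (g n i) \<le> Im (g n k)"
      using mult_left_mono[OF 1, of "(cmod (g n k))\<^sup>2"] green_solution_Im[OF g(1), of n k] by simp
    moreover have "C \<ge> 0" by (simp add: C_def)
    ultimately have "C * ((cmod (g n k))\<^sup>2 * Im (g n i)) \<le> C * Im (g n k)" by (rule mult_left_mono)
    moreover have "1 \<le> C * (cmod (g n k))\<^sup>2"
    proof -
      have "cmod (Complex E (\<eta> n)) \<le> \<bar>E\<bar> + 1"
        using cmod_le[of "Complex E (\<eta> n)"] \<eta>[of n] e0 by simp
      hence "cmod (Complex E (\<eta> n)) + ?S \<le> \<bar>E\<bar> + 1 + total_deg" using column_le_total_deg[of k] by linarith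
      hence "(cmod (Complex E (\<eta> n)) + ?S)\<^sup>2 \<le> C" unfolding C_def by (intro power_mono add_nonneg_nonneg sum_nonneg) auto
      hence "(cmod (g n k))\<^sup>2 * (cmod (Complex E (\<eta> n)) + ?S)\<^sup>2 \<le> (cmod (g n k))\<^sup>2 * C" by (rule mult_left_mono) simp
      thus ?thesis using green_solution_norm_ge[OF g(1,4), of n k] by (simp add: mult.commute)
    qed
    hence "Im (g n i) \<le> (C * (cmod (g n k))\<^sup>2) * Im (g n i)" using g(3)[of n i] by simp
    ultimately show ?thesis by (simp add: mult.assoc)
  qed
  obtain m where m: "\<And>i k. mat_pow M m $ i $ k > 0" using M2 by blast
  have C0: "C \<ge> 0" by (simp add: C_def)
  have "Im (g n i) \<le> (C ^ m * (4 * K)) * \<eta> n" for n i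
  proof -
    have "Im (g n i) \<le> C ^ m * Im (g n j)"
      by (rule mat_pow_path_bound[where p = "\<lambda>i. Im (g n i)" and M = M, OF step C0 m])
    also have "\<dots> \<le> C ^ m * (4 * K * \<eta> n)" using C0 root by (intro mult_left_mono) auto
    finally show ?thesis by (simp add: mult.assoc)
  qed
  from real_solution_of_limit[OF \<eta>(1) \<eta>0 g(1,4,3) this] show ?thesis .
qed

lemma real_resolvent_iff:
  "complex_of_real E \<in> op_spectrum V L \<longleftrightarrow> \<not> (\<exists>g p. real_solution M E g p)"
proof
  show "\<not> (\<exists>g p. real_solution M E g p)" if "complex_of_real E \<in> op_spectrum V L"
    using that resolvent_of_green_solution[OF real_solution_green] unfolding op_spectrum_def by blast
  show "complex_of_real E \<in> op_spectrum V L" if "\<not> (\<exists>g p. real_solution M E g p)"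
  proof (rule ccontr)
    assume "complex_of_real E \<notin> op_spectrum V L"
    then obtain K where "K > 0" "\<And>\<phi>. \<phi> \<in> ell2 V \<Longrightarrow> norm_sq V \<phi> \<le> K * norm_sq V (\<lambda>x. L \<phi> x - complex_of_real E * \<phi> x)"
      using resolvent_bound by blast
    hence "\<exists>g p. real_solution M E g p" by (rule real_solution_of_bound)
    thus False using that by blast
  qed
qed

lemma spectrum_bounded:
  assumes "complex_of_real E \<in> op_spectrum V L"
  shows "\<bar>E\<bar> \<le> 2 * (total_deg + 1)"
proof (rule ccontr)
  assume "\<not> \<bar>E\<bar> \<le> 2 * (total_deg + 1)"
  hence "(2 * (total_deg + 1))\<^sup>2 \<le> \<bar>E\<bar>\<^sup>2" using total_deg_nonneg by (intro power_mono) auto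
  moreover have "4 + 6 * total_deg \<le> (2 * (total_deg + 1))\<^sup>2"
    using total_deg_nonneg mult_nonneg_nonneg[OF total_deg_nonneg total_deg_nonneg] by (simp add: power2_eq_square algebra_simps)
  ultimately have E2: "4 + 6 * total_deg \<le> E\<^sup>2" by simp
  have "norm_sq V \<phi> \<le> 3 * norm_sq V (\<lambda>x. L \<phi> x - complex_of_real E * \<phi> x)" if \<phi>: "\<phi> \<in> ell2 V" for \<phi>
  proof -
    let ?T = "\<lambda>x. L \<phi> x - complex_of_real E * \<phi> x"
    have T: "?T \<in> ell2 V" by (intro ell2_diff L_ell2 ell2_cmult \<phi>)
    have nn: "norm_sq V \<xi> \<ge> 0" for \<xi> by (simp add: wsq_nonneg)
    have "E\<^sup>2 * norm_sq V \<phi> = norm_sq V (\<lambda>x. complex_of_real (- E) * \<phi> x)" unfolding norm_sq_cmult by simp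
    also have "(\<lambda>x. complex_of_real (- E) * \<phi> x) = (\<lambda>x. ?T x + (-1) * L \<phi> x)" by auto
    \<comment> \<open>Young's inequality with \<open>e = 1 / 2\<close>; with \<open>L_bound\<close>
      it yields the factor \<open>6 * total_deg\<close> that \<open>E2\<close> has to beat.\<close>
    also have "norm_sq V \<dots> \<le> (1 + 1 / (1/2)) * norm_sq V ?T + (1 + 1/2) * norm_sq V (\<lambda>x. (-1) * L \<phi> x)"
      by (rule wsq_add_le[OF T ell2_cmult[OF L_ell2[OF \<phi>]], where c = 1]) auto
    also have "\<dots> = 3 * norm_sq V ?T + 3 / 2 * norm_sq V (L \<phi>)" unfolding norm_sq_cmult by simp
    also have "\<dots> \<le> 3 * norm_sq V ?T + 3 / 2 * (4 * total_deg * norm_sq V \<phi>)" using L_bound[OF \<phi>] by simp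
    finally have "E\<^sup>2 * norm_sq V \<phi> \<le> 3 * norm_sq V ?T + 6 * total_deg * norm_sq V \<phi>" by simp
    moreover have "(4 + 6 * total_deg) * norm_sq V \<phi> \<le> E\<^sup>2 * norm_sq V \<phi>" using E2 nn by (intro mult_right_mono) auto
    ultimately show ?thesis using nn[of \<phi>] by (simp add: distrib_right)
  qed
  thus False using real_solution_of_bound[of 3 E] assms real_resolvent_iff by auto
qed

sublocale bounded_symmetric V L "2 * (total_deg + 1)"
  by unfold_locales (rule spectrum_bounded)

text \<open>Removing the correction at the parent subtracts \<open>g\<close> times the column of the
  parent. Along the path to the root this adds \<open>Suc (length y)\<close> columns, each with
  entries of modulus at most 1, uniformly in \<open>z\<close>.\<close>

lemma resolvent_column:
  assumes g: "green_solution M z g" and sub: "subcritical M g" and g1: "\<And>k. cmod (g k) \<le> 1"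
  shows "y \<in> V \<Longrightarrow> \<exists>\<psi>\<in>ell2 V. (\<forall>x. L \<psi> x - z * \<psi> x = (if x = y then 1 else 0)) \<and> (\<forall>x. cmod (\<psi> x) \<le> real (Suc (length y)))"
proof -
  have col: "\<exists>\<tau>\<in>ell2 V. (\<forall>x. cmod (\<tau> x) \<le> 1) \<and>
    (\<forall>x. L \<tau> x - z * \<tau> x = (if x = y then 1 else 0) + down g (\<lambda>x. if x = y then 1 else 0) x)" if y: "y \<in> V" for y
  proof -
    obtain \<tau> where \<tau>: "\<tau> \<in> ell2 V" "\<And>x. \<tau> x = (if x = y then g (lab y) else 0) - up g \<tau> x"
      "\<And>x. L \<tau> x - z * \<tau> x = (if x = y then 1 else 0) + down g (\<lambda>x. if x = y then 1 else 0) x"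
      using green_column[OF g sub y] by blast
    \<comment> \<open>The equation propagates only away from the root, so nothing precedes the
      source at \<open>y\<close>; this excludes a second contribution at \<open>y\<close>
      itself.\<close>
    have zero: "length x < length y \<Longrightarrow> \<tau> x = 0" for x
    proof (induction x)
      case (Cons c x)
      thus ?case using \<tau>(2)[of "c # x"] by (auto simp: up_def)
    qed (use \<tau>(2)[of "[]"] in auto)
    have "cmod (\<tau> x) \<le> 1" for x
    proof (induction x)
      case Nil
      show ?case using \<tau>(2)[of "[]"] g1 by auto
    next
      case (Cons c x)
      show ?case
      proof (cases "c # x = y")
        case True
        hence "\<tau> x = 0" by (intro zero) auto
        hence "\<tau> (c # x) = g (lab y)" using \<tau>(2)[of "c # x"] True by (auto simp: up_def)
        thus ?thesis using g1 by simp
      next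
        case False
        have "cmod (\<tau> (c # x)) = cmod (up g \<tau> (c # x))" using \<tau>(2)[of "c # x"] False by simp
        also have "\<dots> \<le> cmod (g (fst c)) * cmod (\<tau> x)" by (simp add: up_def norm_mult)
        also have "\<dots> \<le> 1 * 1" by (intro mult_mono g1 Cons.IH) auto
        finally show ?thesis by simp
      qed
    qed
    thus ?thesis using \<tau>(1,3) by blast
  qed
  show "y \<in> V \<Longrightarrow> \<exists>\<psi>\<in>ell2 V. (\<forall>x. L \<psi> x - z * \<psi> x = (if x = y then 1 else 0)) \<and> (\<forall>x. cmod (\<psi> x) \<le> real (Suc (length y)))"
  proof (induction y)
    case Nil
    obtain \<tau> where \<tau>: "\<tau> \<in> ell2 V" "\<And>x. cmod (\<tau> x) \<le> 1"
      "\<And>x. L \<tau> x - z * \<tau> x = (if x = [] then 1 else 0) + down g (\<lambda>x. if x = [] then 1 else 0) x"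
      using col[OF Nil_in_V] by blast
    have "down g (\<lambda>x. if x = [] then 1 else 0) x = 0" for x by (simp add: down_def)
    thus ?case using \<tau> by (intro bexI[of _ \<tau>]) auto
  next
    case (Cons c x)
    let ?y = "c # x"
    have V: "x \<in> V" "c \<in> steps x" using Cons.prems by (simp_all add: Cons_in_V_iff)
    obtain \<tau> where \<tau>: "\<tau> \<in> ell2 V" "\<And>v. cmod (\<tau> v) \<le> 1"
      "\<And>v. L \<tau> v - z * \<tau> v = (if v = ?y then 1 else 0) + down g (\<lambda>x. if x = ?y then 1 else 0) v"
      using col[OF Cons.prems] by blast
    obtain \<psi> where \<psi>: "\<psi> \<in> ell2 V" "\<And>v. L \<psi> v - z * \<psi> v = (if v = x then 1 else 0)"
      "\<And>v. cmod (\<psi> v) \<le> real (Suc (length x))" using Cons.IH[OF V(1)] by blast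
    have d: "down g (\<lambda>x. if x = ?y then 1 else 0) v = g (fst c) * (if v = x then 1 else 0)" for v
    proof (cases "v = x")
      case True
      have "(\<Sum>c'\<in>steps x. g (fst c') * (if c' # x = ?y then 1 else 0)) = (\<Sum>c'\<in>steps x. if c' = c then g (fst c) else 0)"
        by (intro sum.cong) auto
      thus ?thesis using True V by (simp add: down_def)
    qed (simp add: down_def)
    let ?\<xi> = "\<lambda>v. \<tau> v - g (fst c) * \<psi> v"
    have "L ?\<xi> v - z * ?\<xi> v = (if v = ?y then 1 else 0)" for v
    proof -
      have "L ?\<xi> v - z * ?\<xi> v = (L \<tau> v - z * \<tau> v) - g (fst c) * (L \<psi> v - z * \<psi> v)"
        unfolding L_minus_diff L_cmult by (simp add: algebra_simps)
      thus ?thesis unfolding \<tau>(3) \<psi>(2) d by simp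
    qed
    moreover have "cmod (?\<xi> v) \<le> real (Suc (length ?y))" for v
    proof -
      have "cmod (?\<xi> v) \<le> cmod (\<tau> v) + cmod (g (fst c)) * cmod (\<psi> v)"
        by (metis norm_triangle_ineq4 norm_mult)
      also have "\<dots> \<le> 1 + 1 * real (Suc (length x))"
        by (intro add_mono mult_mono \<tau> \<psi> g1) auto
      finally show ?thesis by simp
    qed
    moreover have "?\<xi> \<in> ell2 V" by (intro ell2_diff ell2_cmult \<tau> \<psi>)
    ultimately show ?case by (intro bexI[of _ ?\<xi>]) blast+
  qed
qed

lemma sum_single:
  fixes a :: "'v \<Rightarrow> complex"
  assumes "finite F"
  shows "(\<Sum>y\<in>F. a y * (if x = y then 1 else 0)) = (if x \<in> F then a x else 0)"
proof -
  have "(\<Sum>y\<in>F. a y * (if x = y then 1 else 0)) = (\<Sum>y\<in>F. if x = y then a y else 0)"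
    by (intro sum.cong) auto
  thus ?thesis using assms by simp
qed

lemma L_sum: "L (\<lambda>x. \<Sum>y\<in>F. a y * \<psi> y x) = (\<lambda>x. \<Sum>y\<in>F. a y * L (\<psi> y) x)"
  by (induction F rule: infinite_finite_induct) (auto simp: T_zero L_add L_cmult)

text \<open>Superposing finitely many resolvent columns bounds the matrix element by a constant
  \<open>C\<close> free of \<open>E\<close> and \<open>\<eta>\<close>. The measure of an interval is
  then at most \<open>C\<close> times its length.\<close>

lemma absolutely_continuous_finite_support:
  assumes F: "finite F" "F \<subseteq> V"
  shows "absolutely_continuous lborel (spectral_measure V L (\<lambda>x. if x \<in> F then a x else 0))"
proof -
  define \<phi> where "\<phi> = (\<lambda>x. if x \<in> F then a x else 0)"
  define C where "C = (\<Sum>y\<in>F. cmod (a y) * (\<Sum>v\<in>F. cmod (a v) * real (Suc (length v))))"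
  have \<phi>sum: "\<phi> x = (\<Sum>y\<in>F. a y * (if x = y then 1 else 0))" for x
    unfolding sum_single[OF F(1)] \<phi>_def ..
  have \<phi>: "\<phi> \<in> ell2 V"
  proof -
    have "(\<lambda>x. \<Sum>y\<in>F. a y * (if x = y then 1 else 0)) \<in> ell2 V"
      using F by (intro ell2_sum ell2_cmult ell2_single) auto
    thus ?thesis using \<phi>sum by presburger
  qed
  have bound: "measure (spectral_measure V L \<phi>) {E - \<eta>..E + \<eta>} \<le> 2 * \<eta> * C" if \<eta>: "\<eta> > 0" for E \<eta>
  proof -
    let ?z = "Complex E \<eta>"
    obtain g where g: "green_solution M ?z g" "subcritical M g" "\<And>k. cmod (g k) \<le> 1"
      using upper_solution[of ?z] \<eta> by auto
    have "\<forall>y\<in>F. \<exists>\<psi>. \<psi> \<in> ell2 V \<and> (\<forall>x. L \<psi> x - ?z * \<psi> x = (if x = y then 1 else 0)) \<and> (\<forall>x. cmod (\<psi> x) \<le> real (Suc (length y)))"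
      using resolvent_column[OF g] F(2) by blast
    then obtain \<psi> where \<psi>: "\<And>y. y \<in> F \<Longrightarrow> \<psi> y \<in> ell2 V"
      "\<And>y x. y \<in> F \<Longrightarrow> L (\<psi> y) x - ?z * \<psi> y x = (if x = y then 1 else 0)"
      "\<And>y x. y \<in> F \<Longrightarrow> cmod (\<psi> y x) \<le> real (Suc (length y))" by metis
    define \<xi> where "\<xi> = (\<lambda>x. \<Sum>y\<in>F. a y * \<psi> y x)"
    have \<xi>: "\<xi> \<in> ell2 V" unfolding \<xi>_def by (intro ell2_sum ell2_cmult \<psi>)
    have eq: "\<phi> = (\<lambda>x. L \<xi> x - ?z * \<xi> x)"
    proof
      fix x
      have "L \<xi> x - ?z * \<xi> x = (\<Sum>y\<in>F. a y * (L (\<psi> y) x - ?z * \<psi> y x))"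
        unfolding \<xi>_def L_sum by (simp add: sum_distrib_left sum_subtractf right_diff_distrib mult.left_commute)
      also have "\<dots> = \<phi> x" unfolding \<phi>sum by (intro sum.cong refl) (simp only: \<psi>(2))
      finally show "\<phi> x = L \<xi> x - ?z * \<xi> x" by simp
    qed
    have "ell2_inner V \<phi> \<xi> = (\<Sum>\<^sub>\<infinity>x\<in>F. cnj (a x) * \<xi> x)"
      unfolding ell2_inner_def using F(2) by (intro infsum_cong_neutral) (auto simp: \<phi>_def)
    also have "\<dots> = (\<Sum>x\<in>F. cnj (a x) * \<xi> x)" using F(1) by simp
    finally have "cmod (ell2_inner V \<phi> \<xi>) \<le> (\<Sum>x\<in>F. cmod (a x) * cmod (\<xi> x))"
      by (simp add: sum_norm_le norm_mult)
    also have "\<dots> \<le> C"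
      unfolding C_def
    proof (intro sum_mono mult_left_mono)
      fix x
      show "cmod (\<xi> x) \<le> (\<Sum>v\<in>F. cmod (a v) * real (Suc (length v)))"
        unfolding \<xi>_def by (intro sum_norm_le) (auto simp: norm_mult intro!: mult_left_mono \<psi>(3) simp del: of_nat_Suc)
    qed auto
    finally have "Im (ell2_inner V \<phi> \<xi>) \<le> C" using abs_Im_le_cmod[of "ell2_inner V \<phi> \<xi>"] by linarith
    hence "2 * \<eta> * Im (ell2_inner V \<phi> \<xi>) \<le> 2 * \<eta> * C" using \<eta> by (intro mult_left_mono) auto
    thus ?thesis using spectral_measure_interval_bound[OF \<xi> eq \<eta>] by linarith
  qed
  have "absolutely_continuous lborel (spectral_measure V L \<phi>)"
  proof (rule absolutely_continuous_intervalI[OF spectral_measure_props(1-3)[OF \<phi>]])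
    fix s t :: real assume "s < t"
    thus "measure (spectral_measure V L \<phi>) {s..t} \<le> C * (t - s)"
      using bound[of "(t - s) / 2" "(s + t) / 2"] by (simp add: field_simps)
  qed
  thus ?thesis by (simp add: \<phi>_def)
qed

lemma purely_absolutely_continuous_L: "purely_absolutely_continuous V L"
  unfolding purely_absolutely_continuous_def
proof
  fix \<phi> assume \<phi>: "\<phi> \<in> ell2 V"
  show "absolutely_continuous lborel (spectral_measure V L \<phi>)"
  proof (rule absolutely_continuous_closure[OF \<phi>])
    fix e :: real assume e: "e > 0"
    obtain F where F: "finite F" "F \<subseteq> V" "norm_sq V (\<lambda>x. \<phi> x - (if x \<in> F then \<phi> x else 0)) \<le> e"
      using ell2_finite_approx[OF \<phi> e] by blast
    have "(\<lambda>x. \<Sum>y\<in>F. \<phi> y * (if x = y then 1 else 0)) \<in> ell2 V"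
      using F by (intro ell2_sum ell2_cmult ell2_single) auto
    moreover have "(\<lambda>x. \<Sum>y\<in>F. \<phi> y * (if x = y then 1 else 0)) = (\<lambda>x. if x \<in> F then \<phi> x else 0)"
      unfolding sum_single[OF F(1)] ..
    ultimately show "\<exists>\<psi>\<in>ell2 V. norm_sq V (\<lambda>x. \<phi> x - \<psi> x) \<le> e \<and> absolutely_continuous lborel (spectral_measure V L \<psi>)"
      using F absolutely_continuous_finite_support[OF F(1,2)] by (intro bexI[of _ "\<lambda>x. if x \<in> F then \<phi> x else 0"]) auto
  qed
qed

text \<open>No spectral measure charges the point \<open>E\<close>, so all of them keep the distance
  \<open>\<epsilon>\<close> from it. The resulting lower bound for \<open>L - E\<close> makes
  \<open>E\<close> regular.\<close>

lemma no_isolated_spectrum: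
  assumes "\<epsilon> > 0" and gap: "\<And>t. t \<noteq> E \<Longrightarrow> \<bar>t - E\<bar> < \<epsilon> \<Longrightarrow> complex_of_real t \<notin> op_spectrum V L"
  shows "complex_of_real E \<notin> op_spectrum V L"
proof -
  have "norm_sq V \<phi> \<le> (1 / \<epsilon>\<^sup>2) * norm_sq V (\<lambda>x. L \<phi> x - complex_of_real E * \<phi> x)" if \<phi>: "\<phi> \<in> ell2 V" for \<phi>
  proof -
    let ?\<mu> = "spectral_measure V L \<phi>"
    have "{E} \<in> null_sets lborel" by (simp add: null_sets_def)
    hence "{E} \<in> null_sets ?\<mu>"
      using purely_absolutely_continuous_L \<phi> unfolding purely_absolutely_continuous_def absolutely_continuous_def by blast
    hence "AE t in ?\<mu>. t \<notin> {E}" by (rule AE_not_in)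
    moreover have "AE t in ?\<mu>. complex_of_real t \<in> op_spectrum V L"
      using spectral_measure[OF \<phi>] by (simp add: is_spectral_measure_def)
    ultimately have "AE t in ?\<mu>. \<epsilon> \<le> \<bar>t - E\<bar>"
      by eventually_elim (use gap in force)
    from spectral_gap_bound[OF \<phi> assms(1) this] show ?thesis
      using assms(1) by (simp add: field_simps)
  qed
  hence "\<exists>g p. real_solution M E g p" using assms(1) by (intro real_solution_of_bound[of "1 / \<epsilon>\<^sup>2"]) auto
  thus ?thesis by (simp add: real_resolvent_iff)
qed

lemma op_spectrum_eq: "op_spectrum V L = complex_of_real ` {E. \<not> (\<exists>g p. real_solution M E g p)}"
proof (intro equalityI subsetI)
  fix z assume z: "z \<in> op_spectrum V L"
  hence "Im z = 0" using nonreal_in_resolvent unfolding op_spectrum_def by blast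
  then obtain E where E: "z = complex_of_real E" using complex_is_Real_iff Reals_cases by blast
  show "z \<in> complex_of_real ` {E. \<not> (\<exists>g p. real_solution M E g p)}"
    using z real_resolvent_iff[of E] unfolding E by blast
next
  fix z assume "z \<in> complex_of_real ` {E. \<not> (\<exists>g p. real_solution M E g p)}"
  then obtain E where "z = complex_of_real E" "\<not> (\<exists>g p. real_solution M E g p)" by blast
  thus "z \<in> op_spectrum V L" using real_resolvent_iff[of E] by simp
qed

end

section \<open>Finite unions of intervals\<close>

definition finite_interval_union :: "real set \<Rightarrow> bool" where
  "finite_interval_union A \<longleftrightarrow> (\<exists>F. finite F \<and> (\<forall>I\<in>F. is_interval I) \<and> A = \<Union>F)"

lemma finite_interval_union_compl:
  assumes "is_interval (I :: real set)"
  shows "finite_interval_union (- I)"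
proof (cases "I = {}")
  case True
  thus ?thesis unfolding finite_interval_union_def by (intro exI[of _ "{UNIV}"]) auto
next
  case False
  have "- I = {x. \<forall>y\<in>I. x < y} \<union> {x. \<forall>y\<in>I. y < x}"
  proof (intro equalityI subsetI)
    fix x assume x: "x \<in> - I"
    show "x \<in> {x. \<forall>y\<in>I. x < y} \<union> {x. \<forall>y\<in>I. y < x}"
    proof (rule ccontr)
      assume "x \<notin> {x. \<forall>y\<in>I. x < y} \<union> {x. \<forall>y\<in>I. y < x}"
      then obtain y1 y2 where "y1 \<in> I" "\<not> x < y1" "y2 \<in> I" "\<not> y2 < x" by blast
      hence "x \<in> I" using mem_is_interval_1_I[OF assms, of y1 y2 x] by simp
      thus False using x by simp
    qed
  qed auto
  moreover have "is_interval {x. \<forall>y\<in>I. x < y}" "is_interval {x. \<forall>y\<in>I. y < x}"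
    unfolding is_interval_1 by (auto intro: order_le_less_trans order_less_le_trans)
  ultimately show ?thesis unfolding finite_interval_union_def
    by (intro exI[of _ "{{x. \<forall>y\<in>I. x < y}, {x. \<forall>y\<in>I. y < x}}"]) auto
qed

lemma finite_interval_union_Int:
  assumes "finite_interval_union A" "finite_interval_union B"
  shows "finite_interval_union (A \<inter> B)"
proof -
  obtain F G where F: "finite F" "\<forall>I\<in>F. is_interval I" "A = \<Union>F" and G: "finite G" "\<forall>I\<in>G. is_interval I" "B = \<Union>G"
    using assms unfolding finite_interval_union_def by blast
  have "A \<inter> B = \<Union>((\<lambda>(I, J). I \<inter> J) ` (F \<times> G))" unfolding F(3) G(3) by auto
  moreover have "finite ((\<lambda>(I, J). I \<inter> J) ` (F \<times> G))" using F G by simp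
  moreover have "\<forall>I\<in>(\<lambda>(I, J). I \<inter> J) ` (F \<times> G). is_interval I" using F G by (auto intro: is_interval_Int)
  ultimately show ?thesis unfolding finite_interval_union_def by blast
qed

lemma finite_interval_union_Inter:
  assumes "finite S" "\<And>s. s \<in> S \<Longrightarrow> is_interval (I s :: real set)"
  shows "finite_interval_union (- (\<Union>s\<in>S. I s))"
  using assms
proof (induction S rule: finite_induct)
  case empty
  show ?case unfolding finite_interval_union_def by (intro exI[of _ "{UNIV}"]) auto
next
  case (insert s S)
  have "- (\<Union>s\<in>insert s S. I s) = - I s \<inter> - (\<Union>s\<in>S. I s)" by auto
  thus ?case using insert by (simp add: finite_interval_union_Int finite_interval_union_compl)
qed

text \<open>Every component contains, as a whole, one of the given intervals that meets it;
  components are disjoint, so this choice is injective.\<close>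

lemma finite_components_of_interval_union:
  assumes "finite_interval_union A"
  shows "finite (components A)"
proof -
  obtain F where F: "finite F" "\<forall>I\<in>F. is_interval I" "A = \<Union>F"
    using assms unfolding finite_interval_union_def by blast
  have "\<forall>C\<in>components A. \<exists>x. x \<in> C" using in_components_nonempty by blast
  then obtain x where x: "\<And>C. C \<in> components A \<Longrightarrow> x C \<in> C" by metis
  have "\<forall>C\<in>components A. \<exists>I\<in>F. x C \<in> I" using x in_components_subset F(3) by blast
  then obtain I where I: "\<And>C. C \<in> components A \<Longrightarrow> I C \<in> F \<and> x C \<in> I C" by metis
  have sub: "I C \<subseteq> C" if "C \<in> components A" for C
  proof (rule components_maximal[OF that])
    show "connected (I C)" using I[OF that] F(2) is_interval_connected by blast
    show "I C \<subseteq> A" using I[OF that] F(3) by blast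
    show "C \<inter> I C \<noteq> {}" using I[OF that] x[OF that] by blast
  qed
  have "inj_on I (components A)"
  proof (rule inj_onI)
    fix C C' assume C: "C \<in> components A" "C' \<in> components A" "I C = I C'"
    hence "x C \<in> C \<inter> C'" using I x sub by blast
    thus "C = C'" using components_nonoverlap[OF C(1,2)] by blast
  qed
  moreover have "I ` components A \<subseteq> F" using I by blast
  ultimately show ?thesis using F(1) finite_subset finite_image_iff by metis
qed

text \<open>A one-point component is isolated, as it cannot lie in the closure of another component.\<close>

lemma isolated_of_degenerate_component:
  fixes A :: "real set"
  assumes fin: "finite (components A)" and C: "C \<in> components A" and int: "interior C = {}"
  shows "\<exists>E\<in>A. \<exists>\<epsilon>>0. \<forall>t. t \<noteq> E \<longrightarrow> \<bar>t - E\<bar> < \<epsilon> \<longrightarrow> t \<notin> A"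
proof -
  have con: "connected C" using C by (rule in_components_connected)
  obtain E where E: "E \<in> C" using in_components_nonempty[OF C] by blast
  have sing: "C = {E}"
  proof (rule ccontr)
    assume "C \<noteq> {E}"
    then obtain x where x: "x \<in> C" "x \<noteq> E" using E by blast
    have "{min x E..max x E} \<subseteq> C" using connected_contains_Icc[OF con] x E by (auto simp: min_def max_def)
    hence "{min x E<..<max x E} \<subseteq> interior C" by (intro interior_maximal) (auto intro: order_trans[rotated])
    moreover have "(x + E) / 2 \<in> {min x E<..<max x E}" using x by (auto simp: min_def max_def)
    ultimately show False using int by blast
  qed
  have EA: "E \<in> A" using E in_components_subset[OF C] by blast
  define U where "U = (\<Union>B\<in>components A - {C}. closure B)"
  have "E \<notin> U"
  proof
    assume "E \<in> U"
    then obtain B where B: "B \<in> components A" "B \<noteq> C" "E \<in> closure B" unfolding U_def by blast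
    have "connected (insert E B)"
      using connected_intermediate_closure[OF in_components_connected[OF B(1)], of "insert E B"] B(3) closure_subset[of B] by blast
    hence "insert E B \<subseteq> B"
      using EA in_components_subset[OF B(1)] in_components_nonempty[OF B(1)]
      by (intro components_maximal[OF B(1)]) auto
    thus False using components_nonoverlap[OF B(1) C] B(2) E by blast
  qed
  moreover have "closed U" unfolding U_def using fin by (intro closed_UN) auto
  ultimately obtain \<epsilon> where e: "\<epsilon> > 0" "ball E \<epsilon> \<subseteq> - U"
    using openE[of "- U" E] by (auto simp: open_Compl)
  have "t \<notin> A" if "t \<noteq> E" "\<bar>t - E\<bar> < \<epsilon>" for t
  proof
    assume "t \<in> A"
    then obtain B where B: "B \<in> components A" "t \<in> B" using Union_components[of A] by blast
    hence "B \<noteq> C" using sing that(1) by blast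
    hence "t \<in> U" unfolding U_def using B closure_subset[of B] by blast
    moreover have "t \<in> ball E \<epsilon>" using that(2) by (simp add: dist_real_def abs_minus_commute)
    ultimately show False using e(2) by blast
  qed
  thus ?thesis using EA e(1) by blast
qed

theorem theorem1:
  fixes M :: "nat ^ 'a ^ 'a"
  assumes M1: "\<forall>j. M $ j $ j \<ge> 1"
    and M2: "\<exists>n\<ge>1. \<forall>i k. mat_pow M n $ i $ k > 0"
    and one_label: "CARD('a) = 1 \<longrightarrow> (\<forall>j. M $ j $ j \<ge> 2)"
  shows "\<exists>\<I> :: real set set. finite \<I> \<and> (\<forall>I\<in>\<I>. is_interval I \<and> interior I \<noteq> {}) \<and>
           (\<forall>j :: 'a.
              op_spectrum (tree_vertices M j) (tree_adj_op M j) = complex_of_real ` \<Union>\<I> \<and>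
              purely_absolutely_continuous (tree_vertices M j) (tree_adj_op M j))"
proof -
  have loc: "primitive_cone_tree M" using M1 M2 by unfold_locales
  define A where "A = {E. \<not> (\<exists>g p. real_solution M E g p)}"
  have spec: "op_spectrum (tree_vertices M j) (tree_adj_op M j) = complex_of_real ` A" for j
    unfolding A_def by (rule primitive_cone_tree.op_spectrum_eq[OF loc])
  \<comment> \<open>The regular energies are sorted by the sign pattern of \<open>g\<close>, of
    which there are finitely many; neither side involves the root label.\<close>
  have "A = - (\<Union>S\<in>UNIV. {E. \<exists>g p. real_solution M E g p \<and> {k. g k > 0} = S})"
    unfolding A_def by auto
  hence "finite_interval_union A"
    using finite_interval_union_Inter[of "UNIV :: 'a set set", OF _ is_interval_sign_class] by simp
  hence fin: "finite (components A)" by (rule finite_components_of_interval_union)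
  have "interior C \<noteq> {}" if C: "C \<in> components A" for C
  proof
    assume "interior C = {}"
    then obtain E \<epsilon> where E: "E \<in> A" "\<epsilon> > 0" "\<And>t. t \<noteq> E \<Longrightarrow> \<bar>t - E\<bar> < \<epsilon> \<Longrightarrow> t \<notin> A"
      using isolated_of_degenerate_component[OF fin C] by blast
    have "complex_of_real t \<in> op_spectrum (tree_vertices M j) (tree_adj_op M j) \<longleftrightarrow> t \<in> A" for t j
      unfolding spec by auto
    thus False using primitive_cone_tree.no_isolated_spectrum[OF loc E(2), of E] E by blast
  qed
  moreover have "is_interval C" if "C \<in> components A" for C
    using in_components_connected[OF that] by (simp add: is_interval_connected_1)
  moreover have "purely_absolutely_continuous (tree_vertices M j) (tree_adj_op M j)" for j
    by (rule primitive_cone_tree.purely_absolutely_continuous_L[OF loc])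
  moreover have "\<Union>(components A) = A" using Union_components[of A] by simp
  ultimately show ?thesis using fin spec by (intro exI[of _ "components A"]) auto
qed

end
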